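(* Let $n\ge 3$, let $B_n(\mathbb{S}^2)$ and $P_n(\mathbb{S}^2)$ be the braid group and pure braid group of the $2$-sphere on $n$ strings, and let $$\alpha_0=\sigma_1\cdots\sigma_{n-2}\sigma_{n-1},\qquad \alpha_1=\sigma_1\cdots\sigma_{n-2}\sigma_{n-1}^2,\qquad \alpha_2=\sigma_1\cdots\sigma_{n-3}\sigma_{n-2}^2$$ in $B_n(\mathbb{S}^2)$ (so $\alpha_2=\sigma_1^2$ if $n=3$). Write $\langle\langle x\rangle\rangle$ for the normal closure of $x$ in $B_n(\mathbb{S}^2)$. (a) $\operatorname{G}(B_n(\mathbb{S}^2))=2$, $\operatorname{NG}(B_n(\mathbb{S}^2))=1$ and $\operatorname{TG}(B_n(\mathbb{S}^2))=2$. (b) If $n$ is even, there is no torsion element of $B_n(\mathbb{S}^2)$ whose normal closure is $B_n(\mathbb{S}^2)$. Furthermore, $B_n(\mathbb{S}^2)/\langle\langle\alpha_1\rangle\rangle\cong\mathbb{Z}_2$ (for $n$ even). (c) $\operatorname{NTG}(B_n(\mathbb{S}^2))=1$ if $n$ is odd, and $\operatorname{NTG}(B_n(\mathbb{S}^2))=2$ if $n$ is even. (d) For $i\in\{0,2\}$, the quotient $B_n(\mathbb{S}^2)/\langle\langle\alpha_i\rangle\rangle$ is isomorphic to $\mathbb{Z}_{n-1}$, unless $n=3$ and $i=2$, in which case $B_3(\mathbb{S}^2)/\langle\langle\alpha_2\rangle\rangle\cong S_3$. (e) $\operatorname{G}(P_n(\mathbb{S}^2))=\operatorname{NG}(P_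n(\mathbb{S}^2))=\operatorname{G}(P_n(\mathbb{S}^2)^{\mathrm{Ab}})=(n(n-3)+2)/2$.
   Context: For a compact connected surface $M$, $F_n(M)=\{(p_1,\dots,p_n): p_i\in M,\ p_i\ne p_j \text{ if } i\ne j\}$ is the $n$th configuration space, $D_n(M)=F_n(M)/S_n$ its quotient by the free action of the symmetric group $S_n$ permuting coordinates, $P_n(M)=\pi_1(F_n(M))$ and $B_n(M)=\pi_1(D_n(M))$. There is a short exact sequence $1\to P_n(M)\to B_n(M)\xrightarrow{\pi}S_n\to 1$. The group $B_n(\mathbb{S}^2)$ is generated by $\sigma_1,\dots,\sigma_{n-1}$ subject to the relations $\sigma_i\sigma_j=\sigma_j\sigma_i$ if $|i-j|\ge 2$, $\sigma_i\sigma_{i+1}\sigma_i=\sigma_{i+1}\sigma_i\sigma_{i+1}$ for $1\le i\le n-2$, and $\sigma_1\cdots\sigma_{n-2}\sigma_{n-1}^2\sigma_{n-2}\cdots\sigma_1=1$; $P_n(\mathbb{S}^2)$ is the kernel of the homomorphism $\pi$ to $S_n$ sending $\sigma_i$ to $(i,i+1)$. For a group $\Gamma$, $\Gamma^{\mathrm{Ab}}$ denotes its Abelianisation. $\operatorname{G}(\Gamma)$ (resp. $\operatorname{NG}(\Gamma)$) is the minimal cardinality of a subset $X\subset\Gamma$ such that the subgroup generated by $X$ (resp. the normal closure of $X$) is $\Gamma$. $\operatorname{TG}(\Gamma)$ (resp. $\operatorname{NTG}(\Gamma)$) is the minimal cardinality of a subset $X\subset\Gamma$ consisting of elements of finite order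 such that the subgroup generated by $X$ (resp. the normal closure of $X$) is $\Gamma$. A torsion element is an element of finite order. *)

theory Defs
  imports "HOL-Algebra.Sym_Groups" "HOL-Algebra.Elementary_Groups" "HOL-Library.Extended_Nat"
begin

section \<open>Groups given by generators and relations\<close>

text \<open>
  A word over \<open>S\<close> is a list of signed letters: \<open>(a, True)\<close> stands for \<open>a\<close>
  and \<open>(a, False)\<close> for its formal inverse. A relation \<open>u = v\<close> is a pair \<open>(u, v)\<close> of words.
\<close>

type_synonym 'a word = "('a \<times> bool) list"

definition words :: "'a set \<Rightarrow> 'a word set" where
  "words S = lists (S \<times> UNIV)"

text \<open>
  The least congruence on the monoid of words over \<open>S\<close> that makes formal inverses
  inverse and contains \<open>R\<close>.
\<close>

inductive pres_eq :: "'a set \<Rightarrow> ('a word \<times> 'a word) set \<Rightarrow> 'a word \<Rightarrow> 'a word \<Rightarrow> bool"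
  for S R where
  refl: "w \<in> words S \<Longrightarrow> pres_eq S R w w"
| sym: "pres_eq S R u v \<Longrightarrow> pres_eq S R v u"
| trans: "pres_eq S R u v \<Longrightarrow> pres_eq S R v w \<Longrightarrow> pres_eq S R u w"
| append: "pres_eq S R u u' \<Longrightarrow> pres_eq S R v v' \<Longrightarrow> pres_eq S R (u @ v) (u' @ v')"
| cancel: "a \<in> S \<Longrightarrow> pres_eq S R [(a, b), (a, \<not> b)] []"
| rel: "(u, v) \<in> R \<Longrightarrow> u \<in> words S \<Longrightarrow> v \<in> words S \<Longrightarrow> pres_eq S R u v"

definition pres_class :: "'a set \<Rightarrow> ('a word \<times> 'a word) set \<Rightarrow> 'a word \<Rightarrow> 'a word set" where
  "pres_class S R w = {v. pres_eq S R w v}"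

definition presented_group ::
    "'a set \<Rightarrow> ('a word \<times> 'a word) set \<Rightarrow> 'a word set monoid" where
  "presented_group S R =
     \<lparr> carrier = pres_class S R ` words S,
       mult = (\<lambda>X Y. \<Union>u\<in>X. \<Union>v\<in>Y. pres_class S R (u @ v)),
       one = pres_class S R [] \<rparr>"

definition eval_word :: "('b, 'c) monoid_scheme \<Rightarrow> ('a \<Rightarrow> 'b) \<Rightarrow> 'a word \<Rightarrow> 'b" where
  "eval_word H f w =
     foldr (\<lambda>(a, b) x. (if b then f a else inv\<^bsub>H\<^esub> (f a)) \<otimes>\<^bsub>H\<^esub> x) w \<one>\<^bsub>H\<^esub>"

text \<open>
  The homomorphism to \<open>H\<close> determined by the images \<open>f\<close> of the generators; it is well defined
  as soon as the relations hold in \<open>H\<close> (see \<open>pres_lift_class\<close> and \<open>pres_lift_hom\<close> below).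
\<close>

definition pres_lift :: "('b, 'c) monoid_scheme \<Rightarrow> ('a \<Rightarrow> 'b) \<Rightarrow> 'a word set \<Rightarrow> 'b" where
  "pres_lift H f X = the_elem (eval_word H f ` X)"

lemma words_simps [simp]:
  "[] \<in> words S" "p # w \<in> words S \<longleftrightarrow> fst p \<in> S \<and> w \<in> words S"
  "u @ v \<in> words S \<longleftrightarrow> u \<in> words S \<and> v \<in> words S"
  by (cases p; auto simp: words_def)+

lemma pres_eq_words: "pres_eq S R u v \<Longrightarrow> u \<in> words S \<and> v \<in> words S"
  by (induction rule: pres_eq.induct) auto

lemma pres_class_eq_iff:
  "u \<in> words S \<Longrightarrow> pres_class S R u = pres_class S R v \<longleftrightarrow> pres_eq S R u v"
  unfolding pres_class_def set_eq_iff mem_Collect_eq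
  by (metis pres_eq.refl pres_eq.sym pres_eq.trans)

lemma pres_mult_class:
  assumes "u \<in> words S" "v \<in> words S"
  shows "pres_class S R u \<otimes>\<^bsub>presented_group S R\<^esub> pres_class S R v = pres_class S R (u @ v)"
proof -
  let ?c = "pres_class S R"
  have "?c (u' @ v') = ?c (u @ v)" if "u' \<in> ?c u" "v' \<in> ?c v" for u' v'
  proof -
    have "pres_eq S R (u @ v) (u' @ v')"
      using that pres_eq.append unfolding pres_class_def by blast
    then show ?thesis
      using assms pres_class_eq_iff[of "u @ v" S R "u' @ v'"] by simp
  qed
  then have "(\<Union>u'\<in>?c u. \<Union>v'\<in>?c v. ?c (u' @ v')) = (\<Union>u'\<in>?c u. \<Union>v'\<in>?c v. ?c (u @ v))"
    by (intro SUP_cong HOL.refl)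
  moreover have "u \<in> ?c u" "v \<in> ?c v"
    using assms pres_eq.refl unfolding pres_class_def by blast+
  ultimately show ?thesis
    by (auto simp: presented_group_def)
qed

lemma pres_inverse:
  assumes "w \<in> words S"
  shows "\<exists>v\<in>words S. pres_eq S R (v @ w) []"
  using assms
proof (induction w)
  case Nil
  then show ?case by (intro bexI[of _ "[]"]) (auto intro: pres_eq.refl)
next
  case (Cons p w)
  obtain a b where p: "p = (a, b)" by (cases p)
  from Cons obtain v where v: "v \<in> words S" "pres_eq S R (v @ w) []" by auto
  have a: "a \<in> S" and w: "w \<in> words S" using Cons.prems p by auto
  have "pres_eq S R (v @ ([(a, \<not> b), (a, b)] @ w)) (v @ ([] @ w))"
    using pres_eq.cancel[OF a, of R "\<not> b"] v w by (intro pres_eq.append pres_eq.refl) auto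
  from pres_eq.trans[OF this] v(2) have "pres_eq S R ((v @ [(a, \<not> b)]) @ p # w) []"
    by (simp add: p)
  with v a show ?case by (intro bexI[of _ "v @ [(a, \<not> b)]"]) auto
qed

lemma presented_group_carrier: "carrier (presented_group S R) = pres_class S R ` words S"
  by (simp add: presented_group_def)

lemma presented_group_one: "\<one>\<^bsub>presented_group S R\<^esub> = pres_class S R []"
  by (simp add: presented_group_def)

lemma group_presented_group: "group (presented_group S R)"
proof -
  let ?G = "presented_group S R" and ?c = "pres_class S R"
  have elim: "\<exists>w\<in>words S. x = ?c w" if "x \<in> carrier ?G" for x
    using that unfolding presented_group_carrier by blast
  have closed: "?c w \<in> carrier ?G" if "w \<in> words S" for w
    using that unfolding presented_group_carrier by blast
  show ?thesis
  proof (rule groupI)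
    fix x y assume "x \<in> carrier ?G" "y \<in> carrier ?G"
    then obtain u v where "u \<in> words S" "x = ?c u" "v \<in> words S" "y = ?c v"
      using elim by metis
    then show "x \<otimes>\<^bsub>?G\<^esub> y \<in> carrier ?G"
      using closed[of "u @ v"] by (simp add: pres_mult_class)
  next
    show "\<one>\<^bsub>?G\<^esub> \<in> carrier ?G"
      using closed[of "[]"] by (simp add: presented_group_one)
  next
    fix x y z assume "x \<in> carrier ?G" "y \<in> carrier ?G" "z \<in> carrier ?G"
    then obtain u v w where "u \<in> words S" "x = ?c u" "v \<in> words S" "y = ?c v"
      "w \<in> words S" "z = ?c w"
      using elim by metis
    then show "x \<otimes>\<^bsub>?G\<^esub> y \<otimes>\<^bsub>?G\<^esub> z = x \<otimes>\<^bsub>?G\<^esub> (y \<otimes>\<^bsub>?G\<^esub> z)"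
      by (simp add: pres_mult_class)
  next
    fix x assume "x \<in> carrier ?G"
    then obtain w where w: "w \<in> words S" "x = ?c w"
      using elim by metis
    then show "\<one>\<^bsub>?G\<^esub> \<otimes>\<^bsub>?G\<^esub> x = x"
      by (simp add: pres_mult_class presented_group_one)
    obtain v where v: "v \<in> words S" "pres_eq S R (v @ w) []"
      using pres_inverse[OF w(1)] by metis
    have "?c v \<otimes>\<^bsub>?G\<^esub> x = \<one>\<^bsub>?G\<^esub>"
      using w v pres_class_eq_iff[of "v @ w" S R "[]"]
      by (simp add: pres_mult_class presented_group_one)
    with closed[OF v(1)] show "\<exists>y\<in>carrier ?G. y \<otimes>\<^bsub>?G\<^esub> x = \<one>\<^bsub>?G\<^esub>"
      by (rule bexI[rotated])
  qed
qed

lemma eval_word_simps [simp]: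
  "eval_word H f [] = \<one>\<^bsub>H\<^esub>"
  "eval_word H f ((a, b) # w) = (if b then f a else inv\<^bsub>H\<^esub> (f a)) \<otimes>\<^bsub>H\<^esub> eval_word H f w"
  by (simp_all add: eval_word_def)

context group
begin

lemma eval_word_closed:
  assumes "f ` S \<subseteq> carrier G" "w \<in> words S"
  shows "eval_word G f w \<in> carrier G"
  using assms(2)
proof (induction w)
  case (Cons p w)
  obtain a b where p: "p = (a, b)" by (cases p)
  with Cons.prems assms(1) have "f a \<in> carrier G" by auto
  with Cons p show ?case by simp
qed simp

lemma eval_word_append:
  assumes "f ` S \<subseteq> carrier G" "u \<in> words S" "v \<in> words S"
  shows "eval_word G f (u @ v) = eval_word G f u \<otimes> eval_word G f v"
  using assms(2)
proof (induction u)
  case Nil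
  then show ?case using eval_word_closed[OF assms(1,3)] by simp
next
  case (Cons p u)
  obtain a b where p: "p = (a, b)" by (cases p)
  with Cons.prems assms(1) have "f a \<in> carrier G" "u \<in> words S" by auto
  with Cons.IH p show ?case
    using eval_word_closed[OF assms(1,3)] eval_word_closed[OF assms(1), of u]
    by (simp add: m_assoc)
qed

lemma eval_word_pres_eq:
  assumes "f ` S \<subseteq> carrier G" "\<And>u v. (u, v) \<in> R \<Longrightarrow> eval_word G f u = eval_word G f v"
    and "pres_eq S R u v"
  shows "eval_word G f u = eval_word G f v"
  using assms(3)
proof (induction rule: pres_eq.induct)
  case (sym u v)
  then show ?case by simp
next
  case (trans u v w)
  then show ?case by simp
next
  case (append u u' v v')
  then have "u \<in> words S" "v \<in> words S" "u' \<in> words S" "v' \<in> words S"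
    using pres_eq_words by blast+
  with append.IH show ?case
    by (simp add: eval_word_append[OF assms(1)])
next
  case (cancel a b)
  then have "f a \<in> carrier G" using assms(1) by blast
  then show ?case by simp
next
  case (rel u v)
  then show ?case using assms(2) by blast
qed simp

lemma pres_lift_class:
  assumes "f ` S \<subseteq> carrier G" "\<And>u v. (u, v) \<in> R \<Longrightarrow> eval_word G f u = eval_word G f v"
    and "w \<in> words S"
  shows "pres_lift G f (pres_class S R w) = eval_word G f w"
proof -
  have "eval_word G f v = eval_word G f w" if "v \<in> pres_class S R w" for v
    using eval_word_pres_eq[OF assms(1,2)] that unfolding pres_class_def by (metis mem_Collect_eq)
  moreover have "w \<in> pres_class S R w"
    using pres_eq.refl[OF assms(3)] by (simp add: pres_class_def)
  ultimately have "eval_word G f ` pres_class S R w = {eval_word G f w}"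
    by blast
  then show ?thesis by (simp add: pres_lift_def)
qed

lemma pres_lift_hom:
  assumes "f ` S \<subseteq> carrier G" "\<And>u v. (u, v) \<in> R \<Longrightarrow> eval_word G f u = eval_word G f v"
  shows "pres_lift G f \<in> hom (presented_group S R) G"
  using assms
  by (auto simp: hom_def presented_group_carrier pres_mult_class pres_lift_class[OF assms]
      eval_word_append[OF assms(1)] eval_word_closed[OF assms(1)])

end

section \<open>Braid groups of the sphere\<close>

text \<open>The word \<open>\<sigma>\<^bsub>i\<^sub>1\<^esub> \<dots> \<sigma>\<^bsub>i\<^sub>k\<^esub>\<close> without inverse letters.\<close>

definition sigma_word :: "nat list \<Rightarrow> nat word" where
  "sigma_word is = map (\<lambda>i. (i, True)) is"

text \<open>
  The last relation reads \<open>\<sigma>\<^sub>1 \<dots> \<sigma>\<^bsub>n-2\<^esub> \<sigma>\<^bsub>n-1\<^esub>\<^sup>2 \<sigma>\<^bsub>n-2\<^esub> \<dots> \<sigma>\<^sub>1 = 1\<close>.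
\<close>

definition sphere_braid_rels :: "nat \<Rightarrow> (nat word \<times> nat word) set" where
  "sphere_braid_rels n =
     {(sigma_word [i, j], sigma_word [j, i]) | i j.
        i \<in> {1..<n} \<and> j \<in> {1..<n} \<and> \<bar>int i - int j\<bar> \<ge> 2}
   \<union> {(sigma_word [i, i + 1, i], sigma_word [i + 1, i, i + 1]) | i. 1 \<le> i \<and> i \<le> n - 2}
   \<union> {(sigma_word ([1..<n] @ rev [1..<n]), [])}"

definition sphere_braid_group :: "nat \<Rightarrow> nat word set monoid" where
  "sphere_braid_group n = presented_group {1..<n} (sphere_braid_rels n)"

definition sigma :: "nat \<Rightarrow> nat \<Rightarrow> nat word set" where
  "sigma n i = pres_class {1..<n} (sphere_braid_rels n) [(i, True)]"

definition sigma_prod :: "nat \<Rightarrow> nat list \<Rightarrow> nat word set" where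
  "sigma_prod n is = foldr (\<otimes>\<^bsub>sphere_braid_group n\<^esub>) (map (sigma n) is) \<one>\<^bsub>sphere_braid_group n\<^esub>"

definition braid_perm :: "nat \<Rightarrow> nat word set \<Rightarrow> nat \<Rightarrow> nat" where
  "braid_perm n = pres_lift (sym_group n) (\<lambda>i. transpose i (i + 1))"

definition sphere_pure_braid_group :: "nat \<Rightarrow> nat word set monoid" where
  "sphere_pure_braid_group n =
     (sphere_braid_group n)
       \<lparr> carrier := kernel (sphere_braid_group n) (sym_group n) (braid_perm n) \<rparr>"

text \<open>\<open>\<sigma>\<^sub>1 \<dots> \<sigma>\<^bsub>n-2\<^esub> \<sigma>\<^bsub>n-1\<^esub>\<close>\<close>
definition alpha0 :: "nat \<Rightarrow> nat word set" where
  "alpha0 n = sigma_prod n [1..<n]"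

text \<open>\<open>\<sigma>\<^sub>1 \<dots> \<sigma>\<^bsub>n-2\<^esub> \<sigma>\<^bsub>n-1\<^esub>\<^sup>2\<close>\<close>
definition alpha1 :: "nat \<Rightarrow> nat word set" where
  "alpha1 n = sigma_prod n ([1..<n] @ [n - 1])"

text \<open>\<open>\<sigma>\<^sub>1 \<dots> \<sigma>\<^bsub>n-3\<^esub> \<sigma>\<^bsub>n-2\<^esub>\<^sup>2\<close>\<close>
definition alpha2 :: "nat \<Rightarrow> nat word set" where
  "alpha2 n = sigma_prod n ([1..<n - 1] @ [n - 2])"

lemma group_sphere_braid_group: "group (sphere_braid_group n)"
  by (simp add: sphere_braid_group_def group_presented_group)

lemma sigma_closed: "i \<in> {1..<n} \<Longrightarrow> sigma n i \<in> carrier (sphere_braid_group n)"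
  by (auto simp: sphere_braid_group_def presented_group_carrier sigma_def)

lemma sigma_prod_eq:
  "set is \<subseteq> {1..<n} \<Longrightarrow>
     sigma_prod n is = pres_class {1..<n} (sphere_braid_rels n) (sigma_word is)"
proof (induction "is")
  case Nil
  then show ?case
    by (simp add: sigma_prod_def sigma_word_def sphere_braid_group_def presented_group_one)
next
  case (Cons i "is")
  have "sigma_word is \<in> words {1..<n}"
    using Cons.prems by (auto simp: sigma_word_def words_def)
  with Cons show ?case
    using pres_mult_class[of "[(i, True)]" "{1..<n}" "sigma_word is" "sphere_braid_rels n"]
    by (auto simp: sigma_prod_def sigma_word_def sphere_braid_group_def sigma_def)
qed

lemma transpose_in_sym_group:
  "(\<lambda>i. transpose i (i + 1)) ` {1..<n} \<subseteq> carrier (sym_group n)"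
  by (auto simp: sym_group_carrier intro!: permutes_swap_id)

lemma eval_sigma_word:
  "eval_word (sym_group n) f (sigma_word is) = foldr (\<circ>) (map f is) id"
  by (induction "is") (auto simp: sigma_word_def sym_group_def)

lemma foldr_transpose_palindrome:
  "foldr (\<circ>) (map (\<lambda>i. transpose i (i + 1)) (is @ rev is)) (id :: nat \<Rightarrow> nat) = id"
proof (induction "is")
  case (Cons i "is")
  have foldr_o: "foldr (\<circ>) fs g = foldr (\<circ>) fs id \<circ> g" for fs :: "(nat \<Rightarrow> nat) list" and g
    by (induction fs) (auto simp: comp_assoc)
  let ?t = "\<lambda>i::nat. transpose i (i + 1)"
  have "foldr (\<circ>) (map ?t ((i # is) @ rev (i # is))) id
      = ?t i \<circ> foldr (\<circ>) (map ?t (is @ rev is)) (?t i)"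
    by simp
  also have "\<dots> = ?t i \<circ> (foldr (\<circ>) (map ?t (is @ rev is)) id \<circ> ?t i)"
    using foldr_o[of "map ?t (is @ rev is)" "?t i"] by (rule arg_cong)
  also have "\<dots> = id"
    unfolding Cons.IH by simp
  finally show ?case .
qed auto

lemma sphere_braid_rels_sym_group:
  assumes "(u, v) \<in> sphere_braid_rels n"
  shows "eval_word (sym_group n) (\<lambda>i. transpose i (i + 1)) u =
         eval_word (sym_group n) (\<lambda>i. transpose i (i + 1)) v"
proof -
  consider i j where "u = sigma_word [i, j]" "v = sigma_word [j, i]" "\<bar>int i - int j\<bar> \<ge> 2"
    | i where "u = sigma_word [i, i + 1, i]" "v = sigma_word [i + 1, i, i + 1]"
    | "u = sigma_word ([1..<n] @ rev [1..<n])" "v = sigma_word []"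
    using assms unfolding sphere_braid_rels_def by (auto simp: sigma_word_def)
  then show ?thesis
  proof cases
    case 1
    then show ?thesis by (auto simp: eval_sigma_word transpose_def fun_eq_iff)
  next
    case 2
    then show ?thesis by (auto simp: eval_sigma_word transpose_def fun_eq_iff)
  next
    case 3
    then show ?thesis
      using foldr_transpose_palindrome[of "[1..<n]"] by (simp only: eval_sigma_word) simp
  qed
qed

lemma braid_perm_hom: "braid_perm n \<in> hom (sphere_braid_group n) (sym_group n)"
  unfolding braid_perm_def sphere_braid_group_def
  by (rule group.pres_lift_hom[OF sym_group_is_group transpose_in_sym_group
        sphere_braid_rels_sym_group])

lemma braid_perm_sigma:
  assumes "i \<in> {1..<n}"
  shows "braid_perm n (sigma n i) = transpose i (i + 1)"
proof -
  have "braid_perm n (sigma n i)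
      = eval_word (sym_group n) (\<lambda>i. transpose i (i + 1)) [(i, True)]"
    unfolding braid_perm_def sigma_def
    by (rule group.pres_lift_class[OF sym_group_is_group transpose_in_sym_group
          sphere_braid_rels_sym_group]) (use assms in auto)
  then show ?thesis by (simp add: sym_group_def)
qed

section \<open>Minimal generating and normally generating sets\<close>

text \<open>
  Since \<open>(\<lambda>N. N \<lhd> \<Gamma>) hull X\<close> is the intersection of all normal subgroups containing \<open>X\<close>,
  this is the normal closure of \<open>X \<subseteq> carrier \<Gamma>\<close>.
\<close>

definition normal_closure :: "('a, 'b) monoid_scheme \<Rightarrow> 'a set \<Rightarrow> 'a set" where
  "normal_closure \<Gamma> X = (\<lambda>N. N \<lhd> \<Gamma>) hull X"

definition torsion :: "('a, 'b) monoid_scheme \<Rightarrow> 'a set" where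
  "torsion \<Gamma> = {x \<in> carrier \<Gamma>. \<exists>k::nat. k > 0 \<and> x [^]\<^bsub>\<Gamma>\<^esub> k = \<one>\<^bsub>\<Gamma>\<^esub>}"

definition abelianisation :: "('a, 'b) monoid_scheme \<Rightarrow> 'a set monoid" where
  "abelianisation \<Gamma> = \<Gamma> Mod derived \<Gamma> (carrier \<Gamma>)"

definition ecard :: "'a set \<Rightarrow> enat" where
  "ecard X = (if finite X then enat (card X) else \<infinity>)"

text \<open>
  The minimal cardinalities are extended naturals: the infimum over the empty family of
  generating sets is \<open>\<infinity>\<close>, and a finite value is always attained.
\<close>

definition G_rank :: "('a, 'b) monoid_scheme \<Rightarrow> enat" where
  "G_rank \<Gamma> = (INF X \<in> {X. X \<subseteq> carrier \<Gamma> \<and> generate \<Gamma> X = carrier \<Gamma>}. ecard X)"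

definition NG_rank :: "('a, 'b) monoid_scheme \<Rightarrow> enat" where
  "NG_rank \<Gamma> = (INF X \<in> {X. X \<subseteq> carrier \<Gamma> \<and> normal_closure \<Gamma> X = carrier \<Gamma>}. ecard X)"

definition TG_rank :: "('a, 'b) monoid_scheme \<Rightarrow> enat" where
  "TG_rank \<Gamma> = (INF X \<in> {X. X \<subseteq> torsion \<Gamma> \<and> generate \<Gamma> X = carrier \<Gamma>}. ecard X)"

definition NTG_rank :: "('a, 'b) monoid_scheme \<Rightarrow> enat" where
  "NTG_rank \<Gamma> = (INF X \<in> {X. X \<subseteq> torsion \<Gamma> \<and> normal_closure \<Gamma> X = carrier \<Gamma>}. ecard X)"

end

theory Submission
  imports Defs
begin

text \<open>
  The proof uses the presentation only; the upper bounds are words and the lower bounds are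
  homomorphisms and crossing numbers.

  \<^bold>\<open>Generators of the whole group.\<close> Let \<open>\<delta> = \<sigma>\<^sub>1 \<cdots> \<sigma>\<^bsub>n-1\<^esub>\<close>, which is \<open>\<alpha>\<^sub>0\<close>; then
  \<open>\<alpha>\<^sub>1 = \<delta> \<sigma>\<^bsub>n-1\<^esub>\<close>. Conjugation by \<open>\<delta>\<close> maps \<open>\<sigma>\<^sub>i\<close> to \<open>\<sigma>\<^bsub>i+1\<^esub>\<close> (\<open>shift\<close>), so the two
  elements generate the group. It also follows that \<open>\<delta>\<^sup>n\<close> is central, and
  that \<open>\<delta>\<close> and the reversed product \<open>\<sigma>\<^bsub>n-1\<^esub> \<cdots> \<sigma>\<^sub>1\<close> have the same \<open>n\<close>-th power
  (\<open>partial_reverse_pow\<close>). On the sphere the reversed product is \<open>\<delta>\<^sup>-\<^sup>1\<close>, whence \<open>\<delta>\<^bsup>2n\<^esup> = 1\<close>.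
  Since \<open>\<alpha>\<^sub>1\<^bsup>n-1\<^esup> = \<delta>\<^sup>n\<close>, both generators are torsion elements. The group is not cyclic, because
  the permutations of \<open>\<sigma>\<^sub>1\<close> and \<open>\<sigma>\<^sub>2\<close> do not commute.

  \<^bold>\<open>Quotients.\<close> If some \<open>\<alpha>\<^sub>i\<close> becomes trivial, then generators become equal for two reasons:
  conjugation by a trivial element still shifts indices, and commuting neighbours are equal by the
  braid relation. Except for \<open>\<alpha>\<^sub>2\<close> on three strands, all generators become equal, the quotient is
  cyclic, and only the exponent sum is left (\<open>normal_closure_eq_kernel_exponent\<close>). In the
  exceptional case the squares of the generators become trivial, and the Coxeter presentation of the
  symmetric group is left.

  \<^bold>\<open>Torsion elements for even \<open>n\<close>.\<close> The exponent sum of a normal generator is invertible modulo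
  \<open>2 (n - 1)\<close>. For a torsion element it is even or divisible by \<open>n - 1\<close>
  (\<open>torsion_exponent\<close>), for the following reason. The
  crossing numbers of pairs of strands are determined by the braid up to the contributions of
  strands running around all others (\<open>crossings_equiv_pres_eq\<close>), so the crossing numbers of a
  power that is trivial have the form \<open>2 (c\<^sub>i + c\<^sub>j)\<close>, and one compares parities.

  \<^bold>\<open>The pure braid group.\<close> The twists of two strands generate a normal subgroup. The
  quotient by it satisfies the Coxeter relations, hence (\<open>coxeter_relation\<close>) the twists
  generate all pure braids. The sphere relation and its conjugates express the twists involving the
  last strand through the others (\<open>generate_twists_pred\<close>), and \<open>(n - 1)(n - 2) / 2\<close> twists remain.
  Linking numbers modulo 2, taken around triangles so that the sphere relation does not disturb
  them, are homomorphisms dual to these twists. Dual families of homomorphisms to a group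
  of two elements bound all three ranks from below (\<open>card_le_NG_rank\<close>, \<open>ranks_eq_card\<close>).
\<close>

section \<open>Normal closures and numbers of generators\<close>

lemma (in group) normal_normal_closure:
  assumes "X \<subseteq> carrier G"
  shows "normal_closure G X \<lhd> G"
proof (rule normal_invI)
  let ?\<N> = "{N. N \<lhd> G \<and> X \<subseteq> N}"
  have ne: "carrier G \<in> ?\<N>"
    using assms normal_invI[OF subgroup_self] by auto
  have eq: "normal_closure G X = \<Inter>?\<N>"
    by (simp add: normal_closure_def hull_def)
  have "?\<N> \<noteq> {}"
    using ne by blast
  with subgroups_Inter[of ?\<N>] show "subgroup (normal_closure G X) G"
    using normal_imp_subgroup unfolding eq by blast
  show "x \<otimes> h \<otimes> inv x \<in> normal_closure G X"
    if "x \<in> carrier G" "h \<in> normal_closure G X" for x h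
    using that normal_invE(2) unfolding eq by blast
qed

lemma normal_closure_subset: "X \<subseteq> normal_closure G X"
  by (simp add: normal_closure_def hull_subset)

lemma normal_closure_minimal: "N \<lhd> G \<Longrightarrow> X \<subseteq> N \<Longrightarrow> normal_closure G X \<subseteq> N"
  by (simp add: normal_closure_def hull_minimal)

lemma (in group) normal_closure_incl:
  assumes "X \<subseteq> carrier G"
  shows "normal_closure G X \<subseteq> carrier G"
  using normal_imp_subgroup[OF normal_normal_closure[OF assms]] subgroup.subset by blast

lemma (in group) generate_subset_normal_closure:
  assumes "X \<subseteq> carrier G"
  shows "generate G X \<subseteq> normal_closure G X"
  by (rule generate_subgroup_incl[OF normal_closure_subset
        normal_imp_subgroup[OF normal_normal_closure[OF assms]]])

lemma (in group) normal_closure_if_generate: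
  assumes "X \<subseteq> carrier G" "generate G X = carrier G"
  shows "normal_closure G X = carrier G"
  using generate_subset_normal_closure[OF assms(1)] normal_closure_incl[OF assms(1)] assms(2) by blast

lemma (in group) normal_closure_empty: "normal_closure G {} = {\<one>}"
proof
  have "{\<one>} \<lhd> G"
    by (rule normal_invI[OF triv_subgroup]) auto
  then show "normal_closure G {} \<subseteq> {\<one>}"
    by (rule normal_closure_minimal) simp
  show "{\<one>} \<subseteq> normal_closure G {}"
    using subgroup.one_closed[OF normal_imp_subgroup[OF normal_normal_closure[of "{}"]]] by simp
qed

lemma (in comm_group) commutator_eq_one:
  assumes "x \<in> carrier G" "y \<in> carrier G"
  shows "x \<otimes> y \<otimes> inv x \<otimes> inv y = \<one>"
  using assms by (metis inv_closed inv_mult_group m_assoc m_closed m_comm r_inv)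

lemma torsion_subset: "torsion \<Gamma> \<subseteq> carrier \<Gamma>"
  by (auto simp: torsion_def)

lemma NG_le_G:
  assumes "group \<Gamma>"
  shows "NG_rank \<Gamma> \<le> G_rank \<Gamma>"
  unfolding NG_rank_def G_rank_def
  by (rule INF_superset_mono) (use group.normal_closure_if_generate[OF assms] in auto)

lemma G_le_TG: "G_rank \<Gamma> \<le> TG_rank \<Gamma>"
  unfolding TG_rank_def G_rank_def
  by (rule INF_superset_mono) (use torsion_subset[of \<Gamma>] in \<open>auto dest: subset_trans\<close>)

lemma NTG_le_TG:
  assumes "group \<Gamma>"
  shows "NTG_rank \<Gamma> \<le> TG_rank \<Gamma>"
  unfolding NTG_rank_def TG_rank_def
  by (rule INF_superset_mono)
     (use group.normal_closure_if_generate[OF assms] torsion_subset[of \<Gamma>] in \<open>auto dest: subset_trans\<close>)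

lemma ecard_less_2_cases:
  assumes "ecard X < 2"
  obtains "X = {}" | x where "X = {x}"
proof -
  have "finite X" "card X < 2"
    using assms by (auto simp: ecard_def numeral_eq_enat split: if_splits)
  then show thesis
    using that by (metis card_0_eq card_1_singletonE less_2_cases_iff One_nat_def)
qed

lemma ecard_image_le: "finite I \<Longrightarrow> ecard (f ` I) \<le> enat (card I)"
  using card_image_le by (auto simp: ecard_def)

lemma ecard_less_1_iff: "ecard X < 1 \<longleftrightarrow> X = {}"
  by (auto simp: ecard_def one_enat_def)

lemma (in group) one_le_NG:
  assumes "carrier G \<noteq> {\<one>}"
  shows "1 \<le> NG_rank G"
  unfolding NG_rank_def
proof (rule INF_greatest, clarsimp)
  fix X assume "normal_closure G X = carrier G"
  with assms have "X \<noteq> {}" using normal_closure_empty by auto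
  then show "1 \<le> ecard X"
    using ecard_less_1_iff[of X] by (meson not_le)
qed

lemma NG_le_NTG: "NG_rank \<Gamma> \<le> NTG_rank \<Gamma>"
  unfolding NTG_rank_def NG_rank_def
  by (rule INF_superset_mono) (use torsion_subset[of \<Gamma>] in \<open>auto dest: subset_trans\<close>)

lemma (in group) two_le_G:
  assumes "x \<in> carrier G" "y \<in> carrier G" "x \<otimes> y \<noteq> y \<otimes> x"
  shows "2 \<le> G_rank G"
  unfolding G_rank_def
proof (rule INF_greatest, clarsimp)
  fix X assume X: "X \<subseteq> carrier G" "generate G X = carrier G"
  show "2 \<le> ecard X"
  proof (rule ccontr)
    assume "\<not> 2 \<le> ecard X"
    then have "ecard X < 2" by simp
    then show False
    proof (cases rule: ecard_less_2_cases)
      case 1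
      then have "carrier G = {\<one>}" using X generate_empty by simp
      with assms show False by auto
    next
      case (2 a)
      then have a: "a \<in> carrier G" using X by auto
      then have "carrier G = {a [^] (k::int) | k. k \<in> UNIV}"
        using X 2 generate_pow by simp
      with assms(1,2) obtain k l :: int where "x = a [^] k" "y = a [^] l" by auto
      with assms(3) show False
        using a by (simp add: int_pow_mult[symmetric] add.commute)
    qed
  qed
qed

text \<open>
  Homomorphisms \<open>\<phi> i\<close> to the group of two elements kill conjugation, so on the normal closure
  of \<open>X\<close> the vector \<open>(\<phi> i x)\<^sub>i\<close> is the sum of the vectors of the members of some subset
  of \<open>X\<close>. If all \<open>2\<^bsup>card I\<^esup>\<close> vectors occur, then \<open>X\<close> has at least \<open>card I\<close> elements.
\<close>

lemma (in group) card_le_NG_rank: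
  fixes I :: "'i set" and \<phi> :: "'i \<Rightarrow> 'a \<Rightarrow> int"
  assumes "finite I"
    and hom: "\<And>i. i \<in> I \<Longrightarrow> \<phi> i \<in> hom G (integer_mod_group 2)"
    and p: "\<And>i. i \<in> I \<Longrightarrow> p i \<in> carrier G"
    and dual: "\<And>i j. i \<in> I \<Longrightarrow> j \<in> I \<Longrightarrow> \<phi> j (p i) = of_bool (i = j)"
  shows "enat (card I) \<le> NG_rank G"
  unfolding NG_rank_def
proof (rule INF_greatest, clarsimp)
  fix X assume X: "X \<subseteq> carrier G" "normal_closure G X = carrier G"
  show "enat (card I) \<le> ecard X"
  proof (cases "finite X")
    case False
    then show ?thesis by (simp add: ecard_def)
  next
    case finX: True
    have mult: "\<phi> i (x \<otimes> y) = (\<phi> i x + \<phi> i y) mod 2" if "i \<in> I" "x \<in> carrier G" "y \<in> carrier G" for i x y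
      using hom_mult[OF hom[OF that(1)] that(2,3)] by simp
    then have oddm: "odd (\<phi> i (x \<otimes> y)) = (odd (\<phi> i x) \<noteq> odd (\<phi> i y))" 
      if "i \<in> I" "x \<in> carrier G" "y \<in> carrier G" for i x y
      using that by simp
    have odd1: "\<not> odd (\<phi> i \<one>)" if "i \<in> I" for i
      using oddm[OF that, of \<one> \<one>] by auto
    have oddi: "odd (\<phi> i (inv x)) = odd (\<phi> i x)" if "i \<in> I" "x \<in> carrier G" for i x
      using oddm[OF that(1), of "inv x" x] odd1[OF that(1)] that by simp
    define Od where "Od x = {i \<in> I. odd (\<phi> i x)}" for x
    define S where "S Y = {i \<in> I. odd (\<Sum>y\<in>Y. \<phi> i y)}" for Y
    have Omult: "Od (x \<otimes> y) = (Od x - Od y) \<union> (Od y - Od x)" if "x \<in> carrier G" "y \<in> carrier G" for x y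
      using oddm that unfolding Od_def by auto
    have Oinv: "Od (inv x) = Od x" if "x \<in> carrier G" for x
      using oddi that unfolding Od_def by auto
    have S_add: "(S Y - S Z) \<union> (S Z - S Y) = S ((Y - Z) \<union> (Z - Y))" if "Y \<subseteq> X" "Z \<subseteq> X" for Y Z
    proof -
      have fin: "finite Y" "finite Z" using that finX finite_subset by auto
      have "odd (\<Sum>y\<in>(Y - Z) \<union> (Z - Y). \<phi> i y) = (odd (\<Sum>y\<in>Y. \<phi> i y) \<noteq> odd (\<Sum>y\<in>Z. \<phi> i y))" for i
      proof -
        have "(\<Sum>y\<in>Y. \<phi> i y) + (\<Sum>y\<in>Z. \<phi> i y)
            = (\<Sum>y\<in>(Y - Z) \<union> (Z - Y). \<phi> i y) + 2 * (\<Sum>y\<in>Y \<inter> Z. \<phi> i y)"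
          using fin sum.Int_Diff[of Y "\<phi> i" Z] sum.Int_Diff[of Z "\<phi> i" Y]
            sum.union_disjoint[of "Y - Z" "Z - Y" "\<phi> i"]
          by (simp add: Int_commute disjoint_iff)
        moreover have parity: "odd c = (odd a \<noteq> odd b)" if "a + b = c + 2 * d" for a b c d :: int
          using that by presburger
        ultimately show ?thesis by (intro parity)
      qed
      then show ?thesis unfolding S_def by blast
    qed
    define H where "H = {x \<in> carrier G. Od x \<in> S ` Pow X}"
    have "S {} = {}" by (simp add: S_def)
    have H1: "\<one> \<in> H"
      using odd1 \<open>S {} = {}\<close> unfolding H_def Od_def by force
    have Hm: "x \<otimes> y \<in> H" if "x \<in> H" "y \<in> H" for x y
    proof -
      from that obtain Y Z where YZ: "Y \<subseteq> X" "Od x = S Y" "Z \<subseteq> X" "Od y = S Z"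
          "x \<in> carrier G" "y \<in> carrier G"
        unfolding H_def by auto
      then have "Od (x \<otimes> y) = S ((Y - Z) \<union> (Z - Y))"
        using S_add Omult by simp
      moreover have "(Y - Z) \<union> (Z - Y) \<in> Pow X" using YZ by blast
      ultimately show ?thesis using YZ unfolding H_def by blast
    qed
    have "H \<lhd> G"
    proof (rule normal_invI)
      show "subgroup H G"
        by (rule subgroupI) (use H1 Hm Oinv in \<open>auto simp: H_def\<close>)
      show "x \<otimes> h \<otimes> inv x \<in> H" if "x \<in> carrier G" "h \<in> H" for x h
      proof -
        have h: "h \<in> carrier G" using that H_def by auto
        have "Od (x \<otimes> h \<otimes> inv x) = Od h"
          using Omult[of "x \<otimes> h" "inv x"] Omult[of x h] Oinv[of x] that h by auto
        then show ?thesis using that h unfolding H_def by auto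
      qed
    qed
    moreover have "X \<subseteq> H"
    proof
      fix x assume x: "x \<in> X"
      then have "Od x = S {x}" by (simp add: Od_def S_def)
      then show "x \<in> H" using x X unfolding H_def by blast
    qed
    ultimately have H: "carrier G \<subseteq> H"
      using normal_closure_minimal X(2) by metis
    have attained: "\<exists>x\<in>carrier G. Od x = J" if "finite J" "J \<subseteq> I" for J
      using that
    proof (induction J rule: finite_induct)
      case empty
      show ?case using odd1 unfolding Od_def by (intro bexI[of _ \<one>]) auto
    next
      case (insert i J)
      then obtain x where x: "x \<in> carrier G" "Od x = J" by auto
      have "Od (p i) = {i}" using insert.prems dual[of i] by (auto simp: Od_def)
      then have "Od (p i \<otimes> x) = insert i J"
        using Omult[of "p i" x] x p[of i] insert by auto
      with x p[of i] insert.prems show ?case by (intro bexI[of _ "p i \<otimes> x"]) auto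
    qed
    have "Pow I \<subseteq> Od ` carrier G"
    proof
      fix J assume "J \<in> Pow I"
      then have "J \<subseteq> I" by simp
      from attained[OF finite_subset[OF this assms(1)] this] show "J \<in> Od ` carrier G" by blast
    qed
    also have "\<dots> \<subseteq> S ` Pow X" using H unfolding H_def by auto
    finally have "card (Pow I) \<le> card (S ` Pow X)"
      using finX by (intro card_mono) auto
    also have "\<dots> \<le> card (Pow X)" using finX by (intro card_image_le) auto
    finally have "(2::nat) ^ card I \<le> 2 ^ card X"
      using finX assms(1) by (simp add: card_Pow)
    then have "card I \<le> card X" by simp
    then show ?thesis using finX by (simp add: ecard_def)
  qed
qed

text \<open>
  Homomorphisms to an abelian group factor through the abelianisation, so the same lower bound
  holds there; together with the upper bound by the size of a generating set, the ranks of the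
  group and of its abelianisation are determined.
\<close>

lemma (in group) ranks_eq_card:
  fixes I :: "'i set" and \<phi> :: "'i \<Rightarrow> 'a \<Rightarrow> int"
  assumes "finite I"
    and hom: "\<And>i. i \<in> I \<Longrightarrow> \<phi> i \<in> hom G (integer_mod_group 2)"
    and p: "\<And>i. i \<in> I \<Longrightarrow> p i \<in> carrier G"
    and dual: "\<And>i j. i \<in> I \<Longrightarrow> j \<in> I \<Longrightarrow> \<phi> j (p i) = of_bool (i = j)"
    and gen: "generate G (p ` I) = carrier G"
  shows "G_rank G = enat (card I)" "NG_rank G = enat (card I)"
    and "G_rank (abelianisation G) = enat (card I)"
proof -
  have sub: "p ` I \<subseteq> carrier G" using p by auto
  have "G_rank G \<le> ecard (p ` I)"
    unfolding G_rank_def by (rule INF_lower) (use sub gen in auto)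
  then have up: "G_rank G \<le> enat (card I)" using ecard_image_le[OF assms(1)] order_trans by blast
  have low: "enat (card I) \<le> NG_rank G"
    by (rule card_le_NG_rank[OF assms(1) hom p dual])
  show "G_rank G = enat (card I)" "NG_rank G = enat (card I)"
    using up low NG_le_G[OF group_axioms] by auto
  let ?D = "derived G (carrier G)"
  have D: "?D \<lhd> G" by (rule derived_self_is_normal)
  interpret Q: group "abelianisation G"
    unfolding abelianisation_def by (rule normal.factorgroup_is_group[OF D])
  have proj: "(\<lambda>a. ?D #> a) \<in> hom G (abelianisation G)"
    unfolding abelianisation_def by (rule normal.r_coset_hom_Mod[OF D])
  interpret pr: group_hom G "abelianisation G" "\<lambda>a. ?D #> a"
    by (simp add: group_hom_def group_hom_axioms_def group_axioms Q.group_axioms proj)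
  have "\<exists>g. g \<in> hom (abelianisation G) (integer_mod_group 2) \<and>
            (\<forall>x\<in>carrier G. g (?D #> x) = \<phi> i x)" if i: "i \<in> I" for i
  proof -
    interpret h: group_hom G "integer_mod_group 2" "\<phi> i"
      by (simp add: group_hom_def group_hom_axioms_def group_axioms hom[OF i])
    have "?D \<subseteq> kernel G (integer_mod_group 2) (\<phi> i)"
      unfolding derived_def
    proof (rule generate_subgroup_incl[OF _ h.subgroup_kernel], clarify)
      fix a b assume ab: "a \<in> carrier G" "b \<in> carrier G"
      then have "\<phi> i (a \<otimes> b \<otimes> inv a \<otimes> inv b) = \<one>\<^bsub>integer_mod_group 2\<^esub>"
        using comm_group.commutator_eq_one[OF abelian_integer_mod_group, of "\<phi> i a" 2 "\<phi> i b"]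
        by (simp only: h.hom_mult h.hom_inv h.hom_closed m_closed inv_closed)
      then show "a \<otimes> b \<otimes> inv a \<otimes> inv b \<in> kernel G (integer_mod_group 2) (\<phi> i)"
        using ab by (simp only: kernel_def mem_Collect_eq m_closed inv_closed)
    qed
    then show ?thesis
      using h.FactGroup_universal_kernel[OF D] unfolding abelianisation_def by metis
  qed
  then obtain \<psi> where \<psi>: "\<And>i. i \<in> I \<Longrightarrow> \<psi> i \<in> hom (abelianisation G) (integer_mod_group 2)"
      "\<And>i x. i \<in> I \<Longrightarrow> x \<in> carrier G \<Longrightarrow> \<psi> i (?D #> x) = \<phi> i x"
    by metis
  have "enat (card I) \<le> NG_rank (abelianisation G)"
    by (rule Q.card_le_NG_rank[OF assms(1) \<psi>(1), where p = "\<lambda>i. ?D #> p i"])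
       (use p dual \<psi>(2) in auto)
  moreover have "G_rank (abelianisation G) \<le> ecard ((\<lambda>i. ?D #> p i) ` I)"
    unfolding G_rank_def
  proof (rule INF_lower, clarsimp, rule conjI)
    show "(\<lambda>i. ?D #> p i) ` I \<subseteq> carrier (abelianisation G)" using p by auto
    show "generate (abelianisation G) ((\<lambda>i. ?D #> p i) ` I) = carrier (abelianisation G)"
      using pr.generate_img[OF sub] gen
      by (simp add: image_image abelianisation_def carrier_FactGroup)
  qed
  ultimately show "G_rank (abelianisation G) = enat (card I)"
    using NG_le_G[OF Q.group_axioms] ecard_image_le[OF assms(1), of "\<lambda>i. ?D #> p i"] by auto
qed

section \<open>Elements satisfying the braid relations\<close>

context group
begin

definition prodl :: "'a list \<Rightarrow> 'a" where
  "prodl xs = foldr (\<otimes>) xs \<one>"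

lemma prodl_simps [simp]: "prodl [] = \<one>" "prodl (x # xs) = x \<otimes> prodl xs"
  by (simp_all add: prodl_def)

lemma prodl_closed [simp, intro]: "set xs \<subseteq> carrier G \<Longrightarrow> prodl xs \<in> carrier G"
  by (induction xs) auto

lemma prodl_append:
  "set xs \<subseteq> carrier G \<Longrightarrow> set ys \<subseteq> carrier G \<Longrightarrow> prodl (xs @ ys) = prodl xs \<otimes> prodl ys"
  by (induction xs) (auto simp: m_assoc)

lemma prodl_commute:
  assumes "x \<in> carrier G" "set ys \<subseteq> carrier G" "\<And>y. y \<in> set ys \<Longrightarrow> x \<otimes> y = y \<otimes> x"
  shows "x \<otimes> prodl ys = prodl ys \<otimes> x"
  using assms(2,3)
proof (induction ys)
  case (Cons y ys)
  then have c: "y \<in> carrier G" "prodl ys \<in> carrier G" by auto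
  have "x \<otimes> (y \<otimes> prodl ys) = y \<otimes> (x \<otimes> prodl ys)"
    using c assms(1) Cons.prems(2)[of y] by (simp add: m_assoc[symmetric])
  also have "\<dots> = y \<otimes> prodl ys \<otimes> x"
    using c assms(1) Cons by (simp add: m_assoc)
  finally show ?case by simp
qed (use assms(1) in simp)

lemma prodl_in_subgroup: "subgroup H G \<Longrightarrow> set xs \<subseteq> H \<Longrightarrow> prodl xs \<in> H"
  by (induction xs) (auto intro: subgroup.one_closed subgroup.m_closed)

abbreviation conj_by :: "'a \<Rightarrow> 'a \<Rightarrow> 'a" where
  "conj_by g x \<equiv> g \<otimes> x \<otimes> inv g"

lemma conj_by_closed: "g \<in> carrier G \<Longrightarrow> x \<in> carrier G \<Longrightarrow> conj_by g x \<in> carrier G"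
  by simp

lemma conj_by_mult:
  "g \<in> carrier G \<Longrightarrow> x \<in> carrier G \<Longrightarrow> y \<in> carrier G
    \<Longrightarrow> conj_by g (x \<otimes> y) = conj_by g x \<otimes> conj_by g y"
  by (simp add: m_assoc inv_solve_left)

lemma conj_by_conj_by:
  "g \<in> carrier G \<Longrightarrow> h \<in> carrier G \<Longrightarrow> x \<in> carrier G
    \<Longrightarrow> conj_by g (conj_by h x) = conj_by (g \<otimes> h) x"
  by (simp add: m_assoc inv_mult_group)

lemma conj_by_eq_iff:
  "g \<in> carrier G \<Longrightarrow> x \<in> carrier G \<Longrightarrow> y \<in> carrier G
    \<Longrightarrow> conj_by g x = y \<longleftrightarrow> g \<otimes> x = y \<otimes> g"
  by (metis inv_solve_right m_closed)

lemma conj_by_hom: "g \<in> carrier G \<Longrightarrow> group_hom G G (conj_by g)"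
  by (simp add: group_hom_def group_hom_axioms_def group_axioms hom_def conj_by_mult)

lemma conj_by_prodl:
  assumes "g \<in> carrier G" "set xs \<subseteq> carrier G"
  shows "conj_by g (prodl xs) = prodl (map (conj_by g) xs)"
  using assms(2)
proof (induction xs)
  case (Cons x xs)
  then show ?case using assms(1) conj_by_mult[of g x "prodl xs"] by simp
qed (use assms(1) in simp)

lemma conj_by_generate:
  assumes "g \<in> carrier G" "X \<subseteq> carrier G" "\<And>x. x \<in> X \<Longrightarrow> conj_by g x \<in> generate G Y"
    and "Y \<subseteq> carrier G" "x \<in> generate G X"
  shows "conj_by g x \<in> generate G Y"
proof -
  interpret c: group_hom G G "conj_by g" by (rule conj_by_hom[OF assms(1)])
  have "conj_by g x \<in> generate G (conj_by g ` X)"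
    using c.generate_img[OF assms(2)] assms(5) by blast
  also have "\<dots> \<subseteq> generate G Y"
    using assms(3) by (intro generate_subgroup_incl generate_is_subgroup assms(4)) auto
  finally show ?thesis .
qed

end

text \<open>
  The braid groups, their quotients and the symmetric groups all contain elements satisfying
  the braid relations, so what follows from these relations alone is proved once for all of them.
\<close>

locale braid_system = group G for G :: "('a, 'b) monoid_scheme" (structure) +
  fixes n :: nat and s :: "nat \<Rightarrow> 'a"
  assumes s_closed [simp, intro]: "i \<in> {1..<n} \<Longrightarrow> s i \<in> carrier G"
    and far: "i \<in> {1..<n} \<Longrightarrow> j \<in> {1..<n} \<Longrightarrow> i + 2 \<le> j \<Longrightarrow> s i \<otimes> s j = s j \<otimes> s i"
    and braid: "1 \<le> i \<Longrightarrow> i + 1 < n \<Longrightarrow> s i \<otimes> s (i+1) \<otimes> s i = s (i+1) \<otimes> s i \<otimes> s (i+1)"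
begin

definition pr :: "nat list \<Rightarrow> 'a" where
  "pr is = prodl (map s is)"

lemma pr_simps [simp]: "pr [] = \<one>" "pr (i # is) = s i \<otimes> pr is"
  by (simp_all add: pr_def)

lemma pr_closed [simp, intro]: "set is \<subseteq> {1..<n} \<Longrightarrow> pr is \<in> carrier G"
  unfolding pr_def by (intro prodl_closed) auto

lemma pr_append:
  "set is \<subseteq> {1..<n} \<Longrightarrow> set js \<subseteq> {1..<n} \<Longrightarrow> pr (is @ js) = pr is \<otimes> pr js"
  unfolding pr_def map_append by (intro prodl_append) auto

lemma far': "i \<in> {1..<n} \<Longrightarrow> j \<in> {1..<n} \<Longrightarrow> i + 2 \<le> j \<or> j + 2 \<le> i \<Longrightarrow> s i \<otimes> s j = s j \<otimes> s i"
  using far by metis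

lemma pr_commute:
  assumes "set is \<subseteq> {1..<n}" "i \<in> {1..<n}" "\<And>j. j \<in> set is \<Longrightarrow> i + 2 \<le> j \<or> j + 2 \<le> i"
  shows "s i \<otimes> pr is = pr is \<otimes> s i"
  unfolding pr_def
proof (rule prodl_commute)
  fix y assume "y \<in> set (map s is)"
  then obtain j where "j \<in> set is" "y = s j" by auto
  then show "s i \<otimes> y = y \<otimes> s i"
    using far'[of i j] assms by blast
qed (use assms in auto)

lemma pr_commute_pr:
  assumes "set is \<subseteq> {1..<n}" "set js \<subseteq> {1..<n}"
    and "\<And>i j. i \<in> set is \<Longrightarrow> j \<in> set js \<Longrightarrow> i + 2 \<le> j \<or> j + 2 \<le> i"
  shows "pr is \<otimes> pr js = pr js \<otimes> pr is"
  unfolding pr_def[of js]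
proof (rule prodl_commute)
  fix y assume "y \<in> set (map s js)"
  then obtain j where j: "j \<in> set js" "y = s j" by auto
  then have "s j \<otimes> pr is = pr is \<otimes> s j"
    using assms by (intro pr_commute) blast+
  with j show "pr is \<otimes> y = y \<otimes> pr is" by simp
qed (use assms in auto)

text \<open>
  Conjugation by \<open>s\<^sub>j \<cdots> s\<^bsub>m-1\<^esub>\<close> shifts indices: only the braid relation between \<open>s\<^sub>i\<close> and
  \<open>s\<^bsub>i+1\<^esub>\<close> matters, the other factors commute with \<open>s\<^sub>i\<close> or with \<open>s\<^bsub>i+1\<^esub>\<close>.
\<close>

lemma shift:
  assumes "1 \<le> j" "j \<le> i" "i + 1 < m" "m \<le> n"
  shows "pr [j..<m] \<otimes> s i = s (i+1) \<otimes> pr [j..<m]"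
proof -
  have split: "[j..<m] = [j..<i] @ i # (i+1) # [i+2..<m]"
    using assms upt_add_eq_append[of j i "m - i"] by (simp add: upt_conv_Cons)
  let ?a = "pr [j..<i]" and ?b = "pr [i+2..<m]" and ?x = "s i" and ?y = "s (i+1)"
  have c: "?a \<in> carrier G" "?b \<in> carrier G" "?x \<in> carrier G" "?y \<in> carrier G"
    using assms by auto
  have xb: "?x \<otimes> ?b = ?b \<otimes> ?x" and ya: "?y \<otimes> ?a = ?a \<otimes> ?y"
    using assms by (auto intro!: pr_commute)
  have eq: "pr [j..<m] = ?a \<otimes> (?x \<otimes> (?y \<otimes> ?b))"
    unfolding split using assms by (subst pr_append) auto
  have "pr [j..<m] \<otimes> ?x = ?a \<otimes> (?x \<otimes> (?y \<otimes> (?b \<otimes> ?x)))"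
    using c eq by (simp add: m_assoc)
  also have "\<dots> = ?a \<otimes> (?x \<otimes> (?y \<otimes> (?x \<otimes> ?b)))"
    by (simp only: xb)
  also have "\<dots> = ?a \<otimes> (?x \<otimes> ?y \<otimes> ?x \<otimes> ?b)"
    using c by (simp add: m_assoc)
  also have "?x \<otimes> ?y \<otimes> ?x = ?y \<otimes> ?x \<otimes> ?y"
    using braid assms by simp
  also have "?a \<otimes> (?y \<otimes> ?x \<otimes> ?y \<otimes> ?b) = (?a \<otimes> ?y) \<otimes> (?x \<otimes> (?y \<otimes> ?b))"
    using c by (simp add: m_assoc)
  also have "\<dots> = ?y \<otimes> pr [j..<m]"
    using c eq ya by (simp add: m_assoc[symmetric])
  finally show ?thesis .
qed

text \<open>
  When the two generators of a braid relation commute, the relation cancels to their equality. This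
  identifies generators that shifting does not reach.
\<close>

lemma commuting_neighbours_eq:
  assumes "1 \<le> i" "i + 1 < n" "s i \<otimes> s (i+1) = s (i+1) \<otimes> s i"
  shows "s (i+1) = s i"
proof -
  have c: "s i \<in> carrier G" "s (i+1) \<in> carrier G" using assms by auto
  have "s (i+1) \<otimes> s i \<otimes> s i = s (i+1) \<otimes> s i \<otimes> s (i+1)"
    using braid[OF assms(1,2)] assms(3) by simp
  then show ?thesis using c by simp
qed

end

lemma (in group) hom_prodl:
  assumes "h \<in> hom G H" "group H" "set xs \<subseteq> carrier G"
  shows "h (prodl xs) = group.prodl H (map h xs)"
proof -
  interpret h: group_hom G H h
    by (simp add: group_hom_def group_hom_axioms_def group_axioms assms)
  show ?thesis using assms(3) by (induction xs) auto
qed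

lemma (in braid_system) hom_braid_system:
  assumes h: "h \<in> hom G H" and "group H"
  shows "braid_system H n (h \<circ> s)"
proof -
  interpret H: group H by fact
  have m: "h x \<otimes>\<^bsub>H\<^esub> h y = h (x \<otimes> y)" if "x \<in> carrier G" "y \<in> carrier G" for x y
    using hom_mult[OF h that] by simp
  show ?thesis
  proof
    show "(h \<circ> s) i \<in> carrier H" if "i \<in> {1..<n}" for i
      using h that by (auto simp: hom_def)
  next
    fix i j assume ij: "i \<in> {1..<n}" "j \<in> {1..<n}" "i + 2 \<le> j"
    then show "(h \<circ> s) i \<otimes>\<^bsub>H\<^esub> (h \<circ> s) j = (h \<circ> s) j \<otimes>\<^bsub>H\<^esub> (h \<circ> s) i"
      using far[OF ij] by (simp add: m)
  next
    fix i assume i: "1 \<le> i" "i + 1 < n"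
    then show "(h \<circ> s) i \<otimes>\<^bsub>H\<^esub> (h \<circ> s) (i+1) \<otimes>\<^bsub>H\<^esub> (h \<circ> s) i =
        (h \<circ> s) (i+1) \<otimes>\<^bsub>H\<^esub> (h \<circ> s) i \<otimes>\<^bsub>H\<^esub> (h \<circ> s) (i+1)"
      using braid[OF i] by (simp add: m)
  qed
qed

lemma (in braid_system) hom_pr:
  assumes h: "h \<in> hom G H" and "group H" "set is \<subseteq> {1..<n}"
  shows "h (pr is) = braid_system.pr H (h \<circ> s) is"
proof -
  interpret H: braid_system H n "h \<circ> s" by (rule hom_braid_system[OF h assms(2)])
  have "set (map s is) \<subseteq> carrier G" using assms(3) by auto
  from hom_prodl[OF h assms(2) this] show ?thesis
    by (simp add: pr_def H.pr_def)
qed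

locale sphere_braid_system = braid_system +
  assumes n_ge: "3 \<le> n"
    and sphere: "pr ([1..<n] @ rev [1..<n]) = \<one>"
begin

lemma hom_sphere_braid_system:
  assumes h: "h \<in> hom G H" and "group H"
  shows "sphere_braid_system H n (h \<circ> s)"
proof -
  interpret H: braid_system H n "h \<circ> s" by (rule hom_braid_system[OF assms])
  interpret h: group_hom G H h
    by (simp add: group_hom_def group_hom_axioms_def group_axioms assms H.group_axioms)
  show ?thesis
  proof
    show "3 \<le> n" by (rule n_ge)
    show "H.pr ([1..<n] @ rev [1..<n]) = \<one>\<^bsub>H\<^esub>"
      using hom_pr[OF assms, of "[1..<n] @ rev [1..<n]"] sphere by auto
  qed
qed

end

section \<open>Torsion in the braid group of the sphere\<close>

context braid_system
begin

abbreviation \<delta> :: 'a where "\<delta> \<equiv> pr [1..<n]"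

lemma shift_pr:
  assumes "1 \<le> j" "m \<le> n" "\<And>i. i \<in> set is \<Longrightarrow> j \<le> i \<and> i + 1 < m"
  shows "pr [j..<m] \<otimes> pr is = pr (map Suc is) \<otimes> pr [j..<m]"
  using assms(3)
proof (induction "is")
  case Nil
  have "pr [j..<m] \<in> carrier G" using assms by auto
  then show ?case by simp
next
  case (Cons i "is")
  have i: "j \<le> i" "i + 1 < m" using Cons.prems[of i] by auto
  have "set is \<subseteq> {1..<n}" "set (map Suc is) \<subseteq> {1..<n}"
    using Cons.prems assms(1,2) by force+
  then have c: "pr [j..<m] \<in> carrier G" "pr is \<in> carrier G" "pr (map Suc is) \<in> carrier G"
      "s i \<in> carrier G" "s (Suc i) \<in> carrier G"
    using i assms(1,2) by auto
  have "pr [j..<m] \<otimes> pr (i # is) = s (Suc i) \<otimes> (pr [j..<m] \<otimes> pr is)"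
    using c shift[OF assms(1) i assms(2)] by (simp add: m_assoc[symmetric])
  also have "\<dots> = pr (map Suc (i # is)) \<otimes> pr [j..<m]"
    using c Cons by (simp add: m_assoc)
  finally show ?case .
qed

lemma delta_closed: "\<delta> \<in> carrier G" by auto

lemma delta_sq:
  assumes "2 \<le> n"
  shows "\<delta> [^] (2::nat) \<otimes> s (n - 1) = s 1 \<otimes> \<delta> [^] (2::nat)"
proof -
  have c: "pr [1..<n-1] \<in> carrier G" "pr [2..<n] \<in> carrier G" "s 1 \<in> carrier G" "s (n-1) \<in> carrier G"
    using assms by auto
  have "\<delta> = pr ([1..<n-1] @ [n-1])" using assms upt_Suc_append[of 1 "n-1"] by simp
  also have "\<dots> = pr [1..<n-1] \<otimes> pr [n-1]" by (rule pr_append) (use assms in auto)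
  finally have snoc: "pr [1..<n-1] \<otimes> s (n-1) = \<delta>" using c by simp
  have cons: "s 1 \<otimes> pr [2..<n] = \<delta>"
    using assms by (simp add: upt_conv_Cons numeral_2_eq_2)
  have "map Suc [1..<n-1] = [2..<n]" using assms by (simp add: map_Suc_upt numeral_2_eq_2)
  moreover have "\<delta> \<otimes> pr [1..<n-1] = pr (map Suc [1..<n-1]) \<otimes> \<delta>"
    by (rule shift_pr) (use assms in auto)
  ultimately have mv: "\<delta> \<otimes> pr [1..<n-1] = pr [2..<n] \<otimes> \<delta>" by metis
  have sq: "\<delta> [^] (2::nat) = \<delta> \<otimes> \<delta>" using delta_closed by (simp add: numeral_2_eq_2)
  have "s 1 \<otimes> (\<delta> \<otimes> \<delta>) = s 1 \<otimes> (\<delta> \<otimes> (pr [1..<n-1] \<otimes> s (n-1)))"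
    by (simp only: snoc)
  also have "\<dots> = s 1 \<otimes> ((\<delta> \<otimes> pr [1..<n-1]) \<otimes> s (n-1))"
    using delta_closed c by (simp only: m_assoc m_closed)
  also have "\<dots> = (s 1 \<otimes> pr [2..<n]) \<otimes> \<delta> \<otimes> s (n-1)"
    unfolding mv using delta_closed c by (simp only: m_assoc m_closed)
  also have "\<dots> = \<delta> \<otimes> \<delta> \<otimes> s (n-1)"
    by (simp only: cons)
  finally show ?thesis by (simp only: sq)
qed

lemma delta_pow_shift:
  assumes "1 \<le> i" "i + k < n"
  shows "\<delta> [^] k \<otimes> s i = s (i + k) \<otimes> \<delta> [^] k"
  using assms
proof (induction k)
  case (Suc k)
  then have c: "s i \<in> carrier G" "s (i + k) \<in> carrier G" "s (i + Suc k) \<in> carrier G" by auto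
  have "\<delta> [^] Suc k \<otimes> s i = \<delta> \<otimes> (\<delta> [^] k \<otimes> s i)"
    using c delta_closed by (simp only: nat_pow_Suc2 m_assoc nat_pow_closed)
  also have "\<dots> = (\<delta> \<otimes> s (i + k)) \<otimes> \<delta> [^] k"
    using Suc c delta_closed by (simp add: m_assoc)
  also have "\<dots> = s (i + Suc k) \<otimes> \<delta> \<otimes> \<delta> [^] k"
    using shift[of 1 "i + k" n] Suc.prems by simp
  also have "\<dots> = s (i + Suc k) \<otimes> \<delta> [^] Suc k"
    using c delta_closed by (simp only: nat_pow_Suc2 m_assoc nat_pow_closed)
  finally show ?case .
qed simp

text \<open>
  Conjugation by \<open>\<delta>\<close> moves \<open>s\<^sub>i\<close> through \<open>s\<^bsub>i+1\<^esub>, \<dots>, s\<^bsub>n-1\<^esub>\<close>, and two more steps lead from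
  \<open>s\<^bsub>n-1\<^esub>\<close> back to \<open>s\<^sub>1\<close>.
\<close>

lemma delta_pow_wrap:
  assumes "1 \<le> k" "k < n"
  shows "\<delta> [^] (k + 1) \<otimes> s (n - 1) = s k \<otimes> \<delta> [^] (k + 1)"
proof -
  have c: "s 1 \<in> carrier G" "s k \<in> carrier G" "s (n - 1) \<in> carrier G" using assms by auto
  have k: "\<delta> [^] (k + 1) = \<delta> [^] (k - 1) \<otimes> \<delta> [^] (2::nat)"
    using delta_closed assms nat_pow_mult[of \<delta> "k - 1" 2] by simp
  have "\<delta> [^] (k + 1) \<otimes> s (n - 1) = \<delta> [^] (k - 1) \<otimes> (\<delta> [^] (2::nat) \<otimes> s (n - 1))"
    unfolding k using c delta_closed by (simp only: m_assoc nat_pow_closed)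
  also have "\<dots> = \<delta> [^] (k - 1) \<otimes> (s 1 \<otimes> \<delta> [^] (2::nat))"
    using delta_sq assms by simp
  also have "\<dots> = (\<delta> [^] (k - 1) \<otimes> s 1) \<otimes> \<delta> [^] (2::nat)"
    using c delta_closed by (simp only: m_assoc nat_pow_closed)
  also have "\<dots> = s k \<otimes> \<delta> [^] (k - 1) \<otimes> \<delta> [^] (2::nat)"
    using delta_pow_shift[of 1 "k - 1"] assms by simp
  also have "\<dots> = s k \<otimes> \<delta> [^] (k + 1)"
    unfolding k using c delta_closed by (simp only: m_assoc nat_pow_closed)
  finally show ?thesis .
qed

lemma delta_pow_n_central_s:
  assumes "i \<in> {1..<n}"
  shows "s i \<otimes> \<delta> [^] n = \<delta> [^] n \<otimes> s i"
proof -
  have i: "1 \<le> i" "i < n" and c: "s i \<in> carrier G" "s (n - 1) \<in> carrier G" using assms by auto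
  have k: "\<delta> [^] n = \<delta> [^] (i + 1) \<otimes> \<delta> [^] (n - 1 - i)"
    using delta_closed i nat_pow_mult[of \<delta> "i + 1" "n - 1 - i"] by simp
  have "\<delta> [^] n \<otimes> s i = \<delta> [^] (i + 1) \<otimes> (\<delta> [^] (n - 1 - i) \<otimes> s i)"
    unfolding k using c delta_closed by (simp only: m_assoc nat_pow_closed)
  also have "\<dots> = \<delta> [^] (i + 1) \<otimes> (s (n - 1) \<otimes> \<delta> [^] (n - 1 - i))"
    using delta_pow_shift[of i "n - 1 - i"] i by simp
  also have "\<dots> = \<delta> [^] (i + 1) \<otimes> s (n - 1) \<otimes> \<delta> [^] (n - 1 - i)"
    using c delta_closed by (simp only: m_assoc nat_pow_closed)
  also have "\<dots> = s i \<otimes> \<delta> [^] (i + 1) \<otimes> \<delta> [^] (n - 1 - i)"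
    by (simp only: delta_pow_wrap[OF i])
  also have "\<dots> = s i \<otimes> \<delta> [^] n"
    unfolding k using c delta_closed by (simp only: m_assoc nat_pow_closed)
  finally show ?thesis by simp
qed

lemma delta_pow_n_central:
  assumes "set is \<subseteq> {1..<n}"
  shows "\<delta> [^] n \<otimes> pr is = pr is \<otimes> \<delta> [^] n"
  unfolding pr_def[of "is"]
proof (rule prodl_commute)
  fix y assume "y \<in> set (map s is)"
  then show "\<delta> [^] n \<otimes> y = y \<otimes> \<delta> [^] n"
    using delta_pow_n_central_s assms by auto
qed (use assms delta_closed in auto)

lemma pow_intertwine:
  assumes "x \<in> carrier G" "y \<in> carrier G" "z \<in> carrier G" "x \<otimes> z = z \<otimes> y"
  shows "x [^] (k::nat) \<otimes> z = z \<otimes> y [^] k"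
proof (induction k)
  case (Suc k)
  have "x [^] Suc k \<otimes> z = x [^] k \<otimes> (x \<otimes> z)" using assms by (simp add: m_assoc)
  also have "\<dots> = (x [^] k \<otimes> z) \<otimes> y" using assms by (simp add: m_assoc)
  also have "\<dots> = z \<otimes> y [^] Suc k" unfolding Suc using assms by (simp add: m_assoc)
  finally show ?case .
qed (use assms in simp)

text \<open>
  The products of all generators in the orders \<open>1, \<dots>, n-1\<close> and \<open>n-1, \<dots>, 1\<close> are conjugate:
  with \<open>X = s\<^sub>m \<cdots> s\<^sub>1\<close> and \<open>Y = s\<^bsub>m+2\<^esub> \<cdots> s\<^bsub>n-1\<^esub>\<close>, the element \<open>X s\<^bsub>m+1\<^esub> Y\<close> is
  conjugate by \<open>X\<close> to \<open>s\<^bsub>m+1\<^esub> Y X = s\<^bsub>m+1\<^esub> X Y\<close>. As the \<open>n\<close>-th power of the first product is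
  central, all these products have the same \<open>n\<close>-th power.
\<close>

lemma partial_reverse_pow:
  assumes "m < n"
  shows "pr (rev [1..<Suc m] @ [Suc m..<n]) [^] n = \<delta> [^] n"
  using assms
proof (induction m)
  case 0
  then show ?case by simp
next
  case (Suc m)
  let ?X = "pr (rev [1..<Suc m])" and ?s = "s (Suc m)" and ?Y = "pr [Suc (Suc m)..<n]"
  let ?c = "pr (rev [1..<Suc m] @ [Suc m..<n])" and ?d = "pr (rev [1..<Suc (Suc m)] @ [Suc (Suc m)..<n])"
  have car: "?X \<in> carrier G" "?s \<in> carrier G" "?Y \<in> carrier G" using Suc.prems by auto
  have XY: "?X \<otimes> ?Y = ?Y \<otimes> ?X"
    using Suc.prems by (intro pr_commute_pr) auto
  have c: "?c = ?X \<otimes> (?s \<otimes> ?Y)"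
    using Suc.prems by (subst pr_append) (auto simp: upt_conv_Cons)
  have "pr (rev [1..<Suc (Suc m)]) = ?s \<otimes> ?X" by simp
  then have d: "?d = ?s \<otimes> ?X \<otimes> ?Y"
    using Suc.prems by (subst pr_append) auto
  have "?c \<otimes> ?X = ?X \<otimes> (?s \<otimes> (?Y \<otimes> ?X))"
    unfolding c using car by (simp add: m_assoc)
  also have "\<dots> = ?X \<otimes> ?d"
    unfolding d XY[symmetric] using car by (simp add: m_assoc)
  finally have "?c [^] n \<otimes> ?X = ?X \<otimes> ?d [^] n"
    using car c d by (intro pow_intertwine) auto
  then have "?X \<otimes> ?d [^] n = ?X \<otimes> \<delta> [^] n"
    using Suc delta_pow_n_central[of "rev [1..<Suc m]"] by (auto simp del: upt_Suc)
  moreover have "?d \<in> carrier G" using car d by simp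
  ultimately show ?case using car delta_closed by (simp del: upt_Suc)
qed

text \<open>
  In \<open>(\<delta> s\<^bsub>n-1\<^esub>)\<^bsup>n-1\<^esup>\<close> all powers of \<open>\<delta>\<close> can be moved to the right, at the price of
  conjugating \<open>s\<^bsub>n-1\<^esub>\<close>. By the wrapping rule the conjugates are \<open>t, s\<^sub>1, \<dots>, s\<^bsub>n-2\<^esub>\<close>
  with \<open>t = \<delta> s\<^bsub>n-1\<^esub> \<delta>\<^sup>-\<^sup>1\<close>; their product is conjugate by \<open>\<delta>\<close> to \<open>s\<^sub>1 \<cdots> s\<^bsub>n-1\<^esub> = \<delta>\<close>.
\<close>

lemma delta_s_pow:
  assumes "2 \<le> n"
  shows "(\<delta> \<otimes> s (n - 1)) [^] (n - 1) = \<delta> [^] n"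
proof -
  have c: "s (n - 1) \<in> carrier G" using assms by auto
  define t where "t k = conj_by (\<delta> [^] (k + 1)) (s (n - 1))" for k :: nat
  have tc: "t k \<in> carrier G" for k unfolding t_def using c delta_closed by simp
  have tset: "set (map t ks) \<subseteq> carrier G" for ks using tc by auto
  have ts: "t k = s k" if "1 \<le> k" "k < n" for k
    unfolding t_def using that c delta_closed delta_pow_wrap[OF that]
    by (subst conj_by_eq_iff) auto
  have tSuc: "conj_by \<delta> (t k) = t (Suc k)" for k
    unfolding t_def using c delta_closed nat_pow_Suc2[OF delta_closed, of "k + 1"]
    by (subst conj_by_conj_by) auto
  have pw: "(\<delta> \<otimes> s (n - 1)) [^] k = prodl (map t [0..<k]) \<otimes> \<delta> [^] k" for k
  proof (induction k)
    case (Suc k)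
    let ?p = "prodl (map t [0..<k])"
    have p: "?p \<in> carrier G" using tset by blast
    have "t k \<otimes> \<delta> [^] (k + 1) = \<delta> [^] (k + 1) \<otimes> s (n - 1)"
      unfolding t_def using c delta_closed by (simp only: m_assoc nat_pow_closed inv_closed m_closed l_inv r_one)
    moreover have "(\<delta> \<otimes> s (n - 1)) [^] Suc k = ?p \<otimes> (\<delta> [^] (k + 1) \<otimes> s (n - 1))"
      using Suc p c delta_closed by (simp add: m_assoc)
    moreover have "prodl (map t [0..<Suc k]) = ?p \<otimes> t k"
      using prodl_append[OF tset, of "[t k]" "[0..<k]"] tc by simp
    ultimately show ?case using p tc delta_closed by (simp add: m_assoc)
  qed (use delta_closed in simp)
  let ?p = "prodl (map t [0..<n-1])"
  have p: "?p \<in> carrier G" using tset by blast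
  have "conj_by \<delta> ?p = prodl (map (conj_by \<delta>) (map t [0..<n-1]))"
    by (rule conj_by_prodl[OF delta_closed tset])
  also have "map (conj_by \<delta>) (map t [0..<n-1]) = map t (map Suc [0..<n-1])"
    using tSuc by simp
  also have "map Suc [0..<n-1] = [1..<n]" using assms by (simp add: map_Suc_upt)
  also have "map t [1..<n] = map s [1..<n]" using ts by simp
  also have "prodl (map s [1..<n]) = \<delta>" by (simp add: pr_def)
  finally have "\<delta> \<otimes> ?p = \<delta> \<otimes> \<delta>"
    using conj_by_eq_iff[OF delta_closed p delta_closed] by simp
  then have "?p = \<delta>" using p delta_closed by simp
  moreover have "\<delta> [^] n = \<delta> \<otimes> \<delta> [^] (n - 1)"
    using nat_pow_Suc2[OF delta_closed, of "n - 1"] assms by simp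
  ultimately show ?thesis unfolding pw by simp
qed

lemma pr_alpha1: "2 \<le> n \<Longrightarrow> pr ([1..<n] @ [n - 1]) = \<delta> \<otimes> s (n - 1)"
  by (subst pr_append) auto

end

context sphere_braid_system
begin

text \<open>
  On the sphere the reversed product is inverse to \<open>\<delta>\<close>. Since both have the same \<open>n\<close>-th power,
  \<open>\<delta>\<^sup>n\<close> is its own inverse.
\<close>

lemma delta_pow_2n: "\<delta> [^] (2 * n) = \<one>"
proof -
  let ?r = "pr (rev [1..<n])"
  have r: "?r \<in> carrier G" by auto
  have "\<delta> \<otimes> ?r = \<one>" using sphere by (subst (asm) pr_append) auto
  then have r1: "?r \<otimes> \<delta> = \<one>" using r delta_closed inv_comm by blast
  have "?r [^] n = \<delta> [^] n"
    using partial_reverse_pow[of "n - 1"] n_ge by simp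
  moreover have "?r [^] n \<otimes> \<delta> [^] n = (?r \<otimes> \<delta>) [^] n"
    using r delta_closed r1 \<open>\<delta> \<otimes> ?r = \<one>\<close> by (intro pow_mult_distrib[symmetric]) auto
  ultimately have "\<delta> [^] n \<otimes> \<delta> [^] n = \<one>" using r1 by simp
  then show ?thesis using delta_closed by (simp add: nat_pow_mult mult_2)
qed

lemma alpha1_pow: "pr ([1..<n] @ [n - 1]) [^] (2 * (n - 1)) = \<one>"
proof -
  let ?e = "\<delta> \<otimes> s (n - 1)"
  have e: "?e \<in> carrier G" using n_ge by auto
  have "?e [^] (2 * (n - 1)) = (?e [^] (n - 1)) [^] (2::nat)"
    using nat_pow_pow[OF e, of "n - 1" 2] by (simp add: mult.commute)
  also have "\<dots> = \<delta> [^] (n * 2)"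
    using delta_s_pow n_ge delta_closed by (simp add: nat_pow_pow)
  finally show ?thesis using delta_pow_2n pr_alpha1 n_ge by (simp add: mult.commute)
qed

end

section \<open>Quotients by one element\<close>

context braid_system
begin

text \<open>
  The quotient of the two elements is the last generator, and conjugation by \<open>\<delta>\<close> leads from
  it down to all the others.
\<close>

lemma generate_alpha0_alpha1:
  assumes "2 \<le> n"
  shows "s ` {1..<n} \<subseteq> generate G {\<delta>, pr ([1..<n] @ [n - 1])}"
proof -
  let ?H = "generate G {\<delta>, \<delta> \<otimes> s (n - 1)}"
  have sn: "s (n - 1) \<in> carrier G" using assms by auto
  have H: "subgroup ?H G"
    using sn delta_closed by (intro generate_is_subgroup) auto
  have d: "\<delta> \<in> ?H" "\<delta> \<otimes> s (n - 1) \<in> ?H" by (auto intro: generate.incl)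
  have "inv \<delta> \<otimes> (\<delta> \<otimes> s (n - 1)) \<in> ?H"
    by (rule subgroup.m_closed[OF H subgroup.m_inv_closed[OF H d(1)] d(2)])
  then have last: "s (n - 1) \<in> ?H"
    using sn delta_closed by (simp add: m_assoc[symmetric])
  have "s (n - Suc k) \<in> ?H" if "Suc k < n" for k
    using that
  proof (induction k)
    case 0
    show ?case using last by simp
  next
    case (Suc k)
    define i where "i = n - Suc (Suc k)"
    have i: "1 \<le> i" "i + 1 < n" "n - Suc k = i + 1" using Suc.prems by (auto simp: i_def)
    have c: "s i \<in> carrier G" "s (i + 1) \<in> carrier G" using i by auto
    have "s i = inv \<delta> \<otimes> s (i + 1) \<otimes> \<delta>"
      using shift[of 1 i n] i c delta_closed by (simp add: m_assoc inv_solve_left)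
    moreover have "s (i + 1) \<in> ?H" using Suc i by simp
    ultimately show ?case
      using d H unfolding i_def[symmetric]
      by (simp add: subgroup.m_closed subgroup.m_inv_closed)
  qed
  then have "s i \<in> ?H" if "i \<in> {1..<n}" for i
    using that spec[of "\<lambda>k. Suc k < n \<longrightarrow> s (n - Suc k) \<in> ?H" "n - Suc i"] by fastforce
  then show ?thesis using pr_alpha1[OF assms] by auto
qed

lemma normal_subgroup_contains_all:
  assumes "N \<lhd> G" "s 1 \<in> N" "i \<in> {1..<n}"
  shows "s i \<in> N"
  using assms(3)
proof (induction i)
  case (Suc i)
  show ?case
  proof (cases "i = 0")
    case False
    then have i: "1 \<le> i" "i + 1 < n" using Suc.prems by auto
    then have c: "s i \<in> carrier G" "s (i + 1) \<in> carrier G" by auto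
    have "conj_by \<delta> (s i) = s (i + 1)"
      using shift[of 1 i n] i c delta_closed by (subst conj_by_eq_iff) auto
    moreover have "conj_by \<delta> (s i) \<in> N"
      using Suc i by (intro normal_invE(2)[OF assms(1)] delta_closed) auto
    ultimately show ?thesis by simp
  qed (use assms(2) in simp)
qed simp

lemma pr_const:
  assumes "x \<in> carrier G" "\<And>i. i \<in> set is \<Longrightarrow> s i = x"
  shows "pr is = x [^] length is"
  using assms(2)
proof (induction "is")
  case (Cons i "is")
  then have "pr (i # is) = x \<otimes> x [^] length is" by simp
  then show ?case using assms(1) nat_pow_Suc2 by simp
qed simp

lemma eq_first:
  assumes "\<And>i. 1 \<le> i \<Longrightarrow> i + 1 < m \<Longrightarrow> s (i + 1) = s i" "i \<in> {1..<m}"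
  shows "s i = s 1"
  using assms(2)
proof (induction i)
  case (Suc i)
  then show ?case using assms(1)[of i] by (cases "i = 0") auto
qed simp

text \<open>
  A trivial product conjugates trivially, but it also shifts the indices.
\<close>

lemma collapse_alpha0:
  assumes "pr [1..<n] = \<one>" "2 \<le> n"
  shows "i \<in> {1..<n} \<Longrightarrow> s i = s 1" "s 1 [^] (n - 1) = \<one>"
proof -
  have step: "s (i + 1) = s i" if "1 \<le> i" "i + 1 < n" for i
  proof -
    have "s i \<in> carrier G" "s (i + 1) \<in> carrier G" using that by auto
    then show ?thesis using shift[of 1 i n] that assms(1) by simp
  qed
  show all: "s i = s 1" if "i \<in> {1..<n}" for i
    by (rule eq_first[OF step that])
  have "pr [1..<n] = s 1 [^] length [1..<n]"
    proof (rule pr_const)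
      show "s 1 \<in> carrier G" using assms(2) by auto
    qed (rule all, use assms(2) in auto)
  then show "s 1 [^] (n - 1) = \<one>" using assms(1) by simp
qed

text \<open>
  The additional factor at the end commutes with \<open>s\<^sub>i\<close>, so the product still shifts \<open>s\<^sub>i\<close> to
  \<open>s\<^bsub>i+1\<^esub>\<close>; being trivial, it makes them equal.
\<close>

lemma collapse_shift:
  assumes "pr ([1..<m] @ [m - 1]) = \<one>" "1 \<le> i" "i + 2 < m" "m \<le> n"
  shows "s (i + 1) = s i"
proof -
  have c: "pr [1..<m] \<in> carrier G" "s i \<in> carrier G" "s (i+1) \<in> carrier G"
    using assms by auto
  have "m - 1 \<in> {1..<n}" using assms by auto
  then have c': "s (m - 1) \<in> carrier G" by (rule s_closed)
  note c = c c'
  have "pr ([1..<m] @ [m - 1]) = pr [1..<m] \<otimes> pr [m - 1]"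
    by (rule pr_append) (use assms in auto)
  then have e: "pr [1..<m] \<otimes> s (m - 1) = \<one>"
    using assms(1) c' by simp
  have f: "s i \<otimes> s (m - 1) = s (m - 1) \<otimes> s i"
    using assms by (intro far) auto
  have "s i = pr [1..<m] \<otimes> (s (m - 1) \<otimes> s i)"
    using e c by (simp add: m_assoc[symmetric])
  also have "\<dots> = (pr [1..<m] \<otimes> s i) \<otimes> s (m - 1)"
    unfolding f[symmetric] using c by (simp add: m_assoc)
  also have "\<dots> = s (i + 1) \<otimes> (pr [1..<m] \<otimes> s (m - 1))"
    using shift[of 1 i m] assms c by (simp add: m_assoc)
  finally show ?thesis using e c by simp
qed

text \<open>
  Shifting only reaches \<open>s\<^bsub>n-3\<^esub>\<close>, but \<open>s\<^bsub>n-2\<^esub>\<close> and then \<open>s\<^bsub>n-1\<^esub>\<close> commute with their left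
  neighbours: these equal \<open>s\<^sub>1\<close>, which is far enough away, or, for the pair \<open>s\<^sub>1, s\<^sub>2\<close> on four
  strands, the relation \<open>s\<^sub>1 s\<^sub>2\<^sup>2 = 1\<close> writes \<open>s\<^sub>1\<close> as a power of \<open>s\<^sub>2\<close>.
\<close>

lemma collapse_alpha2:
  assumes "pr ([1..<n - 1] @ [n - 2]) = \<one>" "4 \<le> n"
  shows "i \<in> {1..<n} \<Longrightarrow> s i = s 1" "s 1 [^] (n - 1) = \<one>"
proof -
  have rel: "pr ([1..<n - 1] @ [n - 1 - 1]) = \<one>" using assms(1) by (simp add: numeral_2_eq_2)
  have c: "s i \<in> carrier G" if "i \<in> {1..<n}" for i using that by auto
  have low: "s i = s 1" if "i \<in> {1..<n - 2}" for i
    by (rule eq_first[OF collapse_shift[OF rel] that]) auto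
  have s3: "s (n - 3) = s 1" using assms(2) by (intro low) auto
  have "s (n - 3) \<otimes> s (n - 2) = s (n - 2) \<otimes> s (n - 3)"
  proof (cases "n = 4")
    case True
    then have n: "n = Suc (Suc (Suc (Suc 0)))" by simp
    have c2: "s 1 \<in> carrier G" "s 2 \<in> carrier G" using n by (auto simp: numeral_2_eq_2)
    have e: "s 1 \<otimes> (s 2 \<otimes> s 2) = \<one>"
      using assms(1) c2 n by (simp add: upt_conv_Cons numeral_2_eq_2)
    have "s 1 = inv (s 2 \<otimes> s 2)"
      using e c2 by (simp add: inv_equality)
    then have "s 1 \<otimes> s 2 = s 2 \<otimes> s 1"
      using c2 by (simp add: inv_mult_group m_assoc[symmetric]) (simp add: m_assoc)
    then show ?thesis using n by (simp add: numeral_2_eq_2)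
  next
    case False
    have "s 1 \<otimes> s (n - 2) = s (n - 2) \<otimes> s 1"
      using assms(2) False by (intro far) auto
    then show ?thesis using s3 by simp
  qed
  then have "s (n - 3 + 1) = s (n - 3)"
    using assms(2) by (intro commuting_neighbours_eq) (auto simp: Suc_diff_Suc numeral_eq_Suc)
  moreover have "n - 3 + 1 = n - 2" using assms(2) by simp
  ultimately have s2: "s (n - 2) = s 1" using s3 by simp
  have "s 1 \<otimes> s (n - 1) = s (n - 1) \<otimes> s 1"
    using assms(2) by (intro far) auto
  moreover have n1: "n - 2 + 1 = n - 1" using assms(2) by simp
  ultimately have "s (n - 2 + 1) = s (n - 2)"
    using assms(2) s2 by (intro commuting_neighbours_eq) auto
  then have s1: "s (n - 1) = s 1" using s2 n1 by simp
  show all: "s i = s 1" if "i \<in> {1..<n}" for i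
  proof -
    have "i < n - 2 \<or> i = n - 2 \<or> i = n - 1" using that by auto
    with low[of i] s1 s2 that show ?thesis by (metis atLeastLessThan_iff)
  qed
  have "pr ([1..<n - 1] @ [n - 2]) = s 1 [^] length ([1..<n - 1] @ [n - 2])"
    proof (rule pr_const)
      show "s 1 \<in> carrier G" using assms(2) by auto
    qed (rule all, use assms(2) in auto)
  moreover have "length ([1..<n - 1] @ [n - 2]) = n - 1" using assms(2) by simp
  ultimately show "s 1 [^] (n - 1) = \<one>" using assms(1) by metis
qed

end

context sphere_braid_system
begin

text \<open>
  The sphere relation is \<open>\<alpha>\<^sub>1 s\<^bsub>n-2\<^esub> \<cdots> s\<^sub>1 = 1\<close>, so \<open>s\<^bsub>n-2\<^esub> \<cdots> s\<^sub>1\<close> becomes trivial together with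
  \<open>\<alpha>\<^sub>1\<close>. On three strands this says \<open>s\<^sub>1 = 1\<close>, and the braid relation gives \<open>s\<^sub>2 = 1\<close>. On
  more strands \<open>s\<^bsub>n-2\<^esub>\<close> equals \<open>s\<^sub>1\<close> by shifting, so it commutes with \<open>s\<^bsub>n-1\<^esub>\<close>.
\<close>

lemma collapse_alpha1:
  assumes "pr ([1..<n] @ [n - 1]) = \<one>"
  shows "i \<in> {1..<n} \<Longrightarrow> s i = s 1" "s 1 [^] (2::nat) = \<one>" "s 1 [^] (n - 2) = \<one>"
proof -
  have c: "s i \<in> carrier G" if "i \<in> {1..<n}" for i using that by auto
  have c1: "s 1 \<in> carrier G" "s (n - 1) \<in> carrier G" using n_ge by auto
  have low: "s i = s 1" if "i \<in> {1..<n - 1}" for i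
    by (rule eq_first[OF collapse_shift[OF assms] that]) auto
  have pl: "pr (rev [1..<n - 1]) = s 1 [^] (n - 2)"
  proof -
    have "pr (rev [1..<n - 1]) = s 1 [^] length (rev [1..<n - 1])"
      proof (rule pr_const)
        show "s 1 \<in> carrier G" using n_ge by auto
      qed (rule low, use n_ge in auto)
    then show ?thesis by (simp add: numeral_2_eq_2)
  qed
  have "[1..<n] @ rev [1..<n] = ([1..<n] @ [n - 1]) @ rev [1..<n - 1]"
    using n_ge upt_Suc_append[of 1 "n - 1"] by simp
  then have "pr (([1..<n] @ [n - 1]) @ rev [1..<n - 1]) = \<one>" using sphere by simp
  then have "pr ([1..<n] @ [n - 1]) \<otimes> pr (rev [1..<n - 1]) = \<one>"
    using n_ge by (subst (asm) pr_append) auto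
  moreover have "pr (rev [1..<n - 1]) \<in> carrier G" by auto
  ultimately show p: "s 1 [^] (n - 2) = \<one>" using assms pl c1 by simp
  show all: "s i = s 1" if "i \<in> {1..<n}" for i
  proof (cases "n = 3")
    case True
    then have one: "s 1 = \<one>" using p c1 by simp
    have "s 1 \<otimes> s (1 + 1) \<otimes> s 1 = s (1 + 1) \<otimes> s 1 \<otimes> s (1 + 1)"
      using True by (intro braid) auto
    then have "s 2 = s 2 \<otimes> s 2"
      using one c1 True by (simp add: numeral_2_eq_2)
    then have "s 2 = \<one>" using c[of 2] True by simp
    moreover have "i = 1 \<or> i = 2" using that True by auto
    ultimately show ?thesis using one by auto
  next
    case False
    have "s (n - 2) = s 1" using n_ge by (intro low) auto
    moreover have "s 1 \<otimes> s (n - 1) = s (n - 1) \<otimes> s 1"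
      using n_ge False by (intro far) auto
    moreover have n1: "n - 2 + 1 = n - 1" using n_ge by simp
    ultimately have "s (n - 2 + 1) = s (n - 2)"
      using n_ge by (intro commuting_neighbours_eq) auto
    then have "s (n - 1) = s 1" using \<open>s (n - 2) = s 1\<close> n1 by simp
    moreover have "i < n - 1 \<or> i = n - 1" using that by auto
    ultimately show ?thesis using low[of i] that by (metis atLeastLessThan_iff)
  qed
  have "pr ([1..<n] @ [n - 1]) = s 1 [^] length ([1..<n] @ [n - 1])"
    proof (rule pr_const)
      show "s 1 \<in> carrier G" using n_ge by auto
    qed (rule all, use n_ge in auto)
  moreover have "length ([1..<n] @ [n - 1]) = (n - 2) + 2" using n_ge by simp
  ultimately have "s 1 [^] (n - 2) \<otimes> s 1 [^] (2::nat) = \<one>"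
    using assms c1 by (simp only: nat_pow_mult)
  then show "s 1 [^] (2::nat) = \<one>" using p c1 by simp
qed

end

section \<open>Generators of the pure braid group\<close>

context braid_system
begin

text \<open>
  The pure braid in which the strands \<open>i < j\<close> wind around each other once.
\<close>

definition twist :: "nat \<Rightarrow> nat \<Rightarrow> 'a" where
  "twist i j = conj_by (pr (rev [Suc i..<j])) (s i \<otimes> s i)"

lemma twist_closed [simp, intro]:
  "1 \<le> i \<Longrightarrow> i < j \<Longrightarrow> j \<le> n \<Longrightarrow> twist i j \<in> carrier G"
  unfolding twist_def by (intro conj_by_closed m_closed pr_closed s_closed) auto

lemma twist_neighbours: "1 \<le> i \<Longrightarrow> i < n \<Longrightarrow> twist i (Suc i) = s i \<otimes> s i"
  by (simp add: twist_def)

lemma twist_Suc: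
  assumes "1 \<le> i" "i < j" "j < n"
  shows "twist i (Suc j) = conj_by (s j) (twist i j)"
proof -
  have c: "pr (rev [Suc i..<j]) \<in> carrier G" "s i \<in> carrier G" "s j \<in> carrier G" using assms by auto
  then have "conj_by (s j) (twist i j) = conj_by (s j \<otimes> pr (rev [Suc i..<j])) (s i \<otimes> s i)"
    unfolding twist_def by (intro conj_by_conj_by) auto
  then show ?thesis using assms by (simp add: twist_def)
qed

lemma conj_by_far:
  assumes "k \<in> {1..<n}" "j \<in> {1..<n}" "k + 2 \<le> j \<or> j + 2 \<le> k" "x \<in> carrier G"
  shows "conj_by (s k) (conj_by (s j) x) = conj_by (s j) (conj_by (s k) x)"
  using far'[OF assms(1-3)] assms by (simp only: conj_by_conj_by s_closed)

lemma conj_by_braid: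
  assumes "1 \<le> i" "i + 1 < n" "x \<in> carrier G"
  shows "conj_by (s i) (conj_by (s (Suc i)) (conj_by (s i) x)) =
    conj_by (s (Suc i)) (conj_by (s i) (conj_by (s (Suc i)) x))"
proof -
  have c: "s i \<in> carrier G" "s (Suc i) \<in> carrier G" using assms by auto
  then have "conj_by (s i) (conj_by (s (Suc i)) (conj_by (s i) x)) = conj_by (s i \<otimes> s (Suc i) \<otimes> s i) x"
    using assms(3) by (simp only: conj_by_conj_by m_closed) (simp only: m_assoc m_closed)
  also have "s i \<otimes> s (Suc i) \<otimes> s i = s (Suc i) \<otimes> s i \<otimes> s (Suc i)"
    using braid[OF assms(1,2)] by simp
  also have "conj_by \<dots> x = conj_by (s (Suc i)) (conj_by (s i) (conj_by (s (Suc i)) x))"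
    using c assms(3) by (simp only: conj_by_conj_by m_closed) (simp only: m_assoc m_closed)
  finally show ?thesis .
qed

lemma conj_twist_far:
  assumes "1 \<le> i" "i < j" "j \<le> n" "k \<in> {1..<n}" "k + 2 \<le> i \<or> j + 1 \<le> k"
  shows "conj_by (s k) (twist i j) = twist i j"
  using Suc_leI[OF assms(2)] assms(3,5)
proof (induction j rule: dec_induct)
  case base
  then have "s k \<otimes> s i = s i \<otimes> s k"
    using assms(1,4) by (intro far') auto
  moreover have "s i \<in> carrier G" "s k \<in> carrier G" using assms by auto
  ultimately have "s k \<otimes> (s i \<otimes> s i) = (s i \<otimes> s i) \<otimes> s k"
    by (metis m_assoc)
  then have "conj_by (s k) (s i \<otimes> s i) = s i \<otimes> s i"
    using \<open>s i \<in> carrier G\<close> \<open>s k \<in> carrier G\<close> by (subst conj_by_eq_iff) auto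
  then show ?case using assms base by (simp add: twist_neighbours)
next
  case (step j)
  then have "twist i j \<in> carrier G" using assms(1) by auto
  moreover have "conj_by (s k) (twist i j) = twist i j" using step by auto
  ultimately show ?case
    using step assms twist_Suc[of i j] conj_by_far[of k j "twist i j"] by auto
qed

lemma conj_twist_mid:
  assumes "1 \<le> i" "i < k" "k + 1 < j" "j \<le> n"
  shows "conj_by (s k) (twist i j) = twist i j"
proof -
  have "k + 2 \<le> j" using assms(3) by simp
  then show ?thesis using assms(4)
  proof (induction j rule: dec_induct)
    case base
    let ?x = "twist i k"
    have x: "?x \<in> carrier G" using assms base by auto
    have t: "twist i (k + 2) = conj_by (s (Suc k)) (conj_by (s k) ?x)"
      using twist_Suc[of i k] twist_Suc[of i "Suc k"] assms(1,2) base by simp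
    have "conj_by (s k) (twist i (k + 2)) = conj_by (s (Suc k)) (conj_by (s k) (conj_by (s (Suc k)) ?x))"
      unfolding t using assms base x by (intro conj_by_braid) auto
    also have "conj_by (s (Suc k)) ?x = ?x"
      using assms(1,2) base by (intro conj_twist_far) auto
    finally show ?case unfolding t .
  next
    case (step j)
    then have "conj_by (s k) (twist i j) = twist i j" by auto
    moreover have "twist i j \<in> carrier G" using assms step by auto
    moreover have "twist i (Suc j) = conj_by (s j) (twist i j)"
      using assms step by (intro twist_Suc) auto
    moreover have "conj_by (s k) (conj_by (s j) (twist i j)) = conj_by (s j) (conj_by (s k) (twist i j))"
      using assms step by (intro conj_by_far) auto
    ultimately show ?case by simp
  qed
qed

lemma conj_twist_low:
  assumes "1 \<le> i" "i + 1 < j" "j \<le> n"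
  shows "conj_by (s i) (twist i j) = twist (Suc i) j"
proof -
  have "i + 2 \<le> j" using assms(2) by simp
  then show ?thesis using assms(3)
  proof (induction j rule: dec_induct)
    case base
    have c: "s i \<in> carrier G" "s (Suc i) \<in> carrier G" using base assms by auto
    have b: "s i \<otimes> s (Suc i) \<otimes> s i = s (Suc i) \<otimes> (s i \<otimes> s (Suc i))"
      using braid[of i] base assms(1) c by (simp add: m_assoc)
    have "(s i \<otimes> s (Suc i)) \<otimes> (s i \<otimes> s i) = (s i \<otimes> s (Suc i) \<otimes> s i) \<otimes> s i"
      using c by (simp add: m_assoc)
    also have "\<dots> = (s (Suc i) \<otimes> (s i \<otimes> s (Suc i))) \<otimes> s i" by (simp only: b)
    also have "\<dots> = s (Suc i) \<otimes> (s i \<otimes> s (Suc i) \<otimes> s i)"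
      using c by (simp add: m_assoc)
    also have "\<dots> = s (Suc i) \<otimes> (s (Suc i) \<otimes> (s i \<otimes> s (Suc i)))" by (simp only: b)
    also have "\<dots> = (s (Suc i) \<otimes> s (Suc i)) \<otimes> (s i \<otimes> s (Suc i))"
      using c by (simp add: m_assoc)
    finally have "conj_by (s i \<otimes> s (Suc i)) (s i \<otimes> s i) = s (Suc i) \<otimes> s (Suc i)"
      using c by (subst conj_by_eq_iff) auto
    then have "conj_by (s i) (conj_by (s (Suc i)) (s i \<otimes> s i)) = s (Suc i) \<otimes> s (Suc i)"
      using c by (subst conj_by_conj_by) auto
    then show ?case
      using base assms(1) twist_Suc[of i "Suc i"] by (simp add: twist_neighbours)
  next
    case (step j)
    then have "conj_by (s i) (twist i j) = twist (Suc i) j" by auto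
    moreover have "twist i j \<in> carrier G" using assms step by auto
    moreover have "twist i (Suc j) = conj_by (s j) (twist i j)"
      "twist (Suc i) (Suc j) = conj_by (s j) (twist (Suc i) j)"
      using assms step by (auto intro!: twist_Suc)
    moreover have "conj_by (s i) (conj_by (s j) (twist i j)) = conj_by (s j) (conj_by (s i) (twist i j))"
      using assms step by (intro conj_by_far) auto
    ultimately show ?case by simp
  qed
qed

definition twists :: "nat \<Rightarrow> 'a set" where
  "twists m = {twist i j | i j. 1 \<le> i \<and> i < j \<and> j \<le> m}"

lemma twists_mono: "m \<le> k \<Longrightarrow> twists m \<subseteq> twists k"
  unfolding twists_def by (blast intro: le_trans)

lemma twists_closed: "m \<le> n \<Longrightarrow> twists m \<subseteq> carrier G"
  by (auto simp: twists_def)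

lemma subgroup_generate_twists: "m \<le> n \<Longrightarrow> subgroup (generate G (twists m)) G"
  by (intro generate_is_subgroup twists_closed)

lemma twist_in: "1 \<le> i \<Longrightarrow> i < j \<Longrightarrow> j \<le> m \<Longrightarrow> twist i j \<in> generate G (twists m)"
  by (rule generate.incl) (auto simp: twists_def)

lemma conj_by_in_subgroup:
  "subgroup H G \<Longrightarrow> g \<in> H \<Longrightarrow> x \<in> H \<Longrightarrow> conj_by g x \<in> H"
  by (simp add: subgroup.m_closed subgroup.m_inv_closed)

text \<open>
  Conjugating by \<open>s\<^sub>k\<close> gives another twist unless \<open>k = i - 1\<close> or \<open>i < k = j - 1\<close>. In these
  cases the twist is already the conjugate of a twist by \<open>s\<^sub>k\<close>, and conjugating once
  more amounts to conjugating by \<open>s\<^sub>k\<^sup>2\<close>, which is a twist.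
\<close>

lemma conj_s_twist_in:
  assumes "1 \<le> i" "i < j" "j \<le> n" "k \<in> {1..<n}"
  shows "conj_by (s k) (twist i j) \<in> generate G (twists n)"
proof -
  let ?N = "generate G (twists n)"
  have N: "subgroup ?N G" by (rule subgroup_generate_twists) simp
  have k: "s k \<in> carrier G" using assms(4) by auto
  have sq: "s k \<otimes> s k \<in> ?N"
    using twist_in[of k "Suc k" n] twist_neighbours[of k] assms(4) by simp
  have inN: "twist i j \<in> ?N" using assms by (intro twist_in)
  consider "k + 2 \<le> i" | "k + 1 = i" | "k = i" "j = i + 1" | "k = i" "i + 1 < j"
    | "i < k" "k + 1 < j" | "i < k" "k + 1 = j" | "k = j" | "j + 1 \<le> k"
    using assms(2) by linarith
  then show ?thesis
  proof cases
    case 1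
    then show ?thesis using conj_twist_far[OF assms] inN by simp
  next
    case 2
    have kj: "1 \<le> k" "k + 1 < j" "k < j" using 2 assms by auto
    then have "twist i j = conj_by (s k) (twist k j)"
      using conj_twist_low[of k j] 2 assms(3) by simp
    then have "conj_by (s k) (twist i j) = conj_by (s k \<otimes> s k) (twist k j)"
      using k kj assms(3) twist_closed[of k j] by (simp only: conj_by_conj_by)
    then show ?thesis
      using conj_by_in_subgroup[OF N sq twist_in[of k j n]] kj assms(3) by simp
  next
    case 3
    then have "conj_by (s k) (twist i j) = twist i j"
      using k assms by (simp add: twist_neighbours m_assoc)
    then show ?thesis using inN by simp
  next
    case 4
    then show ?thesis using conj_twist_low[of i j] assms twist_in[of "Suc i" j n] by simp
  next
    case 5
    then show ?thesis using conj_twist_mid[of i k j] assms inN by simp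
  next
    case 6
    then have "twist i j = conj_by (s k) (twist i k)"
      using twist_Suc[of i k] assms by simp
    then have "conj_by (s k) (twist i j) = conj_by (s k \<otimes> s k) (twist i k)"
      using k 6 assms twist_closed[of i k] by (simp only: conj_by_conj_by)
    then show ?thesis
      using conj_by_in_subgroup[OF N sq twist_in[of i k n]] 6 assms by simp
  next
    case 7
    then show ?thesis using twist_Suc[of i j] twist_in[of i "Suc j" n] assms by simp
  next
    case 8
    then show ?thesis using conj_twist_far[OF assms] inN by simp
  qed
qed

text \<open>
  Conjugation by an inverse generator reduces to conjugation by the generator, because
  \<open>s\<^sub>k\<^sup>-\<^sup>1 = s\<^sub>k (s\<^sub>k\<^sup>2)\<^sup>-\<^sup>1\<close> and the square is a twist.
\<close>

lemma normal_generate_twists: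
  assumes gen: "generate G (s ` {1..<n}) = carrier G"
  shows "generate G (twists n) \<lhd> G"
proof (rule normal_invI)
  let ?N = "generate G (twists n)"
  show N: "subgroup ?N G" by (rule subgroup_generate_twists) simp
  have Nc: "?N \<subseteq> carrier G" using N by (rule subgroup.subset)
  have pos: "conj_by (s k) x \<in> ?N" if "k \<in> {1..<n}" "x \<in> ?N" for k x
  proof (rule conj_by_generate[OF _ _ _ _ that(2)])
    fix y assume "y \<in> twists n"
    then obtain i j where "y = twist i j" "1 \<le> i" "i < j" "j \<le> n" by (auto simp: twists_def)
    then show "conj_by (s k) y \<in> ?N" using conj_s_twist_in that(1) by metis
  qed (use that(1) twists_closed in auto)
  have neg: "conj_by (inv (s k)) x \<in> ?N" if k: "k \<in> {1..<n}" and x: "x \<in> ?N" for k x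
  proof -
    have c: "s k \<in> carrier G" "x \<in> carrier G" using k x Nc by auto
    have "s k \<otimes> s k \<in> ?N"
      using twist_in[of k "Suc k" n] twist_neighbours[of k] k by simp
    then have "conj_by (inv (s k \<otimes> s k)) x \<in> ?N"
      by (intro conj_by_in_subgroup[OF N] subgroup.m_inv_closed[OF N] x)
    from pos[OF k this] have "conj_by (s k \<otimes> inv (s k \<otimes> s k)) x \<in> ?N"
      using c by (simp only: conj_by_conj_by m_closed inv_closed)
    moreover have "s k \<otimes> inv (s k \<otimes> s k) = inv (s k)"
      using c by (simp add: inv_mult_group m_assoc[symmetric])
    ultimately show ?thesis by simp
  qed
  fix g x assume "g \<in> carrier G" "x \<in> ?N"
  then have "g \<in> generate G (s ` {1..<n})" using gen by simp
  then show "conj_by g x \<in> ?N" using \<open>x \<in> ?N\<close>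
  proof (induction arbitrary: x rule: generate.induct)
    case one
    then show ?case using Nc by auto
  next
    case (incl h)
    then show ?case using pos by auto
  next
    case (inv h)
    then show ?case using neg by blast
  next
    case (eng g h)
    have sub: "s ` {1..<n} \<subseteq> carrier G" by auto
    have c: "g \<in> carrier G" "h \<in> carrier G" "x \<in> carrier G"
      using eng generate_in_carrier[OF sub] Nc by auto
    have "conj_by (g \<otimes> h) x = conj_by g (conj_by h x)"
      using c by (simp only: conj_by_conj_by)
    then show ?case using eng by simp
  qed
qed

text \<open>
  Up to conjugation by \<open>s\<^bsub>j-1\<^esub> \<cdots> s\<^sub>1\<close>, the twist of the first and the \<open>j + 1\<close>-st strand is
  \<open>s\<^sub>j\<^sup>2\<close>. In this form a product of such twists telescopes.
\<close>

lemma rev_twist: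
  assumes "1 \<le> j" "j < n"
  shows "pr (rev [1..<j]) \<otimes> twist 1 (Suc j) = s j \<otimes> s j \<otimes> pr (rev [1..<j])"
  using assms
proof (induction j rule: dec_induct)
  case base
  then have "s (Suc 0) \<in> carrier G" by auto
  then show ?case using base by (simp add: twist_neighbours)
next
  case (step j)
  let ?v = "pr (rev [1..<j])" and ?x = "s j" and ?y = "s (Suc j)" and ?t = "twist 1 (Suc j)"
  have c: "?v \<in> carrier G" "?x \<in> carrier G" "?y \<in> carrier G" "?t \<in> carrier G"
    using step by auto
  have v: "pr (rev [1..<Suc j]) = ?x \<otimes> ?v" using step by simp
  have vc: "?y \<otimes> ?v = ?v \<otimes> ?y"
    using step by (intro pr_commute) auto
  have b: "?x \<otimes> ?y \<otimes> ?x = ?y \<otimes> ?x \<otimes> ?y" using braid[of j] step by simp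
  have tw: "twist 1 (Suc (Suc j)) = conj_by ?y ?t"
    using step by (intro twist_Suc) auto
  have "(?x \<otimes> ?v) \<otimes> twist 1 (Suc (Suc j)) \<otimes> ?y = ?x \<otimes> (?v \<otimes> ?y) \<otimes> ?t"
    unfolding tw using c by (simp add: m_assoc)
  also have "\<dots> = ?x \<otimes> ?y \<otimes> (?v \<otimes> ?t)"
    unfolding vc[symmetric] using c by (simp add: m_assoc)
  also have "?v \<otimes> ?t = ?x \<otimes> ?x \<otimes> ?v" using step by simp
  also have "?x \<otimes> ?y \<otimes> (?x \<otimes> ?x \<otimes> ?v) = (?x \<otimes> ?y \<otimes> ?x) \<otimes> ?x \<otimes> ?v"
    using c by (simp add: m_assoc)
  also have "\<dots> = (?y \<otimes> ?x \<otimes> ?y) \<otimes> ?x \<otimes> ?v" by (simp only: b)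
  also have "\<dots> = ?y \<otimes> (?x \<otimes> ?y \<otimes> ?x) \<otimes> ?v"
    using c by (simp add: m_assoc)
  also have "\<dots> = ?y \<otimes> (?y \<otimes> ?x \<otimes> ?y) \<otimes> ?v" by (simp only: b)
  also have "\<dots> = ?y \<otimes> ?y \<otimes> ?x \<otimes> (?y \<otimes> ?v)"
    using c by (simp add: m_assoc)
  also have "\<dots> = (?y \<otimes> ?y \<otimes> (?x \<otimes> ?v)) \<otimes> ?y"
    unfolding vc using c by (simp add: m_assoc)
  finally have "(?x \<otimes> ?v) \<otimes> twist 1 (Suc (Suc j)) = ?y \<otimes> ?y \<otimes> (?x \<otimes> ?v)"
    using c tw by simp
  then show ?case unfolding v .
qed

text \<open>
  Carrying the first strand around the strands \<open>2, \<dots>, j\<close> one after the other amounts to carrying it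
  around all of them at once: by \<open>rev_twist\<close> each further twist only changes the middle of the
  palindrome.
\<close>

lemma prodl_twists_first:
  assumes "1 \<le> j" "j \<le> n"
  shows "prodl (map (twist 1) [2..<Suc j]) = pr ([1..<j] @ rev [1..<j])"
  using assms
proof (induction j rule: dec_induct)
  case base
  then show ?case by simp
next
  case (step j)
  let ?v = "pr (rev [1..<j])" and ?w = "pr [1..<j]" and ?x = "s j"
  have c: "?v \<in> carrier G" "?w \<in> carrier G" "?x \<in> carrier G" "twist 1 (Suc j) \<in> carrier G"
    using step by auto
  have "prodl (map (twist 1) ([2..<Suc j] @ [Suc j])) = prodl (map (twist 1) [2..<Suc j]) \<otimes> prodl [twist 1 (Suc j)]"
    unfolding map_append using step by (subst prodl_append) auto
  also have "\<dots> = pr ([1..<j] @ rev [1..<j]) \<otimes> twist 1 (Suc j)"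
    using step c by simp
  also have "\<dots> = ?w \<otimes> (?v \<otimes> twist 1 (Suc j))"
    using c step by (subst pr_append) (auto simp: m_assoc)
  also have "\<dots> = (?w \<otimes> ?x) \<otimes> (?x \<otimes> ?v)"
    using c step rev_twist[of j] by (simp add: m_assoc)
  also have "\<dots> = pr ([1..<Suc j] @ rev [1..<Suc j])"
    using c step by (subst pr_append) (auto simp: pr_append)
  finally show ?case using step by simp
qed

text \<open>
  The strand \<open>i\<close> travels around all the others, in the order in which the product becomes
  \<open>round_trip (Suc i)\<close> under conjugation by \<open>s i\<close>.
\<close>

definition round_trip :: "nat \<Rightarrow> 'a" where
  "round_trip i = prodl (map (\<lambda>j. if j < i then twist j i else twist i j) ([1..<i] @ [Suc i..<Suc n]))"

lemma conj_round_trip: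
  assumes "1 \<le> i" "i + 1 \<le> n"
  shows "conj_by (s i) (round_trip i) = round_trip (Suc i)"
proof -
  let ?f = "\<lambda>i j. if j < i then twist j i else twist i j"
  let ?l = "[1..<i] @ Suc i # [Suc (Suc i)..<Suc n]"
  let ?r = "[1..<i] @ i # [Suc (Suc i)..<Suc n]"
  have l: "[1..<i] @ [Suc i..<Suc n] = ?l"
    using assms by (simp add: upt_conv_Cons del: upt_Suc)
  have r: "[1..<Suc i] @ [Suc (Suc i)..<Suc n] = ?r"
    using assms by simp
  have si: "s i \<in> carrier G" using assms by auto
  have low: "conj_by (s i) (?f i j) = ?f (Suc i) j" if "j \<in> set [1..<i]" for j
    using that assms twist_Suc[of j i] by auto
  have high: "conj_by (s i) (?f i j) = ?f (Suc i) j" if "j \<in> set [Suc (Suc i)..<Suc n]" for j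
  proof -
    have "Suc i < j" "j \<le> n" using that by auto
    then show ?thesis using assms conj_twist_low[of i j] by simp
  qed
  have mid: "conj_by (s i) (?f i (Suc i)) = ?f (Suc i) i"
    using assms si by (simp add: twist_neighbours m_assoc)
  have A: "map (conj_by (s i)) (map (?f i) ?l) = map (?f (Suc i)) ?r"
    using low high mid by (simp del: upt_Suc)
  have B: "conj_by (s i) (prodl (map (?f i) ?l)) = prodl (map (conj_by (s i)) (map (?f i) ?l))"
    using assms by (intro conj_by_prodl si) auto
  show ?thesis unfolding round_trip_def l r B A by (rule HOL.refl)
qed

end

context sphere_braid_system
begin

text \<open>
  The sphere relation says that the first strand may travel around all the others for free.
  Conjugation spreads this to every strand, and for the strand \<open>i < n\<close> it expresses the twist
  of \<open>i\<close> and \<open>n\<close> through twists among the first \<open>n - 1\<close> strands.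
\<close>

lemma round_trip_trivial:
  assumes "1 \<le> i" "i \<le> n"
  shows "round_trip i = \<one>"
  using assms
proof (induction i rule: dec_induct)
  case base
  have "round_trip 1 = prodl (map (twist 1) [2..<Suc n])"
    unfolding round_trip_def by (intro arg_cong[of _ _ prodl]) (auto simp: numeral_2_eq_2 simp del: upt_Suc)
  then show ?case using prodl_twists_first[of n] sphere n_ge by simp
next
  case (step i)
  then have "s i \<in> carrier G" by auto
  then show ?case using conj_round_trip[of i] step by simp
qed

lemma generate_twists_pred: "generate G (twists (n - 1)) = generate G (twists n)"
proof
  show "generate G (twists (n - 1)) \<subseteq> generate G (twists n)"
    by (intro mono_generate twists_mono) simp
  let ?M = "generate G (twists (n - 1))"
  have M: "subgroup ?M G" by (rule subgroup_generate_twists) simp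
  have last: "twist i n \<in> ?M" if i: "1 \<le> i" "i < n" for i
  proof -
    let ?f = "\<lambda>j. if j < i then twist j i else twist i j"
    let ?p = "prodl (map ?f ([1..<i] @ [Suc i..<n]))"
    have "set (map ?f ([1..<i] @ [Suc i..<n])) \<subseteq> ?M"
      using i by (auto intro!: twist_in)
    then have p: "?p \<in> ?M" by (rule prodl_in_subgroup[OF M])
    have "[1..<i] @ [Suc i..<Suc n] = ([1..<i] @ [Suc i..<n]) @ [n]"
      using i by simp
    then have "round_trip i = prodl (map ?f (([1..<i] @ [Suc i..<n]) @ [n]))"
      unfolding round_trip_def by simp
    also have "\<dots> = ?p \<otimes> prodl (map ?f [n])"
      unfolding map_append[of ?f "[1..<i] @ [Suc i..<n]"] using i by (intro prodl_append) auto
    also have "\<dots> = ?p \<otimes> twist i n" using i by simp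
    finally have "?p \<otimes> twist i n = \<one>" using round_trip_trivial[of i] i by simp
    moreover have "?p \<in> carrier G" using p M subgroup.subset by blast
    ultimately have "twist i n = inv ?p"
      using i by (metis inv_comm inv_equality twist_closed order_refl)
    then show ?thesis using subgroup.m_inv_closed[OF M p] by simp
  qed
  have "twists n \<subseteq> ?M"
  proof
    fix x assume "x \<in> twists n"
    then obtain i j where x: "x = twist i j" "1 \<le> i" "i < j" "j \<le> n" by (auto simp: twists_def)
    show "x \<in> ?M"
      using x last[of i] twist_in[of i j "n - 1"] by (cases "j = n") auto
  qed
  then show "generate G (twists n) \<subseteq> ?M" using M by (rule generate_subgroup_incl)
qed

end

section \<open>The Coxeter presentation of the symmetric group\<close>

context braid_system
begin

text \<open>
  If the generators are involutions, then \<open>s\<^sub>i\<close> permutes the cosets \<open>s\<^sub>j \<cdots> s\<^sub>m H\<close> of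
  the subgroup \<open>H\<close> generated by \<open>s\<^sub>1, \<dots>, s\<^bsub>m-1\<^esub>\<close>. The coset and the element of \<open>H\<close> do
  not depend on the group, which is what allows the comparison of two such groups.
\<close>

definition coset_step :: "nat \<Rightarrow> nat \<Rightarrow> nat \<times> nat list" where
  "coset_step i j =
    (if i + 1 < j then (j, [i]) else if i + 1 = j then (i, []) else if i = j then (j + 1, [])
     else (j, [i - 1]))"

lemma coset_step:
  assumes sq: "\<And>i. i \<in> {1..<n} \<Longrightarrow> s i \<otimes> s i = \<one>"
    and "m < n" "1 \<le> i" "i \<le> m" "1 \<le> j" "j \<le> Suc m" "coset_step i j = (j', js)"
  shows "s i \<otimes> pr [j..<Suc m] = pr [j'..<Suc m] \<otimes> pr js"
proof -
  have si: "s i \<in> carrier G" using assms by auto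
  consider "i + 1 < j" | "i + 1 = j" | "i = j" | "j < i" by linarith
  then show ?thesis
  proof cases
    case 1
    then have "j' = j" "js = [i]" using assms by (auto simp: coset_step_def)
    moreover have "s i \<otimes> pr [j..<Suc m] = pr [j..<Suc m] \<otimes> s i"
      by (rule pr_commute) (use assms 1 in auto)
    ultimately show ?thesis using si by simp
  next
    case 2
    then have "j' = i" "js = []" using assms by (auto simp: coset_step_def)
    moreover have "pr [i..<Suc m] = s i \<otimes> pr [j..<Suc m]"
      using 2 assms by (simp add: upt_conv_Cons del: upt_Suc)
    moreover have "pr [j..<Suc m] \<in> carrier G" using assms by (intro pr_closed) auto
    ultimately show ?thesis using si by simp
  next
    case 3
    then have "j' = j + 1" "js = []" using assms by (auto simp: coset_step_def)
    moreover have "pr [j..<Suc m] = s j \<otimes> pr [j + 1..<Suc m]"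
      using 3 assms by (simp add: upt_conv_Cons del: upt_Suc)
    moreover have "pr [j + 1..<Suc m] \<in> carrier G" using assms by (intro pr_closed) auto
    ultimately show ?thesis using si sq[of j] 3 assms by (simp add: m_assoc[symmetric])
  next
    case 4
    then have "j' = j" "js = [i - 1]" using assms by (auto simp: coset_step_def)
    moreover have "pr [j..<Suc m] \<otimes> s (i - 1) = s i \<otimes> pr [j..<Suc m]"
      using shift[of j "i - 1" "Suc m"] 4 assms by simp
    moreover have "s (i - 1) \<in> carrier G" using 4 assms by (intro s_closed) auto
    ultimately show ?thesis by simp
  qed
qed

end

text \<open>
  Both groups use the same \<open>j\<close> and \<open>js\<close>, so that information about them read off in one group
  can be used in the other.
\<close>

lemma coset_normal_form:
  assumes "braid_system G n s" "\<And>i. i \<in> {1..<n} \<Longrightarrow> s i \<otimes>\<^bsub>G\<^esub> s i = \<one>\<^bsub>G\<^esub>"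
    and "braid_system H n t" "\<And>i. i \<in> {1..<n} \<Longrightarrow> t i \<otimes>\<^bsub>H\<^esub> t i = \<one>\<^bsub>H\<^esub>"
    and "m < n" "set is \<subseteq> {1..<Suc m}"
  shows "\<exists>j js. 1 \<le> j \<and> j \<le> Suc m \<and> set js \<subseteq> {1..<m} \<and>
    braid_system.pr G s is = braid_system.pr G s [j..<Suc m] \<otimes>\<^bsub>G\<^esub> braid_system.pr G s js \<and>
    braid_system.pr H t is = braid_system.pr H t [j..<Suc m] \<otimes>\<^bsub>H\<^esub> braid_system.pr H t js"
  using assms(6)
proof (induction "is")
  interpret G: braid_system G n s by fact
  interpret H: braid_system H n t by fact
  {
    case Nil
    show ?case by (intro exI[of _ "Suc m"] exI[of _ "[]"]) simp
  next
    case (Cons i "is")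
    then obtain j js where IH: "1 \<le> j" "j \<le> Suc m" "set js \<subseteq> {1..<m}"
      "G.pr is = G.pr [j..<Suc m] \<otimes>\<^bsub>G\<^esub> G.pr js" "H.pr is = H.pr [j..<Suc m] \<otimes>\<^bsub>H\<^esub> H.pr js"
      by auto
    obtain j' ks where st: "G.coset_step i j = (j', ks)" by fastforce
    then have st': "H.coset_step i j = (j', ks)"
      by (simp add: G.coset_step_def H.coset_step_def)
    have i: "1 \<le> i" "i \<le> m" using Cons.prems by auto
    have ks: "1 \<le> j'" "j' \<le> Suc m" "set ks \<subseteq> {1..<m}"
      using st i IH(1,2) by (auto simp: G.coset_step_def split: if_splits)
    have sub: "set js \<subseteq> {1..<n}" "set ks \<subseteq> {1..<n}" using IH(3) ks(3) assms(5) by auto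
    have Gc: "s i \<in> carrier G" "G.pr [j..<Suc m] \<in> carrier G" "G.pr [j'..<Suc m] \<in> carrier G"
      "G.pr js \<in> carrier G" "G.pr ks \<in> carrier G"
      using i assms(5) IH(1) ks(1) sub by (auto intro!: G.pr_closed simp del: upt_Suc)
    have Hc: "t i \<in> carrier H" "H.pr [j..<Suc m] \<in> carrier H" "H.pr [j'..<Suc m] \<in> carrier H"
      "H.pr js \<in> carrier H" "H.pr ks \<in> carrier H"
      using i assms(5) IH(1) ks(1) sub by (auto intro!: H.pr_closed simp del: upt_Suc)
    have "G.pr (i # is) = (s i \<otimes>\<^bsub>G\<^esub> G.pr [j..<Suc m]) \<otimes>\<^bsub>G\<^esub> G.pr js"
      using Gc IH(4) by (simp add: G.m_assoc del: upt_Suc)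
    also have "\<dots> = G.pr [j'..<Suc m] \<otimes>\<^bsub>G\<^esub> G.pr (ks @ js)"
      using G.coset_step[OF assms(2,5) i IH(1,2) st] Gc sub
      by (simp add: G.m_assoc G.pr_append del: upt_Suc)
    finally have Gf: "G.pr (i # is) = G.pr [j'..<Suc m] \<otimes>\<^bsub>G\<^esub> G.pr (ks @ js)" .
    have "H.pr (i # is) = (t i \<otimes>\<^bsub>H\<^esub> H.pr [j..<Suc m]) \<otimes>\<^bsub>H\<^esub> H.pr js"
      using Hc IH(5) by (simp add: H.m_assoc del: upt_Suc)
    also have "\<dots> = H.pr [j'..<Suc m] \<otimes>\<^bsub>H\<^esub> H.pr (ks @ js)"
      using H.coset_step[OF assms(4,5) i IH(1,2) st'] Hc sub
      by (simp add: H.m_assoc H.pr_append del: upt_Suc)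
    finally have Hf: "H.pr (i # is) = H.pr [j'..<Suc m] \<otimes>\<^bsub>H\<^esub> H.pr (ks @ js)" .
    show ?case using Gf Hf ks IH(3) by (intro exI[of _ j'] exI[of _ "ks @ js"]) auto
  }
qed

definition adjacent :: "nat \<Rightarrow> nat \<Rightarrow> nat" where
  "adjacent i = transpose i (i + 1)"

lemma adjacent_apply: "adjacent i k = (if k = i then Suc i else if k = Suc i then i else k)"
  by (auto simp: adjacent_def transpose_def)

lemma braid_system_sym_group: "braid_system (sym_group n) n adjacent"
proof -
  interpret S: group "sym_group n" by (rule sym_group_is_group)
  show ?thesis
  proof
    show "adjacent i \<in> carrier (sym_group n)" if "i \<in> {1..<n}" for i
      using that transpose_in_sym_group unfolding adjacent_def by blast
  qed (auto simp: sym_group_mult adjacent_apply fun_eq_iff)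
qed

lemma transpose_product_fixes:
  assumes "set is \<subseteq> {1..<n}" "\<And>i. i \<in> set is \<Longrightarrow> i + 1 < k \<or> k < i"
  shows "braid_system.pr (sym_group n) adjacent is k = k"
proof -
  interpret S: braid_system "sym_group n" n adjacent
    by (rule braid_system_sym_group)
  show ?thesis
    using assms
  proof (induction "is")
    case (Cons i "is")
    then have "S.pr is k = k" "i + 1 < k \<or> k < i" by auto
    then show ?case by (simp add: sym_group_mult) (auto simp: adjacent_apply)
  qed (simp add: sym_group_one)
qed

lemma transpose_product_upt:
  assumes "1 \<le> j" "j \<le> m" "m \<le> n"
  shows "braid_system.pr (sym_group n) adjacent [j..<m] m = j"
proof -
  interpret S: braid_system "sym_group n" n adjacent
    by (rule braid_system_sym_group)
  show ?thesis
    using assms(2,1)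
  proof (induction j rule: inc_induct)
    case base
    then show ?case by (simp add: sym_group_one)
  next
    case (step j)
    then have "S.pr [Suc j..<m] m = Suc j" by simp
    moreover have "S.pr [j..<m] = adjacent j \<circ> S.pr [Suc j..<m]"
      using step by (simp add: upt_conv_Cons sym_group_mult)
    ultimately show ?case by (simp add: adjacent_apply[of j "Suc j"])
  qed
qed

text \<open>
  In the normal form, \<open>s\<^sub>j \<cdots> s\<^sub>m\<close> is the only factor that moves the point \<open>m + 1\<close>, and its
  permutation maps this point to \<open>j\<close>. If the whole product is the identity permutation, then
  \<open>j = m + 1\<close>, this factor is empty, and the remaining one involves fewer generators.
\<close>

lemma coxeter_relation:
  assumes "braid_system G n s" "\<And>i. i \<in> {1..<n} \<Longrightarrow> s i \<otimes>\<^bsub>G\<^esub> s i = \<one>\<^bsub>G\<^esub>"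
    and "m \<le> n" "set is \<subseteq> {1..<m}"
    and "braid_system.pr (sym_group n) adjacent is = id"
  shows "braid_system.pr G s is = \<one>\<^bsub>G\<^esub>"
  using assms(3-5)
proof (induction m arbitrary: "is")
  interpret G: braid_system G n s by fact
  interpret S: braid_system "sym_group n" n adjacent
    by (rule braid_system_sym_group)
  {
    case 0
    then show ?case by simp
  next
    case (Suc m)
    have sq: "adjacent i \<otimes>\<^bsub>sym_group n\<^esub> adjacent i = \<one>\<^bsub>sym_group n\<^esub>"
      if "i \<in> {1..<n}" for i
      by (simp add: sym_group_mult sym_group_one adjacent_apply fun_eq_iff)
    from Suc.prems have "m < n" by simp
    from coset_normal_form[OF assms(1,2) S.braid_system_axioms sq this Suc.prems(2)]
    obtain j js where j: "1 \<le> j" "j \<le> Suc m" "set js \<subseteq> {1..<m}"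
      and Gi: "G.pr is = G.pr [j..<Suc m] \<otimes>\<^bsub>G\<^esub> G.pr js"
      and Si: "S.pr is = S.pr [j..<Suc m] \<otimes>\<^bsub>sym_group n\<^esub> S.pr js"
      by auto
    have sub: "set js \<subseteq> {1..<n}" using j(3) \<open>m < n\<close> by auto
    have "S.pr js (Suc m) = Suc m"
      using j(3) sub by (intro transpose_product_fixes) auto
    moreover have "S.pr [j..<Suc m] (Suc m) = j"
      using j \<open>m < n\<close> by (intro transpose_product_upt) auto
    moreover have "S.pr is (Suc m) = Suc m" using Suc.prems(3) by simp
    ultimately have "j = Suc m"
      unfolding Si sym_group_mult by simp
    then have "G.pr is = G.pr js" "S.pr is = S.pr js"
      using Gi Si sub by simp_all
    then show ?case using Suc.IH[of js] Suc.prems j(3) by simp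
  }
qed

section \<open>The braid group of the sphere and its quotients\<close>

lemma (in group_hom) hom_eval_word:
  assumes "f ` S \<subseteq> carrier G" "w \<in> words S"
  shows "h (eval_word G f w) = eval_word H (h \<circ> f) w"
  using assms(2)
proof (induction w)
  case (Cons p w)
  obtain a b where p: "p = (a, b)" by (cases p)
  with Cons.prems assms(1) have "f a \<in> carrier G" "w \<in> words S" by auto
  with Cons.IH p show ?case
    using G.eval_word_closed[OF assms(1), of w] by simp
qed simp

lemma (in braid_system) eval_word_involutions:
  assumes sq: "\<And>i. i \<in> {1..<n} \<Longrightarrow> s i \<otimes> s i = \<one>" and "w \<in> words {1..<n}"
  shows "eval_word G s w = pr (map fst w)"
  using assms(2)
proof (induction w)
  case (Cons p w)
  obtain a b where p: "p = (a, b)" by (cases p)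
  with Cons.prems have "a \<in> {1..<n}" by auto
  then have "inv (s a) = s a" using sq[of a] by (intro inv_equality) auto
  with Cons p show ?case by auto
qed simp

lemma (in group) eval_word_const:
  assumes "x \<in> carrier G" "\<And>i. i \<in> S \<Longrightarrow> f i = x" "w \<in> words S"
  shows "eval_word G f w = x [^] (\<Sum>(a, b)\<leftarrow>w. if b then 1 else - 1 :: int)"
  using assms(3)
proof (induction w)
  case (Cons p w)
  obtain a b where p: "p = (a, b)" by (cases p)
  with Cons.prems assms(2) have "f a = x" by auto
  let ?e = "if b then 1 else - 1 :: int"
  have "(if b then f a else inv (f a)) = x [^] ?e"
    using \<open>f a = x\<close> assms(1) by (simp add: int_pow_neg int_pow_1)
  then show ?case
    using Cons p assms(1) int_pow_mult[OF assms(1), of ?e] by simp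
qed simp

definition exponent :: "'a word \<Rightarrow> int" where
  "exponent w = (\<Sum>(a, b)\<leftarrow>w. if b then 1 else - 1)"

lemma exponent_simps [simp]:
  "exponent [] = 0" "exponent ((a, b) # w) = (if b then 1 else - 1) + exponent w"
  "exponent (u @ v) = exponent u + exponent v"
  by (simp_all add: exponent_def)

lemma exponent_sigma_word [simp]: "exponent (sigma_word is) = int (length is)"
  by (induction "is") (simp_all add: sigma_word_def)

lemma eval_word_integer_mod_group:
  assumes "m > 0"
  shows "eval_word (integer_mod_group m) (\<lambda>_. 1 mod int m) w = exponent w mod int m"
proof (induction w)
  case (Cons p w)
  obtain a b where p: "p = (a, b)" by (cases p)
  have "1 mod int m \<in> carrier (integer_mod_group m)"
    using assms by (simp add: carrier_integer_mod_group)
  from inv_integer_mod_group[OF this] Cons p show ?case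
    by (simp add: mod_simps)
qed simp

lemma sigma_word_in_words: "set is \<subseteq> S \<Longrightarrow> sigma_word is \<in> words S"
  by (auto simp: sigma_word_def words_def)

lemma sphere_braid_rels_cases:
  assumes "(u, v) \<in> sphere_braid_rels n"
  obtains (far) i j where "i \<in> {1..<n}" "j \<in> {1..<n}" "i + 2 \<le> j \<or> j + 2 \<le> i"
      "u = sigma_word [i, j]" "v = sigma_word [j, i]"
    | (braid) i where "1 \<le> i" "i + 1 < n" "u = sigma_word [i, i + 1, i]" "v = sigma_word [i + 1, i, i + 1]"
    | (sphere) "u = sigma_word ([1..<n] @ rev [1..<n])" "v = []"
proof -
  have "(\<exists>i j. u = sigma_word [i, j] \<and> v = sigma_word [j, i] \<and> i \<in> {1..<n} \<and> j \<in> {1..<n} \<and> \<bar>int i - int j\<bar> \<ge> 2)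
    \<or> (\<exists>i. u = sigma_word [i, i + 1, i] \<and> v = sigma_word [i + 1, i, i + 1] \<and> 1 \<le> i \<and> i \<le> n - 2)
    \<or> u = sigma_word ([1..<n] @ rev [1..<n]) \<and> v = []"
    using assms unfolding sphere_braid_rels_def by blast
  then show thesis
  proof (elim disjE exE conjE)
    fix i j
    assume "u = sigma_word [i, j]" "v = sigma_word [j, i]" "i \<in> {1..<n}" "j \<in> {1..<n}"
      and "\<bar>int i - int j\<bar> \<ge> 2"
    moreover from this(5) have "i + 2 \<le> j \<or> j + 2 \<le> i" by linarith
    ultimately show thesis using far by blast
  next
    fix i
    assume "u = sigma_word [i, i + 1, i]" "v = sigma_word [i + 1, i, i + 1]" "1 \<le> i" "i \<le> n - 2"
    then show thesis using braid[of i] by fastforce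
  next
    assume "u = sigma_word ([1..<n] @ rev [1..<n])" "v = []"
    then show thesis by (rule sphere)
  qed
qed

locale sphere_braids =
  fixes n :: nat
  assumes n3: "3 \<le> n"
begin

abbreviation (input) "B \<equiv> sphere_braid_group n"
abbreviation (input) "cls \<equiv> pres_class {1..<n} (sphere_braid_rels n)"

lemma mult_class: "u \<in> words {1..<n} \<Longrightarrow> v \<in> words {1..<n} \<Longrightarrow> cls u \<otimes>\<^bsub>B\<^esub> cls v = cls (u @ v)"
  by (simp add: sphere_braid_group_def pres_mult_class)

lemma class_eqI: "pres_eq {1..<n} (sphere_braid_rels n) u v \<Longrightarrow> cls u = cls v"
  using pres_class_eq_iff pres_eq_words by blast

lemma class_rel:
  "(sigma_word is, sigma_word js) \<in> sphere_braid_rels n \<Longrightarrow> set is \<subseteq> {1..<n} \<Longrightarrow> set js \<subseteq> {1..<n}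
    \<Longrightarrow> cls (sigma_word is) = cls (sigma_word js)"
  by (intro class_eqI pres_eq.rel sigma_word_in_words)

lemma class_one: "\<one>\<^bsub>B\<^esub> = cls []"
  by (simp add: sphere_braid_group_def presented_group_one)

sublocale B: braid_system "sphere_braid_group n" n "sigma n"
proof -
  interpret group B by (rule group_sphere_braid_group)
  have 2: "sigma n i \<otimes>\<^bsub>B\<^esub> sigma n j = cls (sigma_word [i, j])" if "i \<in> {1..<n}" "j \<in> {1..<n}" for i j
    using that by (simp add: sigma_def mult_class sigma_word_def del: One_nat_def)
  have 3: "sigma n i \<otimes>\<^bsub>B\<^esub> sigma n j \<otimes>\<^bsub>B\<^esub> sigma n k = cls (sigma_word [i, j, k])"
    if "i \<in> {1..<n}" "j \<in> {1..<n}" "k \<in> {1..<n}" for i j k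
    using that by (simp add: sigma_def mult_class sigma_word_def del: One_nat_def)
  show "braid_system B n (sigma n)"
  proof
    show "sigma n i \<in> carrier B" if "i \<in> {1..<n}" for i
      by (rule sigma_closed[OF that])
    show "sigma n i \<otimes>\<^bsub>B\<^esub> sigma n j = sigma n j \<otimes>\<^bsub>B\<^esub> sigma n i"
      if ij: "i \<in> {1..<n}" "j \<in> {1..<n}" "i + 2 \<le> j" for i j
    proof -
      have "\<bar>int i - int j\<bar> \<ge> 2" using ij(3) by simp
      then have "(sigma_word [i, j], sigma_word [j, i]) \<in> sphere_braid_rels n"
        unfolding sphere_braid_rels_def using ij by blast
      then show ?thesis using ij by (simp only: 2) (intro class_rel, auto)
    qed
    show "sigma n i \<otimes>\<^bsub>B\<^esub> sigma n (i + 1) \<otimes>\<^bsub>B\<^esub> sigma n i =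
        sigma n (i + 1) \<otimes>\<^bsub>B\<^esub> sigma n i \<otimes>\<^bsub>B\<^esub> sigma n (i + 1)"
      if i: "1 \<le> i" "i + 1 < n" for i
    proof -
      have "i \<le> n - 2" using i by simp
      then have "(sigma_word [i, i + 1, i], sigma_word [i + 1, i, i + 1]) \<in> sphere_braid_rels n"
        unfolding sphere_braid_rels_def using i by blast
      moreover have "i \<in> {1..<n}" "i + 1 \<in> {1..<n}" using i by auto
      ultimately show ?thesis by (simp only: 3) (intro class_rel, auto)
    qed
  qed
qed

lemma sigma_prod_pr: "sigma_prod n is = B.pr is"
  by (simp add: sigma_prod_def B.pr_def B.prodl_def)

sublocale B: sphere_braid_system "sphere_braid_group n" n "sigma n"
proof
  show "3 \<le> n" by (rule n3)
  have "(sigma_word ([1..<n] @ rev [1..<n]), sigma_word []) \<in> sphere_braid_rels n"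
    unfolding sphere_braid_rels_def by (simp add: sigma_word_def)
  then have "cls (sigma_word ([1..<n] @ rev [1..<n])) = cls (sigma_word [])"
    by (rule class_rel) auto
  moreover have "sigma_prod n ([1..<n] @ rev [1..<n]) = cls (sigma_word ([1..<n] @ rev [1..<n]))"
    by (rule sigma_prod_eq) auto
  ultimately show "B.pr ([1..<n] @ rev [1..<n]) = \<one>\<^bsub>B\<^esub>"
    by (simp add: class_one sigma_word_def flip: sigma_prod_pr)
qed

lemma class_closed: "w \<in> words {1..<n} \<Longrightarrow> cls w \<in> carrier B"
  by (simp add: sphere_braid_group_def presented_group_carrier)

lemma carrierE:
  assumes "x \<in> carrier B"
  obtains w where "w \<in> words {1..<n}" "x = cls w"
  using assms by (auto simp: sphere_braid_group_def presented_group_carrier)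

lemma inv_sigma:
  assumes "a \<in> {1..<n}"
  shows "inv\<^bsub>B\<^esub> sigma n a = cls [(a, False)]"
proof (rule B.inv_equality)
  have "pres_eq {1..<n} (sphere_braid_rels n) [(a, False), (a, True)] []"
    using pres_eq.cancel[OF assms, of _ False] by simp
  from class_eqI[OF this] show "cls [(a, False)] \<otimes>\<^bsub>B\<^esub> sigma n a = \<one>\<^bsub>B\<^esub>"
    using assms by (simp add: sigma_def mult_class class_one del: One_nat_def)
  show "sigma n a \<in> carrier B" by (rule sigma_closed[OF assms])
  show "cls [(a, False)] \<in> carrier B" using assms by (intro class_closed) auto
qed

lemma class_eq_eval_word: "w \<in> words {1..<n} \<Longrightarrow> cls w = eval_word B (sigma n) w"
proof (induction w)
  case (Cons p w)
  obtain a b where p: "p = (a, b)" by (cases p)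
  with Cons.prems have a: "a \<in> {1..<n}" and w: "w \<in> words {1..<n}" by auto
  have "cls (p # w) = cls [p] \<otimes>\<^bsub>B\<^esub> cls w"
    using a w p by (simp add: mult_class del: One_nat_def)
  moreover have "cls [p] = (if b then sigma n a else inv\<^bsub>B\<^esub> sigma n a)"
    using inv_sigma[OF a] p by (simp add: sigma_def)
  ultimately show ?case using Cons.IH[OF w] p by simp
qed (simp add: class_one)

lemma generate_sigma: "generate B (sigma n ` {1..<n}) = carrier B"
proof
  show "generate B (sigma n ` {1..<n}) \<subseteq> carrier B"
    by (rule B.generate_incl) auto
  have "eval_word B (sigma n) w \<in> generate B (sigma n ` {1..<n})" if "w \<in> words {1..<n}" for w
    using that
  proof (induction w)
    case (Cons p w)
    obtain a b where p: "p = (a, b)" by (cases p)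
    with Cons have a: "a \<in> {1..<n}" and IH: "eval_word B (sigma n) w \<in> generate B (sigma n ` {1..<n})"
      by auto
    have "(if b then sigma n a else inv\<^bsub>B\<^esub> sigma n a) \<in> generate B (sigma n ` {1..<n})"
      using generate.incl[of "sigma n a" "sigma n ` {1..<n}" B] generate.inv[of "sigma n a" "sigma n ` {1..<n}" B] a
      by (auto simp del: One_nat_def)
    from generate.eng[OF this IH] show ?case using p by simp
  qed (auto intro: generate.one)
  then show "carrier B \<subseteq> generate B (sigma n ` {1..<n})"
    using class_eq_eval_word by (metis carrierE subsetI)
qed

lemma hom_class:
  assumes "h \<in> hom B H" "group H" "w \<in> words {1..<n}"
  shows "h (cls w) = eval_word H (h \<circ> sigma n) w"
proof -
  interpret h: group_hom B H h
    by (simp add: group_hom_def group_hom_axioms_def B.group_axioms assms)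
  show ?thesis
    unfolding class_eq_eval_word[OF assms(3)]
    by (rule h.hom_eval_word[OF _ assms(3)]) auto
qed

subsection \<open>Permutations\<close>

lemma braid_perm_group_hom: "group_hom B (sym_group n) (braid_perm n)"
  by (simp add: group_hom_def group_hom_axioms_def B.group_axioms sym_group_is_group braid_perm_hom)

lemma braid_perm_class:
  assumes "w \<in> words {1..<n}"
  shows "braid_perm n (cls w) = braid_system.pr (sym_group n) adjacent (map fst w)"
proof -
  interpret S: braid_system "sym_group n" n adjacent by (rule braid_system_sym_group)
  have "braid_perm n (cls w) = eval_word (sym_group n) (braid_perm n \<circ> sigma n) w"
    by (rule hom_class[OF braid_perm_hom sym_group_is_group assms])
  also have "\<dots> = eval_word (sym_group n) adjacent w"
    using assms
  proof (induction w)
    case (Cons p w)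
    then show ?case by (cases p) (auto simp: braid_perm_sigma adjacent_def)
  qed simp
  also have "\<dots> = S.pr (map fst w)"
    using assms
    by (intro S.eval_word_involutions) (auto simp: sym_group_mult sym_group_one adjacent_def)
  finally show ?thesis .
qed

lemma quotient_system:
  assumes "N \<lhd> B"
  shows "sphere_braid_system (B Mod N) n ((\<lambda>x. N #>\<^bsub>B\<^esub> x) \<circ> sigma n)"
  by (rule B.hom_sphere_braid_system[OF normal.r_coset_hom_Mod[OF assms]
        normal.factorgroup_is_group[OF assms]])

lemma coset_eq_iff:
  assumes "N \<lhd> B" "x \<in> carrier B"
  shows "N #>\<^bsub>B\<^esub> x = N \<longleftrightarrow> x \<in> N"
  using B.coset_join1[of N x] B.coset_join2[of x N] normal_imp_subgroup[OF assms(1)]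
    assms(2) subgroup.subset by blast

lemma quotient_pr:
  assumes "N \<lhd> B" "set is \<subseteq> {1..<n}"
  shows "braid_system.pr (B Mod N) ((\<lambda>x. N #>\<^bsub>B\<^esub> x) \<circ> sigma n) is = N #>\<^bsub>B\<^esub> B.pr is"
  using B.hom_pr[OF normal.r_coset_hom_Mod[OF assms(1)]
        normal.factorgroup_is_group[OF assms(1)] assms(2)] by simp

text \<open>
  A normal subgroup containing the squares of the generators contains all pure braids, because the
  quotient satisfies the Coxeter relations.
\<close>

lemma kernel_braid_perm_subset:
  assumes N: "N \<lhd> B" and sq: "\<And>i. i \<in> {1..<n} \<Longrightarrow> sigma n i \<otimes>\<^bsub>B\<^esub> sigma n i \<in> N"
  shows "kernel B (sym_group n) (braid_perm n) \<subseteq> N"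
proof
  let ?s = "(\<lambda>x. N #>\<^bsub>B\<^esub> x) \<circ> sigma n"
  interpret Q: sphere_braid_system "B Mod N" n ?s by (rule quotient_system[OF N])
  have inv: "?s i \<otimes>\<^bsub>B Mod N\<^esub> ?s i = \<one>\<^bsub>B Mod N\<^esub>" if "i \<in> {1..<n}" for i
  proof -
    have "?s i \<otimes>\<^bsub>B Mod N\<^esub> ?s i = N #>\<^bsub>B\<^esub> (sigma n i \<otimes>\<^bsub>B\<^esub> sigma n i)"
      using hom_mult[OF normal.r_coset_hom_Mod[OF N]] that by (simp add: sigma_closed)
    then show ?thesis using coset_eq_iff[OF N] sq[OF that] that by (simp add: sigma_closed)
  qed
  fix x assume "x \<in> kernel B (sym_group n) (braid_perm n)"
  then have x: "x \<in> carrier B" "braid_perm n x = id" by (auto simp: kernel_def sym_group_one)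
  obtain w where w: "w \<in> words {1..<n}" "x = cls w" using carrierE[OF x(1)] .
  have fs: "set (map fst w) \<subseteq> {1..<n}" using w(1) by (auto simp: words_def)
  have "N #>\<^bsub>B\<^esub> x = eval_word (B Mod N) ?s w"
    unfolding w(2) by (rule hom_class[OF normal.r_coset_hom_Mod[OF N] Q.group_axioms w(1)])
  also have "\<dots> = Q.pr (map fst w)"
    by (rule Q.eval_word_involutions[OF inv w(1)])
  also have "\<dots> = \<one>\<^bsub>B Mod N\<^esub>"
  proof (rule coxeter_relation[OF Q.braid_system_axioms inv order_refl fs])
    show "braid_system.pr (sym_group n) adjacent (map fst w) = id"
      using x(2) braid_perm_class[OF w(1)] unfolding w(2) by simp
  qed
  finally show "x \<in> N" using coset_eq_iff[OF N x(1)] by simp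
qed

subsection \<open>Exponents\<close>

definition exponent_mod :: "nat \<Rightarrow> nat word set \<Rightarrow> int" where
  "exponent_mod m = pres_lift (integer_mod_group m) (\<lambda>_. 1 mod int m)"

context
  fixes m :: nat
  assumes m: "m > 0" "m dvd 2 * (n - 1)"
begin

lemma exponent_rels:
  assumes "(u, v) \<in> sphere_braid_rels n"
  shows "eval_word (integer_mod_group m) (\<lambda>_. 1 mod int m) u =
    eval_word (integer_mod_group m) (\<lambda>_. 1 mod int m) v"
  using assms
proof (cases rule: sphere_braid_rels_cases)
  case sphere
  have "int (length ([1..<n] @ rev [1..<n])) = int (2 * (n - 1))" by simp
  moreover have "int (2 * (n - 1)) mod int m = 0"
    using m(2) by (metis dvd_imp_mod_0 int_dvd_int_iff)
  ultimately show ?thesis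
    using sphere by (simp only: eval_word_integer_mod_group[OF m(1)] exponent_sigma_word exponent_simps) simp
qed (simp_all add: eval_word_integer_mod_group[OF m(1)])

lemma exponent_range: "(\<lambda>_. 1 mod int m) ` {1..<n} \<subseteq> carrier (integer_mod_group m)"
  using m(1) by (auto simp: carrier_integer_mod_group)

lemma exponent_mod_hom: "exponent_mod m \<in> hom B (integer_mod_group m)"
  unfolding exponent_mod_def sphere_braid_group_def
  by (rule group.pres_lift_hom[OF group_integer_mod_group exponent_range exponent_rels])

lemma exponent_mod_class: "w \<in> words {1..<n} \<Longrightarrow> exponent_mod m (cls w) = exponent w mod int m"
  unfolding exponent_mod_def
  using group.pres_lift_class[OF group_integer_mod_group exponent_range exponent_rels]
  by (simp add: eval_word_integer_mod_group[OF m(1)])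

lemma exponent_mod_pr:
  assumes "set is \<subseteq> {1..<n}"
  shows "exponent_mod m (B.pr is) = int (length is) mod int m"
  using sigma_prod_eq[OF assms] exponent_mod_class[OF sigma_word_in_words[OF assms]]
  by (simp add: sigma_prod_pr)

lemma exponent_group_hom: "group_hom B (integer_mod_group m) (exponent_mod m)"
  by (simp add: group_hom_def group_hom_axioms_def B.group_axioms exponent_mod_hom)

lemma exponent_mod_surj: "exponent_mod m ` carrier B = carrier (integer_mod_group m)"
proof
  show "exponent_mod m ` carrier B \<subseteq> carrier (integer_mod_group m)"
    using exponent_mod_hom by (auto simp: hom_def)
  show "carrier (integer_mod_group m) \<subseteq> exponent_mod m ` carrier B"
  proof
    fix x assume "x \<in> carrier (integer_mod_group m)"
    then have x: "0 \<le> x" "x < int m" using m(1) by (auto simp: carrier_integer_mod_group)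
    let ?l = "replicate (nat x) (1::nat)"
    have l: "set ?l \<subseteq> {1..<n}" using n3 by auto
    then have "exponent_mod m (B.pr ?l) = x" using x by (simp add: exponent_mod_pr)
    then show "x \<in> exponent_mod m ` carrier B" using B.pr_closed[OF l] by force
  qed
qed

text \<open>
  Once all generators agree in a quotient, the only information left is the exponent. The hypothesis
  \<open>collapse\<close> is to be applied to the quotient by the normal closure, hence the type of \<open>G\<close>.
\<close>

lemma normal_closure_eq_kernel_exponent:
  fixes ks :: "nat list"
  defines "N \<equiv> normal_closure B {B.pr ks}"
  assumes "set ks \<subseteq> {1..<n}" "m dvd length ks"
    and collapse: "\<And>G s. sphere_braid_system G n s \<Longrightarrow> braid_system.pr G s ks = \<one>\<^bsub>G\<^esub> \<Longrightarrow>
        (\<forall>i\<in>{1..<n}. s i = s 1) \<and> s 1 [^]\<^bsub>G\<^esub> m = \<one>\<^bsub>(G :: nat word set set monoid)\<^esub>"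
  shows "N = kernel B (integer_mod_group m) (exponent_mod m)"
proof
  interpret e: group_hom B "integer_mod_group m" "exponent_mod m" by (rule exponent_group_hom)
  have a: "B.pr ks \<in> carrier B" using assms(2) by auto
  have N: "N \<lhd> B" unfolding N_def by (rule B.normal_normal_closure) (use a in simp)
  have aN: "B.pr ks \<in> N" unfolding N_def using normal_closure_subset[of "{B.pr ks}" B] by simp
  have "int (length ks) mod int m = 0" using assms(3) by auto
  then have "B.pr ks \<in> kernel B (integer_mod_group m) (exponent_mod m)"
    using a exponent_mod_pr[OF assms(2)] by (simp add: kernel_def)
  then show "N \<subseteq> kernel B (integer_mod_group m) (exponent_mod m)"
    unfolding N_def by (intro normal_closure_minimal e.normal_kernel) simp
  let ?s = "(\<lambda>x. N #>\<^bsub>B\<^esub> x) \<circ> sigma n"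
  interpret Q: sphere_braid_system "B Mod N" n ?s by (rule quotient_system[OF N])
  have "Q.pr ks = \<one>\<^bsub>B Mod N\<^esub>"
    using quotient_pr[OF N assms(2)] coset_eq_iff[OF N a] aN by simp
  note c = collapse[OF Q.sphere_braid_system_axioms this]
  have all: "?s i = ?s 1" if "i \<in> {1..<n}" for i
    by (rule bspec[OF conjunct1[OF c] that])
  note pow = conjunct2[OF c]
  have s1: "?s 1 \<in> carrier (B Mod N)" using n3 by (intro Q.s_closed) auto
  show "kernel B (integer_mod_group m) (exponent_mod m) \<subseteq> N"
  proof
    fix x assume "x \<in> kernel B (integer_mod_group m) (exponent_mod m)"
    then have x: "x \<in> carrier B" "exponent_mod m x = 0" by (auto simp: kernel_def)
    obtain w where w: "w \<in> words {1..<n}" "x = cls w" using carrierE[OF x(1)] .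
    have "exponent w mod int m = 0" using x w exponent_mod_class by simp
    then obtain k where k: "exponent w = int m * k" by auto
    have "N #>\<^bsub>B\<^esub> x = eval_word (B Mod N) ?s w"
      unfolding w(2) by (rule hom_class[OF normal.r_coset_hom_Mod[OF N] Q.group_axioms w(1)])
    also have "\<dots> = ?s 1 [^]\<^bsub>B Mod N\<^esub> exponent w"
      unfolding exponent_def by (rule Q.eval_word_const[OF s1 all w(1)])
    also have "\<dots> = (?s 1 [^]\<^bsub>B Mod N\<^esub> m) [^]\<^bsub>B Mod N\<^esub> k"
      unfolding k using s1 by (simp only: Q.int_pow_pow[symmetric] int_pow_int)
    also have "\<dots> = \<one>\<^bsub>B Mod N\<^esub>" using pow by (simp only: Q.int_pow_one)
    finally show "x \<in> N" using coset_eq_iff[OF N x(1)] by simp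
  qed
qed

lemma quotient_kernel_exponent:
  "B Mod kernel B (integer_mod_group m) (exponent_mod m) \<cong> integer_mod_group m"
proof -
  interpret e: group_hom B "integer_mod_group m" "exponent_mod m" by (rule exponent_group_hom)
  show ?thesis by (rule e.FactGroup_iso[OF exponent_mod_surj])
qed

end

end

section \<open>Crossing numbers\<close>

primrec word_perm :: "nat word \<Rightarrow> nat \<Rightarrow> nat" where
  "word_perm [] = id"
| "word_perm (p # w) = adjacent (fst p) \<circ> word_perm w"

text \<open>
  The signed number of crossings of the strands that start at the positions \<open>i\<close> and \<open>j\<close>. Letters
  act from right to left, as in a composition of permutations.
\<close>

primrec crossings :: "nat word \<Rightarrow> nat \<Rightarrow> nat \<Rightarrow> int" where
  "crossings [] i j = 0"
| "crossings (p # w) i j = crossings w i j +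
     (if {word_perm w i, word_perm w j} = {fst p, Suc (fst p)} then if snd p then 1 else - 1 else 0)"

lemma adjacent_eq_iff [simp]: "adjacent a i = adjacent a j \<longleftrightarrow> i = j"
  by (auto simp: adjacent_apply split: if_splits)

lemma adjacent_adjacent [simp]: "adjacent a (adjacent a i) = i"
  by (auto simp: adjacent_apply)

lemma adjacent_permutes: "a \<in> {1..<n} \<Longrightarrow> adjacent a permutes {1..n}"
  unfolding adjacent_def by (intro permutes_swap_id) auto

lemma word_perm_eq_iff [simp]: "word_perm w i = word_perm w j \<longleftrightarrow> i = j"
  by (induction w) auto

lemma word_perm_permutes: "w \<in> words {1..<n} \<Longrightarrow> word_perm w permutes {1..n}"
proof (induction w)
  case (Cons p w)
  then have "word_perm w permutes {1..n}" "adjacent (fst p) permutes {1..n}"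
    using adjacent_permutes[of "fst p" n] by auto
  then show ?case unfolding word_perm.simps by (rule permutes_compose)
qed (simp add: permutes_id)

lemma word_perm_append: "word_perm (u @ v) = word_perm u \<circ> word_perm v"
  by (induction u) (auto simp: comp_assoc)

lemma crossings_append:
  "crossings (u @ v) i j = crossings v i j + crossings u (word_perm v i) (word_perm v j)"
  by (induction u) (auto simp: word_perm_append)

text \<open>
  A single letter exchanges the order of exactly those two strands that it crosses.
\<close>

lemma odd_crossings_iff:
  assumes "i \<noteq> j"
  shows "odd (crossings w i j) \<longleftrightarrow> (i < j) \<noteq> (word_perm w i < word_perm w j)"
proof (induction w)
  case (Cons p w)
  define a x y where "a = fst p" and "x = word_perm w i" and "y = word_perm w j"
  have "x \<noteq> y" using assms by (simp add: x_def y_def)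
  then have "(x < y) \<noteq> (adjacent a x < adjacent a y) \<longleftrightarrow> {x, y} = {a, Suc a}"
    by (auto simp: adjacent_apply doubleton_eq_iff)
  then show ?case
    using Cons by (auto simp flip: a_def x_def y_def)
qed simp

text \<open>
  A strand that runs once around all the others crosses each of them twice. The braid group of
  the sphere therefore only determines the crossing numbers up to the following relation, where
  \<open>c i\<close> counts the rounds of the strand \<open>i\<close>.
\<close>

definition crossings_equiv :: "nat \<Rightarrow> nat word \<Rightarrow> nat word \<Rightarrow> bool" where
  "crossings_equiv n u v \<longleftrightarrow> word_perm u = word_perm v \<and>
    (\<exists>c. \<forall>i\<in>{1..n}. \<forall>j\<in>{1..n}. i \<noteq> j \<longrightarrow> crossings u i j = crossings v i j + 2 * (c i + c j))"

lemma word_perm_palindrome: "word_perm (sigma_word (is @ rev is)) = id"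
proof (induction "is")
  case (Cons i "is")
  have "word_perm (sigma_word ((i # is) @ rev (i # is)))
      = adjacent i \<circ> (word_perm (sigma_word (is @ rev is)) \<circ> adjacent i)"
    by (simp add: sigma_word_def word_perm_append comp_assoc)
  then show ?case using Cons by (simp add: fun_eq_iff)
qed (simp add: sigma_word_def)

text \<open>
  The strand \<open>k\<close> moves to the last position and back, and crosses each strand on its way twice.
  Removing the outermost letters of the palindrome gives the same word for \<open>k + 1\<close>.
\<close>

lemma crossings_palindrome:
  assumes "k \<le> n" "i \<noteq> j"
  shows "crossings (sigma_word ([k..<n] @ rev [k..<n])) i j =
    2 * of_bool ((i = k \<or> j = k) \<and> i \<in> {k..n} \<and> j \<in> {k..n})"
  using assms
proof (induction k arbitrary: i j rule: inc_induct)
  case base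
  then show ?case by (auto simp: sigma_word_def)
next
  case (step k)
  let ?P = "sigma_word ([Suc k..<n] @ rev [Suc k..<n])"
  have "sigma_word ([k..<n] @ rev [k..<n]) = (k, True) # ?P @ [(k, True)]"
    using step by (simp add: upt_conv_Cons sigma_word_def)
  moreover have "word_perm ?P = id" by (rule word_perm_palindrome)
  moreover have "{adjacent k i, adjacent k j} = {k, Suc k} \<longleftrightarrow> {i, j} = {k, Suc k}"
    by (auto simp: adjacent_apply doubleton_eq_iff)
  ultimately have "crossings (sigma_word ([k..<n] @ rev [k..<n])) i j =
      crossings ?P (adjacent k i) (adjacent k j) + 2 * of_bool ({i, j} = {k, Suc k})"
    by (simp add: crossings_append word_perm_append)
  also have "crossings ?P (adjacent k i) (adjacent k j) =
      2 * of_bool ((adjacent k i = Suc k \<or> adjacent k j = Suc k) \<and>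
        adjacent k i \<in> {Suc k..n} \<and> adjacent k j \<in> {Suc k..n})"
    using step by (intro step.IH) simp
  finally show ?case
    using step by (auto simp: adjacent_apply doubleton_eq_iff)
qed

lemma crossings_far:
  assumes "a + 2 \<le> b \<or> b + 2 \<le> a"
  shows "word_perm (sigma_word [a, b]) = word_perm (sigma_word [b, a])"
    and "crossings (sigma_word [a, b]) i j = crossings (sigma_word [b, a]) i j"
proof -
  show "word_perm (sigma_word [a, b]) = word_perm (sigma_word [b, a])"
    using assms by (auto simp: fun_eq_iff sigma_word_def adjacent_apply)
  have "{adjacent b i, adjacent b j} = {a, Suc a} \<longleftrightarrow> {i, j} = {a, Suc a}" if "a + 2 \<le> b \<or> b + 2 \<le> a" for a b
    using that by (auto simp: adjacent_apply doubleton_eq_iff)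
  then show "crossings (sigma_word [a, b]) i j = crossings (sigma_word [b, a]) i j"
    using assms by (auto simp: sigma_word_def)
qed

lemma crossings_braid:
  "word_perm (sigma_word [a, a + 1, a]) = word_perm (sigma_word [a + 1, a, a + 1])"
  "crossings (sigma_word [a, a + 1, a]) i j = crossings (sigma_word [a + 1, a, a + 1]) i j"
proof -
  show "word_perm (sigma_word [a, a + 1, a]) = word_perm (sigma_word [a + 1, a, a + 1])"
    by (auto simp: fun_eq_iff sigma_word_def adjacent_apply)
  have 1: "{adjacent a (adjacent (Suc a) i), adjacent a (adjacent (Suc a) j)} = {Suc a, Suc (Suc a)}
      \<longleftrightarrow> {i, j} = {a, Suc a}"
    by (auto simp: adjacent_apply doubleton_eq_iff)
  have 2: "{adjacent (Suc a) (adjacent a i), adjacent (Suc a) (adjacent a j)} = {a, Suc a}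
      \<longleftrightarrow> {i, j} = {Suc a, Suc (Suc a)}"
    by (auto simp: adjacent_apply doubleton_eq_iff)
  have 3: "{adjacent a i, adjacent a j} = {Suc a, Suc (Suc a)}
      \<longleftrightarrow> {adjacent (Suc a) i, adjacent (Suc a) j} = {a, Suc a}"
    by (auto simp: adjacent_apply doubleton_eq_iff)
  show "crossings (sigma_word [a, a + 1, a]) i j = crossings (sigma_word [a + 1, a, a + 1]) i j"
    by (simp add: sigma_word_def 1 2 3)
qed

lemma crossings_equiv_rels:
  assumes "(u, v) \<in> sphere_braid_rels n"
  shows "crossings_equiv n u v"
  using assms
proof (cases rule: sphere_braid_rels_cases)
  case (far a b)
  then show ?thesis
    using crossings_far[of a b] unfolding crossings_equiv_def
    by (intro conjI exI[of _ "\<lambda>_. 0"]) auto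
next
  case (braid a)
  then show ?thesis
    using crossings_braid[of a] unfolding crossings_equiv_def
    by (intro conjI exI[of _ "\<lambda>_. 0"]) auto
next
  case sphere
  show ?thesis
  proof (cases "n = 0")
    case False
    then have "crossings u i j = crossings v i j + 2 * (of_bool (i = 1) + of_bool (j = 1))"
      if "i \<in> {1..n}" "j \<in> {1..n}" "i \<noteq> j" for i j
      using crossings_palindrome[of 1 n i j] that unfolding sphere by auto
    then show ?thesis
      unfolding crossings_equiv_def using word_perm_palindrome[of "[1..<n]"] sphere
      by (intro conjI exI[of _ "\<lambda>i. of_bool (i = 1)"]) auto
  qed (simp add: sphere crossings_equiv_def sigma_word_def)
qed

lemma crossings_equiv_pres_eq:
  assumes "pres_eq {1..<n} (sphere_braid_rels n) u v"
  shows "crossings_equiv n u v"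
  using assms
proof (induction rule: pres_eq.induct)
  case (refl w)
  show ?case unfolding crossings_equiv_def by (intro conjI exI[of _ "\<lambda>_. 0"]) auto
next
  case (sym u v)
  then obtain c where "word_perm u = word_perm v"
    "\<forall>i\<in>{1..n}. \<forall>j\<in>{1..n}. i \<noteq> j \<longrightarrow> crossings u i j = crossings v i j + 2 * (c i + c j)"
    unfolding crossings_equiv_def by blast
  then show ?case
    unfolding crossings_equiv_def by (intro conjI exI[of _ "\<lambda>i. - c i"]) auto
next
  case (trans u v w)
  obtain c where c: "word_perm u = word_perm v"
    "\<forall>i\<in>{1..n}. \<forall>j\<in>{1..n}. i \<noteq> j \<longrightarrow> crossings u i j = crossings v i j + 2 * (c i + c j)"
    using trans(3) unfolding crossings_equiv_def by blast
  obtain d where d: "word_perm v = word_perm w"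
    "\<forall>i\<in>{1..n}. \<forall>j\<in>{1..n}. i \<noteq> j \<longrightarrow> crossings v i j = crossings w i j + 2 * (d i + d j)"
    using trans(4) unfolding crossings_equiv_def by blast
  show ?case
    unfolding crossings_equiv_def using c d by (intro conjI exI[of _ "\<lambda>i. c i + d i"]) auto
next
  case (append u u' v v')
  obtain c where c: "word_perm u = word_perm u'"
    "\<forall>i\<in>{1..n}. \<forall>j\<in>{1..n}. i \<noteq> j \<longrightarrow> crossings u i j = crossings u' i j + 2 * (c i + c j)"
    using append(3) unfolding crossings_equiv_def by blast
  obtain d where d: "word_perm v = word_perm v'"
    "\<forall>i\<in>{1..n}. \<forall>j\<in>{1..n}. i \<noteq> j \<longrightarrow> crossings v i j = crossings v' i j + 2 * (d i + d j)"
    using append(4) unfolding crossings_equiv_def by blast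
  have "word_perm v' permutes {1..n}"
    using append(2) pres_eq_words word_perm_permutes by blast
  then have "word_perm v' i \<in> {1..n}" if "i \<in> {1..n}" for i
    using that permutes_in_image[of "word_perm v'" "{1..n}" i] by blast
  then have "crossings (u @ v) i j = crossings (u' @ v') i j +
      2 * ((d i + c (word_perm v' i)) + (d j + c (word_perm v' j)))"
    if "i \<in> {1..n}" "j \<in> {1..n}" "i \<noteq> j" for i j
    using that c(2) d by (simp add: crossings_append)
  then show ?case
    unfolding crossings_equiv_def using c(1) d(1)
    by (intro conjI exI[of _ "\<lambda>i. d i + c (word_perm v' i)"]) (auto simp: word_perm_append)
next
  case (cancel a b)
  have "{adjacent a i, adjacent a j} = {a, Suc a} \<longleftrightarrow> {i, j} = {a, Suc a}" for i j
    by (auto simp: adjacent_apply doubleton_eq_iff)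
  then show ?case
    unfolding crossings_equiv_def by (intro conjI exI[of _ "\<lambda>_. 0"]) (auto simp: fun_eq_iff)
next
  case (rel u v)
  then show ?case using crossings_equiv_rels by blast
qed

lemma bij_betw_distinct_pairs:
  assumes "p permutes S"
  shows "bij_betw (map_prod p p) {(i, j). i \<in> S \<and> j \<in> S \<and> i \<noteq> j}
    {(i, j). i \<in> S \<and> j \<in> S \<and> i \<noteq> j}"
proof (rule bij_betw_byWitness[where f' = "map_prod (inv' p) (inv' p)"])
  have i: "inv' p permutes S" by (rule permutes_inv[OF assms])
  show "map_prod p p ` {(i, j). i \<in> S \<and> j \<in> S \<and> i \<noteq> j} \<subseteq> {(i, j). i \<in> S \<and> j \<in> S \<and> i \<noteq> j}"
    using permutes_in_image[OF assms] permutes_inj[OF assms] by (auto simp: inj_eq)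
  show "map_prod (inv' p) (inv' p) ` {(i, j). i \<in> S \<and> j \<in> S \<and> i \<noteq> j}
      \<subseteq> {(i, j). i \<in> S \<and> j \<in> S \<and> i \<noteq> j}"
    using permutes_in_image[OF i] permutes_inj[OF i] by (auto simp: inj_eq)
qed (use permutes_inverses[OF assms] in auto)

text \<open>
  Every letter is a crossing of exactly one pair of strands, which is counted in both orders.
\<close>

lemma sum_crossings:
  assumes "w \<in> words {1..<n}"
  shows "(\<Sum>(i, j) | i \<in> {1..n} \<and> j \<in> {1..n} \<and> i \<noteq> j. crossings w i j) = 2 * exponent w"
  using assms
proof (induction w)
  case (Cons p w)
  let ?Q = "{(i, j). i \<in> {1..n} \<and> j \<in> {1..n} \<and> i \<noteq> j}"
  have finQ: "finite ?Q" by (rule finite_subset[of _ "{1..n} \<times> {1..n}"]) auto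
  obtain a b where p: "p = (a, b)" by (cases p)
  with Cons.prems have a: "a \<in> {1..<n}" and w: "w \<in> words {1..<n}" by auto
  let ?e = "if b then 1 else - 1 :: int"
  let ?g = "\<lambda>(i, j). if {i, j} = {a, Suc a} then ?e else 0"
  have perm: "word_perm w permutes {1..n}" by (rule word_perm_permutes[OF w])
  have "bij_betw (map_prod (word_perm w) (word_perm w)) ?Q ?Q"
    by (rule bij_betw_distinct_pairs[OF perm])
  from sum.reindex_bij_betw[OF this, of ?g]
  have "(\<Sum>q\<in>?Q. ?g (map_prod (word_perm w) (word_perm w) q)) = (\<Sum>q\<in>?Q. ?g q)" .
  also have "\<dots> = (\<Sum>q\<in>{(a, Suc a), (Suc a, a)}. ?g q)"
    by (rule sum.mono_neutral_right[OF finQ]) (use a in \<open>auto simp: doubleton_eq_iff split: if_splits\<close>)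
  also have "\<dots> = 2 * ?e" by (simp add: insert_commute)
  finally have g: "(\<Sum>q\<in>?Q. ?g (map_prod (word_perm w) (word_perm w) q)) = 2 * ?e" .
  have "(\<Sum>(i, j)\<in>?Q. crossings (p # w) i j) =
      (\<Sum>q\<in>?Q. (\<lambda>(i, j). crossings w i j) q + ?g (map_prod (word_perm w) (word_perm w) q))"
    by (rule sum.cong) (auto simp: p)
  also have "\<dots> = 2 * exponent w + 2 * ?e"
    unfolding sum.distrib g using Cons.IH[OF w] by simp
  finally show ?case by (simp add: p)
qed (simp add: case_prod_unfold)

section \<open>Exponents of torsion elements\<close>

lemma word_power:
  "word_perm (concat (replicate k w)) = word_perm w ^^ k"
  "crossings (concat (replicate k w)) i j =
     (\<Sum>r<k. crossings w ((word_perm w ^^ r) i) ((word_perm w ^^ r) j))"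
proof -
  show perm: "word_perm (concat (replicate k w)) = word_perm w ^^ k" for k
    by (induction k) (auto simp: word_perm_append)
  show "crossings (concat (replicate k w)) i j =
     (\<Sum>r<k. crossings w ((word_perm w ^^ r) i) ((word_perm w ^^ r) j))"
    by (induction k) (auto simp: crossings_append perm)
qed

lemma sum_over_orbit_period:
  fixes g :: "'a \<Rightarrow> int"
  assumes "bij_betw f Q Q"
  shows "(\<Sum>q\<in>Q. \<Sum>r<k. g ((f ^^ r) q)) = int k * (\<Sum>q\<in>Q. g q)"
proof -
  have "(\<Sum>q\<in>Q. g ((f ^^ r) q)) = (\<Sum>q\<in>Q. g q)" for r
  proof (induction r)
    case (Suc r)
    have "(\<Sum>q\<in>Q. g ((f ^^ Suc r) q)) = (\<Sum>q\<in>Q. g ((f ^^ r) (f q)))"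
      by (simp add: funpow_swap1)
    also have "\<dots> = (\<Sum>q\<in>Q. g ((f ^^ r) q))"
      by (rule sum.reindex_bij_betw[OF assms])
    finally show ?case using Suc by simp
  qed simp
  then have "(\<Sum>r<k. \<Sum>q\<in>Q. g ((f ^^ r) q)) = int k * (\<Sum>q\<in>Q. g q)" by simp
  then show ?thesis by (subst sum.swap)
qed

text \<open>
  A set of pairs of strands that is permuted by the braid has an even total number of crossings:
  the strands of a pair cross an odd number of times if and only if the pair and its image are
  ordered differently, and as many pairs turn from increasing to decreasing as the other way round.
\<close>

lemma even_sum_crossings:
  assumes "bij_betw (map_prod (word_perm w) (word_perm w)) Q Q" "\<And>i j. (i, j) \<in> Q \<Longrightarrow> i \<noteq> j"
  shows "even (\<Sum>(i, j)\<in>Q. crossings w i j)"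
proof -
  let ?f = "map_prod (word_perm w) (word_perm w)"
  define d where "d q = (of_bool (snd q < fst q) :: int)" for q :: "nat \<times> nat"
  define cr where "cr q = crossings w (fst q) (snd q)" for q
  have "even (cr q + d q + d (?f q))" if "q \<in> Q" for q
  proof -
    obtain i j where q: "q = (i, j)" by (cases q)
    with assms(2) that have "i \<noteq> j" by blast
    then have "odd (cr q) \<longleftrightarrow> (i < j) \<noteq> (word_perm w i < word_perm w j)"
      using odd_crossings_iff by (simp add: cr_def q)
    moreover have "word_perm w i \<noteq> word_perm w j" using \<open>i \<noteq> j\<close> by simp
    ultimately show ?thesis using \<open>i \<noteq> j\<close> by (auto simp: d_def q)
  qed
  then have "even (\<Sum>q\<in>Q. cr q + d q + d (?f q))" by (intro dvd_sum) auto
  also have "(\<Sum>q\<in>Q. cr q + d q + d (?f q)) = (\<Sum>q\<in>Q. cr q) + (\<Sum>q\<in>Q. d q) + (\<Sum>q\<in>Q. d (?f q))"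
    by (simp add: sum.distrib)
  also have "(\<Sum>q\<in>Q. d (?f q)) = (\<Sum>q\<in>Q. d q)"
    by (rule sum.reindex_bij_betw[OF assms(1)])
  finally show ?thesis by (simp add: cr_def case_prod_unfold)
qed

text \<open>
  Let \<open>\<tau>\<close> be the permutation of \<open>w\<close>. Adding up crossings over a \<open>\<tau>\<close>-invariant set \<open>Q\<close>
  of pairs of strands gives an even number \<open>2 m\<close>, and comparing with the \<open>k\<close>-th power, whose
  crossing numbers are \<open>2 (c\<^sub>i + c\<^sub>j)\<close> because it is trivial, gives
  \<open>k m = \<Sum>\<^bsub>(i,j)\<in>Q\<^esub> (c\<^sub>i + c\<^sub>j)\<close>. The exponent \<open>e\<close> is the number \<open>m\<close> of the set of all pairs, so
  \<open>k e = 2 (n - 1) \<Sum>\<^sub>i c\<^sub>i\<close>.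

  The pairs \<open>(i, \<tau> i)\<close> show that the sum of \<open>2 c\<^sub>i\<close> over the points moved by \<open>\<tau>\<close> is
  divisible by \<open>k\<close>. If \<open>\<tau>\<close> has no fixed point, then \<open>n - 1\<close> divides \<open>e\<close>. The same holds if there
  are at least two fixed points, since \<open>k\<close> divides \<open>c\<^sub>i + c\<^sub>j\<close> for any two of them. If \<open>z\<close> is
  the only fixed point, then the pairs \<open>(z, i)\<close> give \<open>e = (n - 2) m\<^sub>1 + 2 m\<^sub>2\<close>, where \<open>m\<^sub>1\<close> and \<open>m\<^sub>2\<close>
  belong to the pairs \<open>(i, \<tau> i)\<close> and \<open>(z, i)\<close>; for even \<open>n\<close> this is even.
\<close>

lemma torsion_exponent:
  fixes n k :: nat
  assumes n: "3 \<le> n" "even n" and w: "w \<in> words {1..<n}"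
    and k: "k > 0" and trivial: "crossings_equiv n (concat (replicate k w)) []"
  shows "even (exponent w) \<or> (int n - 1) dvd exponent w"
proof -
  let ?W = "concat (replicate k w)" and ?p = "word_perm w"
  define S where "S = {1..n}"
  have finS: "finite S" and cardS: "card S = n" by (simp_all add: S_def)
  have p: "?p permutes S" unfolding S_def by (rule word_perm_permutes[OF w])
  have pS: "?p i \<in> S \<longleftrightarrow> i \<in> S" for i by (rule permutes_in_image[OF p])
  from trivial obtain c where perm: "?p ^^ k = id"
    and c: "\<And>i j. i \<in> S \<Longrightarrow> j \<in> S \<Longrightarrow> i \<noteq> j \<Longrightarrow> crossings ?W i j = 2 * (c i + c j)"
    unfolding crossings_equiv_def S_def by (auto simp: word_power(1))
  \<comment> \<open>The numbers \<open>c i\<close> are invariant, because they are determined by the crossings of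
      \<open>?W\<close> and \<open>?W\<close> commutes with \<open>w\<close>.\<close>
  have inv: "crossings ?W (?p i) (?p j) = crossings ?W i j" for i j
  proof -
    have "?W @ w = w @ ?W" by (induction k) auto
    then have "crossings (?W @ w) i j = crossings (w @ ?W) i j" by simp
    then show ?thesis by (simp add: crossings_append word_power(1) perm)
  qed
  have cinv: "c (?p i) = c i" if i: "i \<in> S" for i
  proof -
    have "card (S - {i}) \<ge> 2" using i n(1) finS cardS by simp
    then obtain j l where jl: "j \<in> S - {i}" "l \<in> S - {i}" "j \<noteq> l"
      by (metis card_le_Suc0_iff_eq finS finite_Diff not_less_eq_eq numeral_2_eq_2)
    have "4 * c x = crossings ?W x y + crossings ?W x z - crossings ?W y z"
      if "x \<in> S" "y \<in> S" "z \<in> S" "x \<noteq> y" "x \<noteq> z" "y \<noteq> z" for x y z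
      using c that by simp
    from this[of i j l] this[of "?p i" "?p j" "?p l"] show ?thesis
      using jl i by (auto simp: inv pS)
  qed
  have core: "\<exists>m. (\<Sum>(i, j)\<in>Q. crossings w i j) = 2 * m \<and> int k * m = (\<Sum>(i, j)\<in>Q. c i + c j)"
    if Q: "bij_betw (map_prod ?p ?p) Q Q" "\<And>i j. (i, j) \<in> Q \<Longrightarrow> i \<in> S \<and> j \<in> S \<and> i \<noteq> j" for Q
  proof -
    obtain m where m: "(\<Sum>(i, j)\<in>Q. crossings w i j) = 2 * m"
      using even_sum_crossings[OF Q(1)] Q(2) by (meson evenE)
    have pow: "(map_prod ?p ?p ^^ r) q = ((?p ^^ r) (fst q), (?p ^^ r) (snd q))" for r q
      by (induction r) (auto simp: map_prod_def case_prod_unfold)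
    have "2 * (\<Sum>(i, j)\<in>Q. c i + c j) = (\<Sum>q\<in>Q. crossings ?W (fst q) (snd q))"
      unfolding sum_distrib_left using Q(2) c by (intro sum.cong) auto
    also have "\<dots> = (\<Sum>q\<in>Q. \<Sum>r<k. (\<lambda>(i, j). crossings w i j) ((map_prod ?p ?p ^^ r) q))"
      by (simp add: word_power(2) pow)
    also have "\<dots> = int k * (\<Sum>(i, j)\<in>Q. crossings w i j)"
      by (rule sum_over_orbit_period[OF Q(1)])
    finally show ?thesis using m by (intro exI[of _ m]) simp
  qed
  define e where "e = exponent w"
  define C where "C = (\<Sum>i\<in>S. c i)"
  have total: "int k * e = 2 * (int n - 1) * C"
  proof -
    let ?Q = "{(i, j). i \<in> S \<and> j \<in> S \<and> i \<noteq> j}"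
    obtain m where m: "(\<Sum>(i, j)\<in>?Q. crossings w i j) = 2 * m" "int k * m = (\<Sum>(i, j)\<in>?Q. c i + c j)"
      using core[OF bij_betw_distinct_pairs[OF p]] by blast
    have "m = e" using m(1) sum_crossings[OF w] unfolding S_def e_def by simp
    have Qs: "?Q = Sigma S (\<lambda>i. S - {i})" by auto
    have "(\<Sum>(i, j)\<in>?Q. c i + c j) = (\<Sum>i\<in>S. \<Sum>j\<in>S - {i}. c i + c j)"
      unfolding Qs by (subst sum.Sigma) (use finS in auto)
    also have "\<dots> = (\<Sum>i\<in>S. (int n - 2) * c i + C)"
    proof (rule sum.cong)
      fix i assume i: "i \<in> S"
      have "(\<Sum>j\<in>S - {i}. c j) = C - c i" unfolding C_def using i finS by (simp add: sum_diff1)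
      moreover have "int (card (S - {i})) = int n - 1" using i finS cardS n(1) by simp
      moreover have "(\<Sum>j\<in>S - {i}. c i + c j) = int (card (S - {i})) * c i + (\<Sum>j\<in>S - {i}. c j)"
        by (simp add: sum.distrib)
      ultimately have "(\<Sum>j\<in>S - {i}. c i + c j) = (int n - 1) * c i + (C - c i)" by simp
      then show "(\<Sum>j\<in>S - {i}. c i + c j) = (int n - 2) * c i + C"
        by (simp add: algebra_simps)
    qed simp
    also have "\<dots> = (int n - 2) * C + int n * C"
      by (simp add: sum.distrib cardS C_def flip: sum_distrib_left)
    also have "\<dots> = 2 * (int n - 1) * C" by (simp add: algebra_simps)
    finally show ?thesis using m \<open>m = e\<close> by simp
  qed
  define F where "F = {i \<in> S. ?p i = i}"
  define M where "M = S - F"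
  have fin: "finite F" "finite M" using finS by (auto simp: F_def M_def)
  have pM: "?p i \<in> M \<longleftrightarrow> i \<in> M" for i by (auto simp: M_def F_def pS)
  have pM': "?p permutes M"
  proof (rule permutes_superset[OF p])
    show "?p x = x" if "x \<in> S - M" for x using that by (auto simp: M_def F_def)
  qed
  define CM where "CM = (\<Sum>i\<in>M. c i)"
  define CF where "CF = (\<Sum>i\<in>F. c i)"
  have C: "C = CM + CF"
    unfolding C_def CM_def CF_def M_def using finS by (subst sum.subset_diff[of F S]) (auto simp: F_def)
  obtain m1 where m1: "int k * m1 = 2 * CM"
  proof -
    let ?Q = "(\<lambda>i. (i, ?p i)) ` M"
    have inj: "inj_on (\<lambda>i. (i, ?p i)) M" by (auto simp: inj_on_def)
    have "map_prod ?p ?p ` ?Q = (\<lambda>i. (i, ?p i)) ` (?p ` M)" by (auto simp: image_image)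
    then have "bij_betw (map_prod ?p ?p) ?Q ?Q"
      using permutes_image[OF pM'] by (auto simp: bij_betw_def inj_on_def)
    moreover have "i \<in> S \<and> j \<in> S \<and> i \<noteq> j" if "(i, j) \<in> ?Q" for i j
      using that pS by (auto simp: M_def F_def)
    ultimately obtain m where "int k * m = (\<Sum>(i, j)\<in>?Q. c i + c j)" using core[of ?Q] by blast
    also have "\<dots> = (\<Sum>i\<in>M. c i + c (?p i))" by (simp add: sum.reindex[OF inj])
    also have "\<dots> = 2 * CM"
      unfolding CM_def sum_distrib_left by (rule sum.cong) (auto simp: cinv M_def)
    finally show thesis by (rule that)
  qed
  have fixed: "\<exists>m. int k * m = (\<Sum>i\<in>T. c z + c i)" if z: "z \<in> F" and T: "z \<notin> T" "bij_betw ?p T T" "T \<subseteq> S" for z T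
  proof -
    let ?Q = "Pair z ` T"
    have "map_prod ?p ?p ` ?Q = Pair z ` (?p ` T)" using z by (auto simp: F_def image_image)
    then have "bij_betw (map_prod ?p ?p) ?Q ?Q"
      using T(2) by (auto simp: bij_betw_def inj_on_def)
    moreover have "i \<in> S \<and> j \<in> S \<and> i \<noteq> j" if "(i, j) \<in> ?Q" for i j
      using that z T by (auto simp: F_def)
    ultimately obtain m where "int k * m = (\<Sum>(i, j)\<in>?Q. c i + c j)" using core[of ?Q] by blast
    also have "\<dots> = (\<Sum>i\<in>T. c z + c i)" by (simp add: sum.reindex inj_on_def)
    finally show ?thesis by blast
  qed
  have k0: "int k \<noteq> 0" using k by simp
  consider "F = {}" | z where "F = {z}" | "2 \<le> card F"
    using fin(1) by (metis One_nat_def card_0_eq card_1_singletonE less_2_cases not_le)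
  then show ?thesis
  proof cases
    case 1
    then have "int k * e = int k * ((int n - 1) * m1)"
      using total m1 C by (simp add: CF_def algebra_simps)
    then show ?thesis using k0 by (simp add: e_def)
  next
    case 2
    have "z \<in> F" "z \<notin> M" "M \<subseteq> S" using 2 by (auto simp: M_def)
    then obtain m2 where "int k * m2 = (\<Sum>i\<in>M. c z + c i)" using fixed permutes_imp_bij[OF pM'] by blast
    moreover have "int (card M) = int n - 1"
    proof -
      have "z \<in> S" using \<open>z \<in> F\<close> by (simp add: F_def)
      then have "card M = n - 1" unfolding M_def 2 using cardS by simp
      then show ?thesis using n(1) by simp
    qed
    ultimately have m2: "int k * m2 = (int n - 1) * c z + CM" by (simp add: sum.distrib CM_def)
    have "CF = c z" using 2 by (simp add: CF_def)
    then have "int k * e = (int n - 2) * (2 * CM) + 2 * ((int n - 1) * c z + CM)"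
      using total C by (simp add: algebra_simps)
    also have "\<dots> = int k * ((int n - 2) * m1 + 2 * m2)"
      unfolding m1[symmetric] m2[symmetric] by (simp add: algebra_simps)
    finally have "e = (int n - 2) * m1 + 2 * m2" using k0 by simp
    then show ?thesis using n(2) by (simp add: e_def)
  next
    case 3
    have bijF: "bij_betw ?p T T" if "T \<subseteq> F" for T
    proof -
      have "bij_betw ?p T T \<longleftrightarrow> bij_betw id T T"
        by (rule bij_betw_cong) (use that in \<open>auto simp: F_def\<close>)
      then show ?thesis by simp
    qed
    have FS: "F \<subseteq> S" by (auto simp: F_def)
    have pair: "\<exists>m. int k * m = c x + c y" if "x \<in> F" "y \<in> F" "x \<noteq> y" for x y
      using fixed[OF that(1), of "{y}"] bijF[of "{y}"] that FS by auto
    obtain z where z: "z \<in> F" using 3 by fastforce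
    obtain m3 where m3: "int k * m3 = (\<Sum>i\<in>F - {z}. c z + c i)"
      using fixed[OF z, of "F - {z}"] bijF[of "F - {z}"] FS by auto
    have "(\<Sum>i\<in>F - {z}. c z + c i) = (int (card F) - 2) * c z + CF"
    proof -
      have "int (card (F - {z})) = int (card F) - 1" using z fin 3 by simp
      moreover have "(\<Sum>i\<in>F - {z}. c i) = CF - c z"
        unfolding CF_def using z fin by (simp add: sum_diff1)
      moreover have "(\<Sum>i\<in>F - {z}. c z + c i) = int (card (F - {z})) * c z + (\<Sum>i\<in>F - {z}. c i)"
        by (simp add: sum.distrib)
      ultimately have "(\<Sum>i\<in>F - {z}. c z + c i) = (int (card F) - 1) * c z + (CF - c z)" by simp
      then show ?thesis by (simp add: algebra_simps)
    qed
    with m3 have m3: "int k * m3 = (int (card F) - 2) * c z + CF" by simp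
    have "\<exists>m. int k * m = 2 * CF"
    proof (cases "card F = 2")
      case True
      then show ?thesis using m3 by (intro exI[of _ "2 * m3"]) simp
    next
      case False
      then have "card (F - {z}) \<ge> 2" using z fin 3 by simp
      then obtain x y where xy: "x \<in> F - {z}" "y \<in> F - {z}" "x \<noteq> y"
        by (metis card_le_Suc0_iff_eq fin(1) finite_Diff not_less_eq_eq numeral_2_eq_2)
      obtain a b d where "int k * a = c z + c x" "int k * b = c z + c y" "int k * d = c x + c y"
        using pair[of z x] pair[of z y] pair[of x y] z xy by auto
      then have cz: "int k * (a + b - d) = 2 * c z" by (simp add: algebra_simps)
      have "2 * CF = 2 * (int k * m3) - (int (card F) - 2) * (2 * c z)"
        unfolding m3 by (simp add: algebra_simps)
      also have "\<dots> = int k * (2 * m3 - (int (card F) - 2) * (a + b - d))"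
        unfolding cz[symmetric] by (simp add: algebra_simps)
      finally show ?thesis by metis
    qed
    then obtain m where m: "int k * m = 2 * CF" by blast
    have "int k * e = (int n - 1) * (2 * CM + 2 * CF)" using total C by (simp add: algebra_simps)
    also have "\<dots> = int k * ((int n - 1) * (m1 + m))"
      unfolding m1[symmetric] m[symmetric] by (simp add: algebra_simps)
    finally have "e = (int n - 1) * (m1 + m)" using k0 by simp
    then show ?thesis by (simp add: e_def)
  qed
qed

section \<open>Linking numbers of pure braids\<close>

primrec twist_word :: "nat \<Rightarrow> nat \<Rightarrow> nat word" where
  "twist_word i 0 = [(i, True), (i, True)]"
| "twist_word i (Suc d) = (i + Suc d, True) # twist_word i d @ [(i + Suc d, False)]"

lemma word_perm_twist_word: "word_perm (twist_word i d) = id"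
proof (induction d)
  case (Suc d)
  have "word_perm (twist_word i (Suc d)) =
      adjacent (i + Suc d) \<circ> (word_perm (twist_word i d) \<circ> adjacent (i + Suc d))"
    by (simp add: word_perm_append)
  then show ?case using Suc by (simp add: fun_eq_iff)
qed (simp add: fun_eq_iff)

lemma crossings_twist_word:
  assumes "k \<noteq> l"
  shows "crossings (twist_word i d) k l = 2 * of_bool ({k, l} = {i, i + Suc d})"
  using assms
proof (induction d arbitrary: k l)
  case 0
  have "{adjacent i k, adjacent i l} = {i, Suc i} \<longleftrightarrow> {k, l} = {i, Suc i}"
    by (auto simp: adjacent_apply doubleton_eq_iff)
  then show ?case by simp
next
  case (Suc d)
  let ?j = "i + Suc d"
  have "{adjacent ?j k, adjacent ?j l} = {?j, Suc ?j} \<longleftrightarrow> {k, l} = {?j, Suc ?j}"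
    by (auto simp: adjacent_apply doubleton_eq_iff)
  then have "crossings (twist_word i (Suc d)) k l = crossings (twist_word i d) (adjacent ?j k) (adjacent ?j l)"
    by (simp add: crossings_append word_perm_append word_perm_twist_word)
  also have "\<dots> = 2 * of_bool ({adjacent ?j k, adjacent ?j l} = {i, ?j})"
    using Suc.prems by (intro Suc.IH) simp
  also have "{adjacent ?j k, adjacent ?j l} = {i, ?j} \<longleftrightarrow> {k, l} = {i, i + Suc (Suc d)}"
    by (auto simp: adjacent_apply doubleton_eq_iff split: if_splits)
  finally show ?case .
qed

lemma even_crossings_pure:
  assumes "word_perm w = id"
  shows "even (crossings w i j)"
proof (cases "i = j")
  case True
  have "crossings w i i = 0" by (induction w) auto
  then show ?thesis using True by simp
next
  case False
  then show ?thesis using odd_crossings_iff[OF False, of w] assms by simp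
qed

text \<open>
  Half the number of crossings among three strands. A strand that runs once around all the others
  adds 4 to this number of crossings if it is one of the three, and nothing otherwise, so the half is
  well defined modulo 2.
\<close>

definition triangle_link :: "nat word \<Rightarrow> nat \<Rightarrow> nat \<Rightarrow> nat \<Rightarrow> int" where
  "triangle_link w i j k = (crossings w i j + crossings w i k + crossings w j k) div 2 mod 2"

lemma triangle_link_equiv:
  assumes "crossings_equiv n u v" "i \<in> {1..n}" "j \<in> {1..n}" "k \<in> {1..n}" "i \<noteq> j" "i \<noteq> k" "j \<noteq> k"
  shows "triangle_link u i j k = triangle_link v i j k"
proof -
  obtain c where c: "\<forall>i\<in>{1..n}. \<forall>j\<in>{1..n}. i \<noteq> j \<longrightarrow> crossings u i j = crossings v i j + 2 * (c i + c j)"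
    using assms(1) unfolding crossings_equiv_def by blast
  let ?s = "crossings v i j + crossings v i k + crossings v j k"
  have "crossings u i j + crossings u i k + crossings u j k = ?s + 4 * (c i + c j + c k)"
    using c assms by simp
  moreover have "(a + 4 * b) div 2 mod 2 = a div 2 mod 2" for a b :: int by presburger
  ultimately show ?thesis unfolding triangle_link_def by (simp only:)
qed

lemma triangle_link_append:
  assumes "word_perm u = id" "word_perm v = id"
  shows "triangle_link (u @ v) i j k = (triangle_link u i j k + triangle_link v i j k) mod 2"
proof -
  let ?t = "\<lambda>w. crossings w i j + crossings w i k + crossings w j k"
  have "even (?t u)" "even (?t v)" using assms even_crossings_pure by simp_all
  then obtain a b where ab: "?t u = 2 * a" "?t v = 2 * b" by (meson evenE)
  have "?t (u @ v) = 2 * (a + b)"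
    using ab assms by (simp add: crossings_append)
  then show ?thesis unfolding triangle_link_def ab by (simp add: mod_simps)
qed

lemma triangle_link_twist_word:
  assumes "k < l" "l < n" "i < j" "j < n" "l = k + Suc d"
  shows "triangle_link (twist_word k d) i j n = of_bool (k = i \<and> l = j)"
proof -
  have "crossings (twist_word k d) i j = 2 * of_bool (k = i \<and> l = j)"
    using crossings_twist_word[of i j k d] assms by (auto simp: doubleton_eq_iff)
  moreover have "crossings (twist_word k d) i n = 0" "crossings (twist_word k d) j n = 0"
    using crossings_twist_word[of i n k d] crossings_twist_word[of j n k d] assms
    by (auto simp: doubleton_eq_iff)
  ultimately show ?thesis by (simp add: triangle_link_def)
qed

context sphere_braids
begin

lemma class_eq_crossings_equiv:
  assumes "u \<in> words {1..<n}" "cls u = cls v"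
  shows "crossings_equiv n u v"
  using assms pres_class_eq_iff crossings_equiv_pres_eq by blast

lemma braid_perm_word_perm:
  assumes "w \<in> words {1..<n}"
  shows "braid_perm n (cls w) = word_perm w"
proof -
  interpret S: braid_system "sym_group n" n adjacent by (rule braid_system_sym_group)
  have "S.pr (map fst w) = word_perm w"
    by (induction w) (auto simp: sym_group_mult sym_group_one)
  then show ?thesis using braid_perm_class[OF assms] by simp
qed

text \<open>
  The words \<open>twist_word\<close> follow the recursion by which conjugation moves the second strand of a twist
  one step to the right.
\<close>

lemma twist_class:
  assumes "1 \<le> i" "i + Suc d \<le> n"
  shows "twist_word i d \<in> words {1..<n} \<and> cls (twist_word i d) = B.twist i (i + Suc d)"
  using assms
proof (induction d)
  case 0
  then show ?case
    using mult_class[of "[(i, True)]" "[(i, True)]"] B.twist_neighbours[of i]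
    by (simp add: sigma_def[of n i])
next
  case (Suc d)
  let ?j = "i + Suc d"
  have j: "?j \<in> {1..<n}" using Suc.prems by auto
  have IH: "twist_word i d \<in> words {1..<n}" "cls (twist_word i d) = B.twist i ?j"
    using Suc by auto
  have "cls ([(?j, True)] @ twist_word i d @ [(?j, False)]) =
      cls [(?j, True)] \<otimes>\<^bsub>B\<^esub> (cls (twist_word i d) \<otimes>\<^bsub>B\<^esub> cls [(?j, False)])"
    using IH(1) j by (simp add: mult_class del: One_nat_def)
  also have "\<dots> = B.conj_by (sigma n ?j) (B.twist i ?j)"
    unfolding IH(2) inv_sigma[OF j, symmetric] sigma_def[of n ?j, symmetric]
    by (rule B.m_assoc[symmetric]) (use j Suc.prems in \<open>auto intro: sigma_closed\<close>)
  also have "\<dots> = B.twist i (i + Suc (Suc d))"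
    using B.twist_Suc[of i ?j] Suc.prems by simp
  finally show ?case using IH j by simp
qed

abbreviation (input) "P \<equiv> kernel B (sym_group n) (braid_perm n)"

lemma subgroup_P: "subgroup P B"
  by (rule group_hom.subgroup_kernel[OF braid_perm_group_hom])

lemma pureE:
  assumes "x \<in> P"
  obtains w where "w \<in> words {1..<n}" "x = cls w" "word_perm w = id"
proof -
  have x: "x \<in> carrier B" "braid_perm n x = id"
    using assms by (auto simp: kernel_def sym_group_one)
  from carrierE[OF x(1)] obtain w where w: "w \<in> words {1..<n}" "x = cls w" by blast
  then show thesis using that x(2) braid_perm_word_perm[OF w(1)] by simp
qed

lemma twist_pure:
  assumes "1 \<le> i" "i < j" "j \<le> n"
  shows "B.twist i j \<in> P"
proof -
  obtain d where d: "j = i + Suc d" using assms(2) less_imp_Suc_add by fastforce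
  with assms twist_class[of i d] have t: "twist_word i d \<in> words {1..<n}" "cls (twist_word i d) = B.twist i j"
    by auto
  then have "braid_perm n (B.twist i j) = id"
    using braid_perm_word_perm[OF t(1)] word_perm_twist_word by simp
  then show ?thesis using assms B.twist_closed by (simp add: kernel_def sym_group_one)
qed

lemma generate_twists_pure: "generate B (B.twists (n - 1)) = P"
proof -
  have "generate B (B.twists n) \<lhd> B" by (rule B.normal_generate_twists[OF generate_sigma])
  then have "P \<subseteq> generate B (B.twists n)"
  proof (rule kernel_braid_perm_subset)
    show "sigma n i \<otimes>\<^bsub>B\<^esub> sigma n i \<in> generate B (B.twists n)" if "i \<in> {1..<n}" for i
      using B.twist_in[of i "Suc i" n] B.twist_neighbours[of i] that by simp
  qed
  moreover have "generate B (B.twists n) \<subseteq> P"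
    by (rule B.generate_subgroup_incl[OF _ subgroup_P]) (use twist_pure in \<open>auto simp: B.twists_def\<close>)
  ultimately show ?thesis using B.generate_twists_pred by simp
qed

text \<open>
  The last strand serves as third vertex of all triangles. The representing word is arbitrary, as
  \<open>link_class\<close> shows.
\<close>

definition link :: "nat \<times> nat \<Rightarrow> nat word set \<Rightarrow> int" where
  "link q x = triangle_link (SOME w. w \<in> words {1..<n} \<and> x = cls w) (fst q) (snd q) n"

definition pairs :: "(nat \<times> nat) set" where
  "pairs = {(i, j). 1 \<le> i \<and> i < j \<and> j < n}"

lemma link_class:
  assumes "w \<in> words {1..<n}" "(i, j) \<in> pairs"
  shows "link (i, j) (cls w) = triangle_link w i j n"
proof -
  define u where "u = (SOME u. u \<in> words {1..<n} \<and> cls w = cls u)"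
  have "u \<in> words {1..<n} \<and> cls w = cls u"
    unfolding u_def by (rule someI[of _ w]) (use assms in simp)
  then have "crossings_equiv n u w" by (intro class_eq_crossings_equiv) auto
  then show ?thesis
    unfolding link_def u_def[symmetric] fst_conv snd_conv
    by (rule triangle_link_equiv) (use assms(2) in \<open>auto simp: pairs_def\<close>)
qed

lemma finite_pairs: "finite pairs"
  by (rule finite_subset[of _ "{1..n} \<times> {1..n}"]) (auto simp: pairs_def)

lemma card_pairs: "card pairs = (n * (n - 3) + 2) div 2"
proof -
  have "pairs = (\<lambda>(j, i). (i, j)) ` (SIGMA j:{1..<n}. {1..<j})"
    by (auto simp: pairs_def image_iff)
  moreover have "inj_on (\<lambda>(j, i). (i, j)) (SIGMA j:{1..<n}. {1..<j})"
    by (auto simp: inj_on_def)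
  ultimately have "card pairs = (\<Sum>j = 1..<n. j - 1)"
    by (simp add: card_image)
  also have "\<dots> = (n - 1) * (n - 2) div 2"
  proof -
    have "2 * (\<Sum>j = 1..<Suc k. j - 1) = k * (k - 1)" for k :: nat
    proof (induction k)
      case (Suc k)
      then show ?case by (cases k) auto
    qed simp
    moreover have "Suc (n - 1) = n" "n - 1 - 1 = n - 2" using n3 by auto
    ultimately have "2 * (\<Sum>j = 1..<n. j - 1) = (n - 1) * (n - 2)" by metis
    then show ?thesis by (metis nonzero_mult_div_cancel_left zero_neq_numeral)
  qed
  also have "(n - 1) * (n - 2) = n * (n - 3) + 2"
  proof -
    obtain k where "n = k + 3" using n3 le_Suc_ex by (metis add.commute)
    then show ?thesis by (simp add: algebra_simps)
  qed
  finally show ?thesis .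
qed

lemma pure_ranks:
  shows "G_rank (sphere_pure_braid_group n) = enat ((n * (n - 3) + 2) div 2)"
    and "NG_rank (sphere_pure_braid_group n) = enat ((n * (n - 3) + 2) div 2)"
    and "G_rank (abelianisation (sphere_pure_braid_group n)) = enat ((n * (n - 3) + 2) div 2)"
proof -
  let ?P = "sphere_pure_braid_group n"
  have P: "?P = B\<lparr>carrier := P\<rparr>" by (simp add: sphere_pure_braid_group_def)
  interpret PG: group ?P unfolding P by (rule B.subgroup_imp_group[OF subgroup_P])
  let ?p = "\<lambda>(i, j). B.twist i j"
  have hom: "link q \<in> hom ?P (integer_mod_group 2)" if q: "q \<in> pairs" for q
  proof (rule homI)
    obtain i j where ij: "q = (i, j)" by (cases q)
    fix x assume "x \<in> carrier ?P"
    then have "x \<in> P" by (simp add: P)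
    then obtain u where u: "u \<in> words {1..<n}" "x = cls u" "word_perm u = id" by (rule pureE)
    have xu: "link q x = triangle_link u i j n" using link_class[OF u(1)] q u(2) ij by simp
    then show "link q x \<in> carrier (integer_mod_group 2)"
      by (simp add: carrier_integer_mod_group triangle_link_def)
    fix y assume "y \<in> carrier ?P"
    then have "y \<in> P" by (simp add: P)
    then obtain v where v: "v \<in> words {1..<n}" "y = cls v" "word_perm v = id" by (rule pureE)
    have "x \<otimes>\<^bsub>?P\<^esub> y = cls (u @ v)" using mult_class[OF u(1) v(1)] u v by (simp add: P)
    moreover have "link q (cls (u @ v)) = triangle_link (u @ v) i j n"
      using link_class[of "u @ v" i j] u(1) v(1) q ij by simp
    moreover have "link q y = triangle_link v i j n" using link_class[OF v(1)] q v(2) ij by simp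
    ultimately show "link q (x \<otimes>\<^bsub>?P\<^esub> y) = link q x \<otimes>\<^bsub>integer_mod_group 2\<^esub> link q y"
      using xu triangle_link_append[OF u(3) v(3)] by simp
  qed
  have closed: "?p q \<in> carrier ?P" if "q \<in> pairs" for q
    using that twist_pure by (auto simp: P pairs_def)
  have dual: "link r (?p q) = of_bool (q = r)" if "q \<in> pairs" "r \<in> pairs" for q r
  proof -
    obtain k l i j where q: "q = (k, l)" and r: "r = (i, j)" by (cases q, cases r)
    have kl: "1 \<le> k" "k < l" "l < n" "i < j" "j < n" using that by (auto simp: pairs_def q r)
    then obtain d where d: "l = k + Suc d" using less_imp_Suc_add by fastforce
    then have t: "twist_word k d \<in> words {1..<n}" "cls (twist_word k d) = B.twist k l"
      using twist_class[of k d] kl by auto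
    have "link r (?p q) = triangle_link (twist_word k d) i j n"
      using link_class[OF t(1)] that(2) t(2) by (simp add: q r)
    also have "\<dots> = of_bool (k = i \<and> l = j)"
      by (rule triangle_link_twist_word) (use kl d in auto)
    finally show ?thesis by (simp add: q r)
  qed
  have im: "?p ` pairs = B.twists (n - 1)"
    using n3 unfolding B.twists_def pairs_def by fastforce
  have "B.twists (n - 1) \<subseteq> P"
    using twist_pure by (auto simp: B.twists_def)
  then have gen: "generate ?P (?p ` pairs) = carrier ?P"
    unfolding im P using B.generate_consistent[OF _ subgroup_P] generate_twists_pure by simp
  note r = PG.ranks_eq_card[OF finite_pairs hom closed dual gen, unfolded card_pairs]
  show "G_rank ?P = enat ((n * (n - 3) + 2) div 2)"
    "NG_rank ?P = enat ((n * (n - 3) + 2) div 2)"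
    "G_rank (abelianisation ?P) = enat ((n * (n - 3) + 2) div 2)"
    using r by blast+
qed

end

section \<open>Ranks of the braid group of the sphere\<close>

lemma ecard_doubleton: "ecard {x, y} \<le> 2"
  by (auto simp: ecard_def numeral_eq_enat card_insert_if)

lemma ecard_singleton: "ecard {x} = 1"
  by (simp add: ecard_def one_enat_def)

context sphere_braids
begin

lemma class_power:
  assumes "w \<in> words {1..<n}"
  shows "concat (replicate k w) \<in> words {1..<n} \<and> cls (concat (replicate k w)) = cls w [^]\<^bsub>B\<^esub> k"
proof (induction k)
  case (Suc k)
  have "cls w [^]\<^bsub>B\<^esub> Suc k = cls w \<otimes>\<^bsub>B\<^esub> cls w [^]\<^bsub>B\<^esub> k"
    by (rule B.nat_pow_Suc2[OF class_closed[OF assms]])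
  then show ?case using Suc mult_class[OF assms, of "concat (replicate k w)"] assms by simp
qed (simp add: class_one)

lemma two_dvd: "0 < (2::nat) \<and> 2 dvd 2 * (n - 1)" and pred_dvd: "0 < n - 1 \<and> n - 1 dvd 2 * (n - 1)"
  using n3 by auto

lemma torsion_exponent_mod:
  assumes "even n" "x \<in> torsion B"
  shows "exponent_mod 2 x = 0 \<or> exponent_mod (n - 1) x = 0"
proof -
  obtain k :: nat where x: "x \<in> carrier B" and k: "k > 0" "x [^]\<^bsub>B\<^esub> k = \<one>\<^bsub>B\<^esub>"
    using assms(2) by (auto simp: torsion_def)
  obtain w where w: "w \<in> words {1..<n}" "x = cls w" using carrierE[OF x] .
  have "crossings_equiv n (concat (replicate k w)) []"
    using class_power[OF w(1), of k] k(2) w(2)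
    by (intro class_eq_crossings_equiv) (auto simp: class_one)
  then have "even (exponent w) \<or> (int n - 1) dvd exponent w"
    by (rule torsion_exponent[OF n3 assms(1) w(1) k(1)])
  moreover have "exponent_mod 2 x = exponent w mod int 2"
    unfolding w(2) using exponent_mod_class[OF _ _ w(1)] two_dvd by blast
  moreover have "exponent_mod (n - 1) x = exponent w mod int (n - 1)"
    unfolding w(2) using exponent_mod_class[OF _ _ w(1)] pred_dvd by blast
  moreover have "int n - 1 = int (n - 1)" using n3 by simp
  ultimately show ?thesis by (metis dvd_imp_mod_0 of_nat_numeral)
qed

text \<open>
  The kernel of a non-trivial homomorphism to a cyclic group is a proper normal subgroup.
\<close>

lemma normal_closure_in_exponent_kernel:
  assumes m: "0 < m" "m dvd 2 * (n - 1)" "m \<noteq> 1" and x: "x \<in> carrier B" "exponent_mod m x = 0"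
  shows "normal_closure B {x} \<noteq> carrier B"
proof
  interpret e: group_hom B "integer_mod_group m" "exponent_mod m" by (rule exponent_group_hom[OF m(1,2)])
  assume "normal_closure B {x} = carrier B"
  moreover have "normal_closure B {x} \<subseteq> kernel B (integer_mod_group m) (exponent_mod m)"
    using x by (intro normal_closure_minimal e.normal_kernel) (simp add: kernel_def)
  moreover have "B.pr [1] \<in> carrier B" using n3 by (intro B.pr_closed) auto
  ultimately have "exponent_mod m (B.pr [1]) = 0" by (auto simp: kernel_def)
  moreover have "exponent_mod m (B.pr [1]) = 1 mod int m"
    using exponent_mod_pr[OF m(1,2), of "[1]"] n3 by simp
  ultimately show False using m by (simp add: zmod_eq_0_iff)
qed

lemma no_normally_generating_torsion:
  assumes "even n" "x \<in> torsion B"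
  shows "normal_closure B {x} \<noteq> carrier B"
  using torsion_exponent_mod[OF assms] normal_closure_in_exponent_kernel[of 2 x]
    normal_closure_in_exponent_kernel[of "n - 1" x] two_dvd pred_dvd n3 assms(2) torsion_subset
  by fastforce

lemma alpha0_pr: "alpha0 n = B.pr [1..<n]"
  and alpha1_pr: "alpha1 n = B.pr ([1..<n] @ [n - 1])"
  and alpha2_pr: "alpha2 n = B.pr ([1..<n - 1] @ [n - 2])"
  by (simp_all only: alpha0_def alpha1_def alpha2_def sigma_prod_pr)

lemma alphas_torsion: "{alpha0 n, alpha1 n} \<subseteq> torsion B"
proof -
  have "alpha0 n \<in> carrier B" "alpha1 n \<in> carrier B"
    unfolding alpha0_pr alpha1_pr using n3 by (auto intro!: B.pr_closed)
  moreover have "alpha0 n [^]\<^bsub>B\<^esub> (2 * n) = \<one>\<^bsub>B\<^esub>" "alpha1 n [^]\<^bsub>B\<^esub> (2 * (n - 1)) = \<one>\<^bsub>B\<^esub>"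
    unfolding alpha0_pr alpha1_pr by (rule B.delta_pow_2n B.alpha1_pow)+
  moreover have "2 * n > 0" "2 * (n - 1) > 0" using n3 by auto
  ultimately show ?thesis unfolding torsion_def by blast
qed

lemma generate_alphas: "generate B {alpha0 n, alpha1 n} = carrier B"
proof
  have sub: "{alpha0 n, alpha1 n} \<subseteq> carrier B" by (rule subset_trans[OF alphas_torsion torsion_subset])
  then show "generate B {alpha0 n, alpha1 n} \<subseteq> carrier B" by (rule B.generate_incl)
  have "sigma n ` {1..<n} \<subseteq> generate B {alpha0 n, alpha1 n}"
    unfolding alpha0_pr alpha1_pr using n3 by (intro B.generate_alpha0_alpha1) simp
  from B.generate_subgroup_incl[OF this B.generate_is_subgroup[OF sub]]
  show "carrier B \<subseteq> generate B {alpha0 n, alpha1 n}" by (simp only: generate_sigma)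
qed

lemma not_commutative: "sigma n 1 \<otimes>\<^bsub>B\<^esub> sigma n 2 \<noteq> sigma n 2 \<otimes>\<^bsub>B\<^esub> sigma n 1"
proof
  interpret p: group_hom B "sym_group n" "braid_perm n" by (rule braid_perm_group_hom)
  have s: "1 \<in> {1..<n}" "2 \<in> {1..<n}" using n3 by auto
  note c = sigma_closed[OF s(1)] sigma_closed[OF s(2)]
  assume "sigma n 1 \<otimes>\<^bsub>B\<^esub> sigma n 2 = sigma n 2 \<otimes>\<^bsub>B\<^esub> sigma n 1"
  then have "braid_perm n (sigma n 1 \<otimes>\<^bsub>B\<^esub> sigma n 2) 1 = braid_perm n (sigma n 2 \<otimes>\<^bsub>B\<^esub> sigma n 1) 1"
    by simp
  then show False
    unfolding p.hom_mult[OF c] p.hom_mult[OF c(2,1)] braid_perm_sigma[OF s(1)] braid_perm_sigma[OF s(2)]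
    by (simp add: sym_group_mult transpose_def)
qed

lemma sigmas_closed: "sigma n 1 \<in> carrier B" "sigma n 2 \<in> carrier B"
  using n3 by (auto intro!: sigma_closed)

lemma braid_ranks: "G_rank B = 2" "NG_rank B = 1" "TG_rank B = 2"
proof -
  have "TG_rank B \<le> ecard {alpha0 n, alpha1 n}"
    unfolding TG_rank_def
    by (rule INF_lower, rule CollectI, intro conjI alphas_torsion generate_alphas)
  then have "TG_rank B \<le> 2" by (rule order_trans[OF _ ecard_doubleton])
  moreover have "2 \<le> G_rank B" by (rule B.two_le_G[OF sigmas_closed not_commutative])
  ultimately show "G_rank B = 2" "TG_rank B = 2"
    using G_le_TG[of B] by auto
  have "normal_closure B {sigma n 1} = carrier B"
  proof
    have sub: "{sigma n 1} \<subseteq> carrier B" using sigmas_closed by simp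
    show "normal_closure B {sigma n 1} \<subseteq> carrier B" by (rule B.normal_closure_incl[OF sub])
    have N: "normal_closure B {sigma n 1} \<lhd> B" by (rule B.normal_normal_closure[OF sub])
    have "sigma n 1 \<in> normal_closure B {sigma n 1}" using normal_closure_subset by fastforce
    then have "sigma n ` {1..<n} \<subseteq> normal_closure B {sigma n 1}"
      using B.normal_subgroup_contains_all[OF N] by blast
    from B.generate_subgroup_incl[OF this normal_imp_subgroup[OF N]]
    show "carrier B \<subseteq> normal_closure B {sigma n 1}" by (simp only: generate_sigma)
  qed
  then have "NG_rank B \<le> ecard {sigma n 1}"
    unfolding NG_rank_def using sigmas_closed by (intro INF_lower) simp
  moreover have "1 \<le> NG_rank B"
  proof (rule B.one_le_NG)
    show "carrier B \<noteq> {\<one>\<^bsub>B\<^esub>}" using sigmas_closed not_commutative by auto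
  qed
  ultimately show "NG_rank B = 1" by (simp add: ecard_singleton)
qed

lemma kernel_alpha0:
  "normal_closure B {alpha0 n} = kernel B (integer_mod_group (n - 1)) (exponent_mod (n - 1))"
  unfolding alpha0_pr
proof (rule normal_closure_eq_kernel_exponent)
  fix G :: "nat word set set monoid" and s
  assume "sphere_braid_system G n s" and eq: "braid_system.pr G s [1..<n] = \<one>\<^bsub>G\<^esub>"
  then interpret G: sphere_braid_system G n s by simp
  show "(\<forall>i\<in>{1..<n}. s i = s 1) \<and> s 1 [^]\<^bsub>G\<^esub> (n - 1) = \<one>\<^bsub>G\<^esub>"
    using n3 by (intro conjI ballI G.collapse_alpha0[OF eq]) simp_all
qed (use pred_dvd in auto)

lemma kernel_alpha2:
  assumes "n \<noteq> 3"
  shows "normal_closure B {alpha2 n} = kernel B (integer_mod_group (n - 1)) (exponent_mod (n - 1))"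
  unfolding alpha2_pr
proof (rule normal_closure_eq_kernel_exponent)
  fix G :: "nat word set set monoid" and s
  assume "sphere_braid_system G n s" and eq: "braid_system.pr G s ([1..<n - 1] @ [n - 2]) = \<one>\<^bsub>G\<^esub>"
  then interpret G: sphere_braid_system G n s by simp
  have "4 \<le> n" using assms n3 by simp
  then show "(\<forall>i\<in>{1..<n}. s i = s 1) \<and> s 1 [^]\<^bsub>G\<^esub> (n - 1) = \<one>\<^bsub>G\<^esub>"
    by (intro conjI ballI G.collapse_alpha2[OF eq]) simp_all
next
  have "length ([1..<n - 1] @ [n - 2]) = n - 1" using n3 by simp
  then show "n - 1 dvd length ([1..<n - 1] @ [n - 2])" by simp
qed (use pred_dvd n3 in auto)

lemma kernel_alpha1:
  assumes "m = (if even n then 2 else 1)"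
  shows "normal_closure B {alpha1 n} = kernel B (integer_mod_group m) (exponent_mod m)"
  unfolding alpha1_pr
proof (rule normal_closure_eq_kernel_exponent)
  fix G :: "nat word set set monoid" and s
  assume "sphere_braid_system G n s" and eq: "braid_system.pr G s ([1..<n] @ [n - 1]) = \<one>\<^bsub>G\<^esub>"
  then interpret G: sphere_braid_system G n s by simp
  note k = G.collapse_alpha1[OF eq]
  have s1: "s 1 \<in> carrier G" using n3 by auto
  have "s 1 [^]\<^bsub>G\<^esub> m = \<one>\<^bsub>G\<^esub>"
  proof (cases "even n")
    case True
    then show ?thesis using k(2) assms by simp
  next
    case False
    then have "odd (n - 2)" using n3 by simp
    then obtain q where q: "n - 2 = 2 * q + 1" by (rule oddE)
    have "s 1 [^]\<^bsub>G\<^esub> (n - 2) = (s 1 [^]\<^bsub>G\<^esub> (2::nat)) [^]\<^bsub>G\<^esub> q \<otimes>\<^bsub>G\<^esub> s 1"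
      unfolding q using s1 by (simp add: G.nat_pow_pow)
    then have "s 1 = \<one>\<^bsub>G\<^esub>" using k(2,3) s1 by simp
    then show ?thesis by simp
  qed
  then show "(\<forall>i\<in>{1..<n}. s i = s 1) \<and> s 1 [^]\<^bsub>G\<^esub> m = \<one>\<^bsub>G\<^esub>"
    by (intro conjI ballI k(1)) simp_all
next
  show "m dvd length ([1..<n] @ [n - 1])" using n3 assms by auto
qed (use n3 assms in auto)

lemma normal_closure_alpha1_odd:
  assumes "odd n"
  shows "normal_closure B {alpha1 n} = carrier B"
proof -
  have "exponent_mod 1 x = 0" if "x \<in> carrier B" for x
    using hom_in_carrier[OF exponent_mod_hom[of 1] that] by (simp add: carrier_integer_mod_group)
  then show ?thesis
    using kernel_alpha1[of 1] assms by (auto simp: kernel_def)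
qed

lemma NTG_rank_odd: "odd n \<Longrightarrow> NTG_rank B = 1"
proof -
  assume odd: "odd n"
  have "NTG_rank B \<le> ecard {alpha1 n}"
    unfolding NTG_rank_def
    using alphas_torsion normal_closure_alpha1_odd[OF odd] by (intro INF_lower) simp
  then show "NTG_rank B = 1"
    using NG_le_NTG[of B] braid_ranks(2) by (simp add: ecard_singleton)
qed

lemma NTG_rank_even:
  assumes "even n"
  shows "NTG_rank B = 2"
proof (rule antisym)
  show "NTG_rank B \<le> 2" using NTG_le_TG[OF B.group_axioms] braid_ranks(3) by simp
  show "2 \<le> NTG_rank B"
    unfolding NTG_rank_def
  proof (rule INF_greatest, clarsimp)
    fix X assume X: "X \<subseteq> torsion B" "normal_closure B X = carrier B"
    show "2 \<le> ecard X"
    proof (rule ccontr)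
      assume "\<not> 2 \<le> ecard X"
      then have "ecard X < 2" by simp
      then show False
      proof (cases rule: ecard_less_2_cases)
        case 1
        then have "carrier B = {\<one>\<^bsub>B\<^esub>}" using X(2) B.normal_closure_empty by simp
        then show False using sigmas_closed not_commutative by auto
      next
        case (2 x)
        then show False using X no_normally_generating_torsion[OF assms] by auto
      qed
    qed
  qed
qed

end

text \<open>
  The sphere relation \<open>\<sigma>\<^sub>1 \<sigma>\<^sub>2\<^sup>2 \<sigma>\<^sub>1 = 1\<close> puts \<open>\<sigma>\<^sub>2\<^sup>2\<close> into the normal closure of
  \<open>\<alpha>\<^sub>2 = \<sigma>\<^sub>1\<^sup>2\<close>, which therefore consists of all pure braids.
\<close>

lemma three_strands_alpha2:
  "sphere_braid_group 3 Mod normal_closure (sphere_braid_group 3) {alpha2 3} \<cong> sym_group 3"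
proof -
  interpret sphere_braids 3 by unfold_locales simp
  interpret p: group_hom "sphere_braid_group 3" "sym_group 3" "braid_perm 3"
    by (rule braid_perm_group_hom)
  let ?B = "sphere_braid_group 3"
  let ?N = "normal_closure ?B {alpha2 3}"
  have s: "sigma 3 1 \<in> carrier ?B" "sigma 3 2 \<in> carrier ?B" by (rule sigmas_closed)+
  have a: "alpha2 3 = sigma 3 1 \<otimes>\<^bsub>?B\<^esub> sigma 3 1"
  proof -
    have "[1..<3 - 1] @ [3 - 2] = [1, 1::nat]" by (simp add: upt_rec)
    then show ?thesis unfolding alpha2_pr using s by (simp only: B.pr_simps B.r_one)
  qed
  have N: "?N \<lhd> ?B" using s a by (intro B.normal_normal_closure) simp
  have aN: "sigma 3 1 \<otimes>\<^bsub>?B\<^esub> sigma 3 1 \<in> ?N"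
    using normal_closure_subset[of "{alpha2 3}" ?B] a by simp
  have "B.pr ([1..<3] @ rev [1..<3]) = \<one>\<^bsub>?B\<^esub>" by (rule B.sphere)
  moreover have "[1..<3] @ rev [1..<3] = [1, 2, 2, 1::nat]" by (simp add: upt_rec)
  ultimately have "sigma 3 1 \<otimes>\<^bsub>?B\<^esub> (sigma 3 2 \<otimes>\<^bsub>?B\<^esub> sigma 3 2) \<otimes>\<^bsub>?B\<^esub> sigma 3 1 = \<one>\<^bsub>?B\<^esub>"
    using s by (simp add: B.m_assoc)
  then have "sigma 3 1 \<otimes>\<^bsub>?B\<^esub> (sigma 3 1 \<otimes>\<^bsub>?B\<^esub> (sigma 3 2 \<otimes>\<^bsub>?B\<^esub> sigma 3 2)) = \<one>\<^bsub>?B\<^esub>"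
    by (rule B.inv_comm) (use s in auto)
  then have "sigma 3 1 \<otimes>\<^bsub>?B\<^esub> sigma 3 1 \<otimes>\<^bsub>?B\<^esub> (sigma 3 2 \<otimes>\<^bsub>?B\<^esub> sigma 3 2) = \<one>\<^bsub>?B\<^esub>"
    using s by (simp add: B.m_assoc)
  then have "sigma 3 2 \<otimes>\<^bsub>?B\<^esub> sigma 3 2 \<otimes>\<^bsub>?B\<^esub> (sigma 3 1 \<otimes>\<^bsub>?B\<^esub> sigma 3 1) = \<one>\<^bsub>?B\<^esub>"
    by (rule B.inv_comm) (use s in auto)
  then have "sigma 3 2 \<otimes>\<^bsub>?B\<^esub> sigma 3 2 = inv\<^bsub>?B\<^esub> (sigma 3 1 \<otimes>\<^bsub>?B\<^esub> sigma 3 1)"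
    using s by (intro B.inv_equality[symmetric]) auto
  then have bN: "sigma 3 2 \<otimes>\<^bsub>?B\<^esub> sigma 3 2 \<in> ?N"
    using subgroup.m_inv_closed[OF normal_imp_subgroup[OF N] aN] by simp
  have "kernel ?B (sym_group 3) (braid_perm 3) = ?N"
  proof
    have "i = 1 \<or> i = 2" if "i \<in> {1..<3}" for i :: nat using that by auto
    then show "kernel ?B (sym_group 3) (braid_perm 3) \<subseteq> ?N"
      using aN bN by (intro kernel_braid_perm_subset[OF N]) metis
    have "1 \<in> {1..<3::nat}" by simp
    then have "alpha2 3 \<in> kernel ?B (sym_group 3) (braid_perm 3)"
      using s p.hom_mult[OF s(1) s(1)] braid_perm_sigma[of 1 3]
      by (simp add: a kernel_def sym_group_mult sym_group_one)
    then show "?N \<subseteq> kernel ?B (sym_group 3) (braid_perm 3)"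
      by (intro normal_closure_minimal p.normal_kernel) simp
  qed
  moreover have "braid_perm 3 ` carrier ?B = carrier (sym_group 3)"
  proof (rule card_subset_eq)
    show "finite (carrier (sym_group 3))"
      using sym_group_card_carrier[of 3] by (intro card_ge_0_finite) simp
    show "braid_perm 3 ` carrier ?B \<subseteq> carrier (sym_group 3)" by auto
    \<comment> \<open>The six permutations are told apart by their values at 1 and 2.\<close>
    let ?L = "{[], [1], [2], [1, 2], [2, 1], [1, 2, 1::nat]}"
    let ?v = "\<lambda>f::nat \<Rightarrow> nat. (f 1, f 2)"
    have "?v (word_perm (sigma_word l)) \<in> (?v ` (braid_perm 3 ` carrier ?B))" if "l \<in> ?L" for l
    proof -
      have "set l \<subseteq> {1..<3}" using that by auto
      from sigma_word_in_words[OF this] show ?thesis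
        using braid_perm_word_perm[of "sigma_word l"] class_closed[of "sigma_word l"] by force
    qed
    then have sub: "(\<lambda>l. ?v (word_perm (sigma_word l))) ` ?L \<subseteq> ?v ` (braid_perm 3 ` carrier ?B)" by blast
    have "(\<lambda>l. ?v (word_perm (sigma_word l))) ` ?L = {(1, 2), (2, 1), (1, 3), (2, 3), (3, 1), (3, 2)}"
      by (simp add: sigma_word_def adjacent_apply numeral_2_eq_2 numeral_3_eq_3)
    moreover have "card {(1, 2), (2, 1), (1, 3), (2, 3), (3, 1), (3, 2::nat)::nat \<times> nat} = 6" by simp
    moreover have fin: "finite (braid_perm 3 ` carrier ?B)"
      using \<open>finite (carrier (sym_group 3))\<close> \<open>braid_perm 3 ` carrier ?B \<subseteq> carrier (sym_group 3)\<close>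
      by (rule rev_finite_subset)
    ultimately have "6 \<le> card (?v ` (braid_perm 3 ` carrier ?B))"
      using card_mono[OF _ sub] by simp
    also have "\<dots> \<le> card (braid_perm 3 ` carrier ?B)" by (rule card_image_le[OF fin])
    finally have "6 \<le> card (braid_perm 3 ` carrier ?B)" .
    moreover have "card (carrier (sym_group 3)) = 6"
      using sym_group_card_carrier[of 3] by (simp add: eval_nat_numeral)
    moreover have "card (braid_perm 3 ` carrier ?B) \<le> card (carrier (sym_group 3))"
      by (intro card_mono) fact+
    ultimately show "card (braid_perm 3 ` carrier ?B) = card (carrier (sym_group 3))" by simp
  qed
  ultimately show ?thesis using p.FactGroup_iso by simp
qed

theorem theorem5:
  fixes n :: nat
  assumes "n \<ge> 3"
  defines "B \<equiv> sphere_braid_group n"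
    and "P \<equiv> sphere_pure_braid_group n"
  shows
    "(G_rank B = 2 \<and> NG_rank B = 1 \<and> TG_rank B = 2)
   \<and> (even n \<longrightarrow>
        \<not> (\<exists>x \<in> torsion B. normal_closure B {x} = carrier B)
      \<and> B Mod normal_closure B {alpha1 n} \<cong> integer_mod_group 2)
   \<and> (odd n \<longrightarrow> NTG_rank B = 1) \<and> (even n \<longrightarrow> NTG_rank B = 2)
   \<and> B Mod normal_closure B {alpha0 n} \<cong> integer_mod_group (n - 1)
   \<and> (n \<noteq> 3 \<longrightarrow> B Mod normal_closure B {alpha2 n} \<cong> integer_mod_group (n - 1))
   \<and> (n = 3 \<longrightarrow> B Mod normal_closure B {alpha2 n} \<cong> sym_group 3)
   \<and> G_rank P = enat ((n * (n - 3) + 2) div 2)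
   \<and> NG_rank P = enat ((n * (n - 3) + 2) div 2)
   \<and> G_rank (abelianisation P) = enat ((n * (n - 3) + 2) div 2)"
proof -
  interpret sphere_braids n by unfold_locales fact
  have q2: "B Mod normal_closure B {alpha1 n} \<cong> integer_mod_group 2" if "even n"
    unfolding B_def using kernel_alpha1[of 2] quotient_kernel_exponent[of 2] two_dvd that by simp
  have q0: "B Mod normal_closure B {alpha0 n} \<cong> integer_mod_group (n - 1)"
    unfolding B_def kernel_alpha0 using quotient_kernel_exponent[of "n - 1"] pred_dvd by simp
  have q2': "B Mod normal_closure B {alpha2 n} \<cong> integer_mod_group (n - 1)" if "n \<noteq> 3"
    unfolding B_def kernel_alpha2[OF that] using quotient_kernel_exponent[of "n - 1"] pred_dvd by simp
  have q3: "B Mod normal_closure B {alpha2 n} \<cong> sym_group 3" if "n = 3"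
    unfolding B_def that by (rule three_strands_alpha2)
  show ?thesis
    using q2 q0 q2' q3 braid_ranks no_normally_generating_torsion NTG_rank_odd NTG_rank_even pure_ranks
    unfolding B_def P_def by blast
qed

end
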